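(* Let $\sigma\in[-1,1]$, let $g\in H_0^2(\mathbb R)$ be real valued and compactly supported, fix $a\in(0,1)$ and $\epsilon>0$ (independent of $N$), and for $|E|\le2-\epsilon$ set $f(x):=g(N^a(x-E))$. Then the quantities $V_{\mathrm{tr}}^1,V_{\mathrm{tr}}^2,V_{\mathrm d}^1,V_{\mathrm d}^2,E_{\mathrm{tr}}$ and $C_N=C_N^{a,E}$ defined in the context have the following large $N$ asymptotics: $$V_{\mathrm{tr}}^1(f)=\frac{\|g\|_{\dot H^{1/2}}^2}{4\pi^2}+\mathcal O(N^{-a}),$$ $$V_{\mathrm{tr}}^2(f,\sigma)=\mathbf 1(\sigma=1)\frac{\|g\|_{\dot H^{1/2}}^2}{4\pi^2}+\mathbf 1(\sigma=-1)\mathbf 1(E=0)\frac{\langle g(x),g(-x)\rangle_{\dot H^{1/2}}}{4\pi^2}+\mathcal O(N^{-a}),$$ $$C_NV_{\mathrm d}^1(f)=\|g\|_{L^2}^2+\mathcal O(N^{-a}),$$ $$C_NV_{\mathrm d}^2(f,\sigma)=\mathbf 1(\sigma=1)\|g\|_{L^2}^2+\mathbf 1(\sigma=-1)\mathbf 1(E=0)\langle g(x),g(-x)\rangle_{L^2}+\mathcal O(N^{-a}),$$ $$-\tfrac12E_{\mathrm{tr}}(f,\sigma)=\mathbf 1(\sigma=-1)\mathbf 1(E=0)\frac{g(0)}2+\mathcal O(N^{-a}).$$ The implicit constants in the error terms depend only on $a$, $\epsilon$, $\|g\|_{H_0^2}$, $|\operatorname{supp}g|$ and on the moment constants $C_p$,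 and they are uniform in $E,\sigma$ in the following sense: in formulas containing $\mathbf 1(\sigma=1)$ the error is, when $\sigma\neq1$, uniform in $\sigma\le1-\epsilon'$ for any fixed $\epsilon'>0$; in formulas containing $\mathbf 1(\sigma=-1)$ the error is, when $\sigma\ne-1$, uniform in $\sigma\ge-1+\epsilon'$ for any fixed $\epsilon'>0$; in terms with $\mathbf 1(E=0)$ the error is, when $E\neq0$, uniform in $|E|\ge\epsilon'$ for any fixed $\epsilon'>0$; in all other terms it is uniform in $|E|\le2-\epsilon$.
   Context: Here $\sigma=\mathbf E\chi_{\mathrm{od}}^2$ is a parameter of a Wigner matrix with entries $w_{ab}\overset d=N^{-1/2}\chi_{\mathrm{od}}$ ($a<b$), $w_{aa}\overset d=N^{-1/2}\chi_{\mathrm d}$, centred, $\mathbf E|\chi_{\mathrm{od}}|^2=1$, and moments bounded by constants: $\mathbf E|\chi_{\mathrm d}|^p+\mathbf E|\chi_{\mathrm{od}}|^p\le C_p$; the quantities below are deterministic and depend on the matrix only through $\sigma$. $m(z)=\int_{-2}^2\frac{\sqrt{4-x^2}}{2\pi(x-z)}dx$, $\rho(z):=\frac1\pi|\operatorname{Im}m(z)|$, $C_N:=C_N^{a,E}:=N^a/\rho(E+\mathrm iN^{-a})$ for $a>0$. $\langle h\rangle_{\mathrm{sc}}:=\int_{-2}^2h(x)\frac{\sqrt{4-x^2}}{2\pi}dx$, $\langle h\rangle_{1/\mathrm{sc}}:=\int_{-2}^2\frac{h(x)}{\pi\sqrt{4-x^2}}dx$. For $|\sigma|<1$: $V_{\mathrm{tr}}^1(f):=\frac1{4\pi^2}\iint_{-2}^2\Big(\frac{f(x)-f(y)}{x-y}\Big)^2\frac{4-xy}{\sqrt{(4-x^2)(4-y^2)}}dxdy$,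 $V_{\mathrm{tr}}^2(f,\sigma):=\frac1{4\pi^2}\iint_{-2}^2f(x)f(y)\partial_x\partial_y\log\Big[\frac{(x-\sigma y)^2+(\sqrt{4-x^2}+\sigma\sqrt{4-y^2})^2}{(x-\sigma y)^2+(\sqrt{4-x^2}-\sigma\sqrt{4-y^2})^2}\Big]dxdy$, $V_{\mathrm d}^1(f):=\langle f^2\rangle_{\mathrm{sc}}-\langle f\rangle_{\mathrm{sc}}^2$, $V_{\mathrm d}^2(f,\sigma):=\frac1{4\pi^2}\iint_{-2}^2f(x)f(y)\frac{(1-\sigma^2)\sqrt{(4-x^2)(4-y^2)}}{\sigma^2(x^2+y^2)+(1-\sigma^2)^2-xy\sigma(1+\sigma^2)}dxdy-\langle f\rangle_{\mathrm{sc}}^2$, $E_{\mathrm{tr}}(f,\sigma):=\Big\langle f\Big(1-\frac{1-\sigma^2}{(1+\sigma)^2-\sigma x^2}\Big)\Big\rangle_{1/\mathrm{sc}}$; for $\sigma=\pm1$, $V_{\mathrm{tr}}^2,V_{\mathrm d}^2,E_{\mathrm{tr}}$ are defined as the limits $\sigma\to\pm1$. Inner products: $\langle f,g\rangle_{L^2}:=\int_{\mathbb R}f(x)g(x)dx$, $\langle f,g\rangle_{\dot H^{1/2}}:=\int_{\mathbb R^2}\frac{f(x)-f(y)}{x-y}\frac{g(x)-g(y)}{x-y}dxdy$, with associated norms; $g(-x)$ denotes the function $x\mapsto g(-x)$.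
   Formalization: The constants depend on a bound L with supp g contained in [-L,L] instead of on |supp g|; with the measure or diameter of the support the uniformity fails, since translating g by 5N^a keeps norm and |supp g| but makes f vanish on [-2,2]. *)

theory Defs
  imports "HOL-Analysis.Analysis"
begin

section \<open>The space $H^2_0(\mathbb R)$\<close>

definition supp :: "(real \<Rightarrow> real) \<Rightarrow> real set" where
  "supp g = closure {x. g x \<noteq> 0}"

definition test_function :: "(real \<Rightarrow> real) \<Rightarrow> bool" where
  "test_function \<phi> \<longleftrightarrow>
     (\<forall>n x. (deriv ^^ n) \<phi> differentiable (at x)) \<and> compact (supp \<phi>)"

definition square_integrable :: "(real \<Rightarrow> real) \<Rightarrow> bool" where
  "square_integrable g \<longleftrightarrow>
     g \<in> borel_measurable lborel \<and> integrable lborel (\<lambda>x. (g x)\<^sup>2)"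

definition L2_inner :: "(real \<Rightarrow> real) \<Rightarrow> (real \<Rightarrow> real) \<Rightarrow> real" where
  "L2_inner f g = (LINT x|lborel. f x * g x)"

definition L2_norm :: "(real \<Rightarrow> real) \<Rightarrow> real" where
  "L2_norm g = sqrt (L2_inner g g)"

definition weak_deriv :: "(real \<Rightarrow> real) \<Rightarrow> (real \<Rightarrow> real) \<Rightarrow> bool" where
  "weak_deriv g h \<longleftrightarrow>
     (\<forall>\<phi>. test_function \<phi> \<longrightarrow> L2_inner g (deriv \<phi>) = - L2_inner h \<phi>)"

text \<open>\<open>H20_derivs g g1 g2\<close>: the function \<open>g\<close> has the weak derivatives \<open>g1\<close> and \<open>g2\<close> of order
  one and two, all three are in $L^2$, and \<open>g\<close> is a limit of test functions in the $H^2$-norm.\<close>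

definition H20_derivs :: "(real \<Rightarrow> real) \<Rightarrow> (real \<Rightarrow> real) \<Rightarrow> (real \<Rightarrow> real) \<Rightarrow> bool" where
  "H20_derivs g g1 g2 \<longleftrightarrow>
     square_integrable g \<and> square_integrable g1 \<and> square_integrable g2 \<and>
     weak_deriv g g1 \<and> weak_deriv g1 g2 \<and>
     (\<exists>\<phi>. (\<forall>n. test_function (\<phi> n)) \<and>
          (\<lambda>n. L2_norm (\<lambda>x. g x - \<phi> n x)) \<longlonglongrightarrow> 0 \<and>
          (\<lambda>n. L2_norm (\<lambda>x. g1 x - deriv (\<phi> n) x)) \<longlonglongrightarrow> 0 \<and>
          (\<lambda>n. L2_norm (\<lambda>x. g2 x - deriv (deriv (\<phi> n)) x)) \<longlonglongrightarrow> 0)"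

text \<open>Every class in $H^2_0(\mathbb R)$ has exactly one continuous representative, and it is the
  one meant when \<open>g\<close> is evaluated at a point.\<close>

definition H20 :: "(real \<Rightarrow> real) set" where
  "H20 = {g. continuous_on UNIV g \<and> (\<exists>g1 g2. H20_derivs g g1 g2)}"

text \<open>Weak derivatives are unique almost everywhere, so the norm does not depend on the choice.\<close>

definition H20_norm :: "(real \<Rightarrow> real) \<Rightarrow> real" where
  "H20_norm g =
     (let (g1, g2) = (SOME (g1, g2). H20_derivs g g1 g2)
      in sqrt ((L2_norm g)\<^sup>2 + (L2_norm g1)\<^sup>2 + (L2_norm g2)\<^sup>2))"

text \<open>Real valued compactly supported functions in $H^2_0(\mathbb R)$ with norm at most \<open>K\<close> and
  support in \<open>[-L, L]\<close>. Bounding the measure or the diameter of the support instead would allow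
  arbitrary translates of \<open>g\<close>, whose rescaled version may sit at the edge of \<open>[-2, 2]\<close> or
  outside of it, and no estimate is uniform over those.\<close>

definition H20_ball :: "real \<Rightarrow> real \<Rightarrow> (real \<Rightarrow> real) set" where
  "H20_ball K L = {g \<in> H20. compact (supp g) \<and> H20_norm g \<le> K \<and> supp g \<subseteq> {-L..L}}"

definition Hhalf_inner :: "(real \<Rightarrow> real) \<Rightarrow> (real \<Rightarrow> real) \<Rightarrow> real" where
  "Hhalf_inner f g =
     (LINT p|(lborel :: (real \<times> real) measure).
        (case p of (x, y) \<Rightarrow> (f x - f y) / (x - y) * ((g x - g y) / (x - y))))"

definition Hhalf_norm :: "(real \<Rightarrow> real) \<Rightarrow> real" where
  "Hhalf_norm g = sqrt (Hhalf_inner g g)"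

section \<open>Semicircle law and scaling\<close>

definition m_sc :: "complex \<Rightarrow> complex" where
  "m_sc z = (LINT x:{-2..2}|lborel.
     complex_of_real (sqrt (4 - x\<^sup>2) / (2 * pi)) / (complex_of_real x - z))"

definition rho :: "complex \<Rightarrow> real" where
  "rho z = \<bar>Im (m_sc z)\<bar> / pi"

definition C_N :: "real \<Rightarrow> real \<Rightarrow> nat \<Rightarrow> real" where
  "C_N a E N = real N powr a / rho (Complex E (real N powr (- a)))"

definition rescale :: "real \<Rightarrow> real \<Rightarrow> nat \<Rightarrow> (real \<Rightarrow> real) \<Rightarrow> real \<Rightarrow> real" where
  "rescale a E N g = (\<lambda>x. g (real N powr a * (x - E)))"

definition avg_sc :: "(real \<Rightarrow> real) \<Rightarrow> real" where
  "avg_sc h = (LINT x:{-2..2}|lborel. h x * sqrt (4 - x\<^sup>2) / (2 * pi))"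

definition avg_inv_sc :: "(real \<Rightarrow> real) \<Rightarrow> real" where
  "avg_inv_sc h = (LINT x:{-2..2}|lborel. h x / (pi * sqrt (4 - x\<^sup>2)))"

section \<open>Variances and expectation\<close>

definition integral_sq :: "(real \<Rightarrow> real \<Rightarrow> real) \<Rightarrow> real" where
  "integral_sq F =
     (LINT p:{-2..2} \<times> {-2..2}|(lborel :: (real \<times> real) measure). (case p of (x, y) \<Rightarrow> F x y))"

text \<open>Extension to \<open>\<sigma> = 1\<close> and \<open>\<sigma> = - 1\<close> by the limit from inside \<open>(-1, 1)\<close>.\<close>

definition extend_limit :: "(real \<Rightarrow> real) \<Rightarrow> real \<Rightarrow> real" where
  "extend_limit V \<sigma> = (if \<bar>\<sigma>\<bar> < 1 then V \<sigma> else Lim (at \<sigma> within {-1<..<1}) V)"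

definition V_tr1 :: "(real \<Rightarrow> real) \<Rightarrow> real" where
  "V_tr1 f = 1 / (4 * pi\<^sup>2) *
     integral_sq (\<lambda>x y. ((f x - f y) / (x - y))\<^sup>2 *
       ((4 - x * y) / sqrt ((4 - x\<^sup>2) * (4 - y\<^sup>2))))"

definition log_kernel :: "real \<Rightarrow> real \<Rightarrow> real \<Rightarrow> real" where
  "log_kernel \<sigma> x y =
     ln (((x - \<sigma> * y)\<^sup>2 + (sqrt (4 - x\<^sup>2) + \<sigma> * sqrt (4 - y\<^sup>2))\<^sup>2) /
         ((x - \<sigma> * y)\<^sup>2 + (sqrt (4 - x\<^sup>2) - \<sigma> * sqrt (4 - y\<^sup>2))\<^sup>2))"

definition V_tr2 :: "(real \<Rightarrow> real) \<Rightarrow> real \<Rightarrow> real" where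
  "V_tr2 f = extend_limit (\<lambda>\<sigma>. 1 / (4 * pi\<^sup>2) *
     integral_sq (\<lambda>x y. f x * f y * deriv (\<lambda>u. deriv (\<lambda>v. log_kernel \<sigma> u v) y) x))"

definition V_d1 :: "(real \<Rightarrow> real) \<Rightarrow> real" where
  "V_d1 f = avg_sc (\<lambda>x. (f x)\<^sup>2) - (avg_sc f)\<^sup>2"

definition V_d2 :: "(real \<Rightarrow> real) \<Rightarrow> real \<Rightarrow> real" where
  "V_d2 f = extend_limit (\<lambda>\<sigma>. 1 / (4 * pi\<^sup>2) *
     integral_sq (\<lambda>x y. f x * f y *
       ((1 - \<sigma>\<^sup>2) * sqrt ((4 - x\<^sup>2) * (4 - y\<^sup>2)) /
        (\<sigma>\<^sup>2 * (x\<^sup>2 + y\<^sup>2) + (1 - \<sigma>\<^sup>2)\<^sup>2 - x * y * \<sigma> * (1 + \<sigma>\<^sup>2))))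
     - (avg_sc f)\<^sup>2)"

definition E_tr :: "(real \<Rightarrow> real) \<Rightarrow> real \<Rightarrow> real" where
  "E_tr f = extend_limit (\<lambda>\<sigma>.
     avg_inv_sc (\<lambda>x. f x * (1 - (1 - \<sigma>\<^sup>2) / ((1 + \<sigma>)\<^sup>2 - \<sigma> * x\<^sup>2))))"

end

theory Submission
  imports Defs
begin

text \<open>In the angles \<open>x = 2 cos \<alpha>\<close>, \<open>y = 2 cos \<beta>\<close> all \<open>\<sigma>\<close>-dependent kernels are built from
  Poisson kernels at \<open>\<alpha> \<plusminus> \<beta>\<close>. Their marginals are explicit: \<open>0\<close> for the kernel of \<^const>\<open>V_tr2\<close>,
  \<open>2 \<pi> sqrt (4 - x\<^sup>2)\<close> for that of \<^const>\<open>V_d2\<close>, \<open>1\<close> for that of \<^const>\<open>E_tr\<close>. Polarizing \<open>f(x) f(y)\<close>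
  into the marginal and \<open>(f(x) - f(y))\<^sup>2\<close> therefore yields the exact limits at \<open>\<sigma> = 1\<close>, namely
  \<open>V_tr2 f 1 = V_tr1 f\<close> and \<open>V_d2 f 1 = V_d1 f\<close>; the limits at \<open>\<sigma> = - 1\<close> are the same with the
  second copy of \<open>f\<close> reflected at \<open>0\<close>, since \<open>\<sigma> \<mapsto> - \<sigma>\<close> amounts to \<open>y \<mapsto> - y\<close>. For \<open>\<sigma>\<close> away
  from \<open>\<plusminus> 1\<close> the kernels are bounded on the bulk, so the quantities are as small as a power of
  \<open>\<integral>|f| = O(N\<^sup>-\<^sup>a)\<close>. What remains is \<open>V_tr1\<close>, whose weight is \<open>1 + O((x - y)\<^sup>2)\<close> near the
  diagonal, and the bulk expansion of \<^const>\<open>rho\<close>, where the linear Taylor term cancels by symmetry of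
  the Poisson kernel. Of \<open>g\<close> only its Lipschitz constant, its supremum and its support matter.\<close>

section \<open>Integrals over the square\<close>

text \<open>The values at \<sigma> = 1 and \<sigma> = -1 are given by \<open>Lim\<close>, so
  convergence itself has to be proved. As \<sigma> tends to 1 the kernels blow up or concentrate on
  the diagonal, so dominated convergence does not apply to \<open>f x * f y\<close> times the
  kernel. After polarization the kernel meets only a product of two increments, which for Lipschitz
  functions is at most a constant times (x - y)^2. This cancels the (x - y)^-2 of the logarithmic
  kernel and makes the remainder of the other kernel O(1 - \<sigma>^2). The Lipschitz constant of
  the rescaled function grows like N^a. It is harmless because these limits are taken at fixed N and
  yield exact identities; the error terms see only the supremum, the support and the distance to the
  edges. The singularities at 2 and -2 are all of the type 1 / \<open>edge\<close>, which is
  integrable on [-2, 2]. Since division by zero gives 0, every pointwise bound also has a meaning at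
  the edges and on the diagonal, and has to be checked there.\<close>

definition sq_integrable :: "(real \<Rightarrow> real \<Rightarrow> real) \<Rightarrow> bool" where
  "sq_integrable F \<longleftrightarrow> set_integrable lborel ({-2..2} \<times> {-2..2}) (\<lambda>(x, y). F x y)"

text \<open>A non-integrable \<open>f\<close> has integral 0 by convention, and \<open>g\<close> is
  nonnegative since it dominates an absolute value. Estimates can thus be made before the
  integrability of the integrand is discussed.\<close>

lemma abs_integral_le:
  fixes f g :: "'a \<Rightarrow> real"
  assumes "integrable M g" and "\<And>x. \<bar>f x\<bar> \<le> g x"
  shows "\<bar>integral\<^sup>L M f\<bar> \<le> integral\<^sup>L M g"
proof (cases "integrable M f")
  case True
  then have "\<bar>integral\<^sup>L M f\<bar> \<le> (\<integral>x. \<bar>f x\<bar> \<partial>M)"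
    using integral_norm_bound[of M f] by simp
  also have "\<dots> \<le> integral\<^sup>L M g"
    by (rule integral_mono) (use True assms in auto)
  finally show ?thesis .
next
  case False
  have "0 \<le> g x" for x
    using assms(2)[of x] by linarith
  then show ?thesis
    using False by (simp add: not_integrable_integral_eq)
qed

lemma abs_set_integral_le:
  fixes f g :: "real \<Rightarrow> real"
  assumes "set_integrable lborel A g" and "\<And>x. x \<in> A \<Longrightarrow> \<bar>f x\<bar> \<le> g x"
  shows "\<bar>LINT x:A|lborel. f x\<bar> \<le> (LINT x:A|lborel. g x)"
  using assms unfolding set_lebesgue_integral_def set_integrable_def
  by (intro abs_integral_le) (auto split: split_indicator)

lemma set_integrable_bound_real:
  fixes f g :: "real \<Rightarrow> real"
  assumes "set_integrable lborel A g" and "f \<in> borel_measurable borel" and "A \<in> sets borel"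
    and "\<And>x. x \<in> A \<Longrightarrow> \<bar>f x\<bar> \<le> g x"
  shows "set_integrable lborel A f"
  using assms unfolding set_integrable_def
  by (intro Bochner_Integration.integrable_bound[OF assms(1)[unfolded set_integrable_def]])
    (auto simp: indicator_def intro: order_trans[OF _ abs_ge_self])

lemma
  fixes u v :: "real \<Rightarrow> real"
  assumes u: "integrable lborel u" and v: "integrable lborel v"
  shows integrable_tensor: "integrable (lborel :: (real \<times> real) measure) (\<lambda>(x, y). u x * v y)"
    and integral_tensor: "(LINT p|(lborel :: (real \<times> real) measure). (case p of (x, y) \<Rightarrow> u x * v y))
      = integral\<^sup>L lborel u * integral\<^sup>L lborel v"
proof -
  have [measurable]: "u \<in> borel_measurable borel" "v \<in> borel_measurable borel"
    using u v by auto
  have *: "integrable (lborel \<Otimes>\<^sub>M lborel) (\<lambda>(x, y). u x * v y)"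
    by (rule lborel_pair.Fubini_integrable) (use u v in \<open>auto simp: abs_mult\<close>)
  then show "integrable (lborel :: (real \<times> real) measure) (\<lambda>(x, y). u x * v y)"
    by (simp add: lborel_prod)
  show "(LINT p|(lborel :: (real \<times> real) measure). (case p of (x, y) \<Rightarrow> u x * v y))
      = integral\<^sup>L lborel u * integral\<^sup>L lborel v"
    unfolding lborel_prod[symmetric] using lborel_pair.integral_fst'[OF *] by simp
qed

lemma
  fixes u v :: "real \<Rightarrow> real"
  assumes u: "set_integrable lborel {-2..2} u" and v: "set_integrable lborel {-2..2} v"
  shows sq_integrable_tensor: "sq_integrable (\<lambda>x y. u x * v y)"
    and integral_sq_tensor:
      "integral_sq (\<lambda>x y. u x * v y) = (LINT x:{-2..2}|lborel. u x) * (LINT x:{-2..2}|lborel. v x)"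
proof -
  have eq: "(\<lambda>p. indicator ({-2..2} \<times> {-2..2}) p *\<^sub>R (case p of (x, y) \<Rightarrow> u x * v y))
      = (\<lambda>(x, y). (indicator {-2..2} x *\<^sub>R u x) * (indicator {-2..2} y *\<^sub>R v y))"
    by (auto simp: fun_eq_iff indicator_def)
  show "sq_integrable (\<lambda>x y. u x * v y)"
    using integrable_tensor[OF u[unfolded set_integrable_def] v[unfolded set_integrable_def]]
    by (simp only: sq_integrable_def set_integrable_def eq)
  show "integral_sq (\<lambda>x y. u x * v y) = (LINT x:{-2..2}|lborel. u x) * (LINT x:{-2..2}|lborel. v x)"
    using integral_tensor[OF u[unfolded set_integrable_def] v[unfolded set_integrable_def]]
    by (simp only: integral_sq_def set_lebesgue_integral_def eq)
qed

lemma sq_integrable_cmult: "sq_integrable F \<Longrightarrow> sq_integrable (\<lambda>x y. c * F x y)"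
  unfolding sq_integrable_def using set_integrable_mult_right[of c lborel _ "\<lambda>(x, y). F x y"]
  by (simp add: case_prod_unfold)

lemma integral_sq_cmult: "integral_sq (\<lambda>x y. c * F x y) = c * integral_sq F"
  unfolding integral_sq_def using set_integral_mult_right[of lborel _ c "\<lambda>(x, y). F x y"]
  by (simp add: case_prod_unfold)

lemma sq_integrable_add:
  "sq_integrable F \<Longrightarrow> sq_integrable G \<Longrightarrow> sq_integrable (\<lambda>x y. F x y + G x y)"
  unfolding sq_integrable_def
  using set_integral_add(1)[of lborel _ "\<lambda>(x, y). F x y" "\<lambda>(x, y). G x y"]
  by (simp add: case_prod_unfold)

lemma integral_sq_add:
  "sq_integrable F \<Longrightarrow> sq_integrable G \<Longrightarrow>
    integral_sq (\<lambda>x y. F x y + G x y) = integral_sq F + integral_sq G"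
  unfolding sq_integrable_def integral_sq_def
  using set_integral_add(2)[of lborel _ "\<lambda>(x, y). F x y" "\<lambda>(x, y). G x y"]
  by (simp add: case_prod_unfold)

lemma integral_sq_cong:
  "(\<And>x y. \<bar>x\<bar> \<le> 2 \<Longrightarrow> \<bar>y\<bar> \<le> 2 \<Longrightarrow> F x y = G x y) \<Longrightarrow> integral_sq F = integral_sq G"
  unfolding integral_sq_def set_lebesgue_integral_def
  by (intro Bochner_Integration.integral_cong) (auto split: split_indicator simp: abs_le_iff)

lemma sq_integrable_bound:
  assumes [measurable]: "(\<lambda>(x, y). F x y) \<in> borel_measurable (borel \<Otimes>\<^sub>M borel)" and G: "sq_integrable G"
    and "\<And>x y. \<bar>x\<bar> \<le> 2 \<Longrightarrow> \<bar>y\<bar> \<le> 2 \<Longrightarrow> \<bar>F x y\<bar> \<le> G x y"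
  shows "sq_integrable F"
  unfolding sq_integrable_def set_integrable_def
proof (rule Bochner_Integration.integrable_bound)
  show "integrable lborel (\<lambda>p. indicator ({-2..2} \<times> {-2..2}) p *\<^sub>R (case p of (x, y) \<Rightarrow> G x y))"
    using G unfolding sq_integrable_def set_integrable_def .
  have "(\<lambda>p. indicator ({-2..2} \<times> {-2..2}) p *\<^sub>R (case p of (x, y) \<Rightarrow> F x y))
      \<in> borel_measurable (borel \<Otimes>\<^sub>M borel)"
    by measurable
  then show "(\<lambda>p. indicator ({-2..2} \<times> {-2..2}) p *\<^sub>R (case p of (x, y) \<Rightarrow> F x y))
      \<in> borel_measurable lborel"
    by (simp add: borel_prod)
  show "AE p in lborel. norm (indicator ({-2..2} \<times> {-2..2}) p *\<^sub>R (case p of (x, y) \<Rightarrow> F x y))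
      \<le> norm (indicator ({-2..2} \<times> {-2..2}) p *\<^sub>R (case p of (x, y) \<Rightarrow> G x y))"
    using assms(3) by (intro AE_I2) (force simp: indicator_def abs_le_iff intro: order_trans[OF _ abs_ge_self])
qed

lemma abs_integral_sq_le:
  assumes "sq_integrable G"
    and "\<And>x y. \<bar>x\<bar> \<le> 2 \<Longrightarrow> \<bar>y\<bar> \<le> 2 \<Longrightarrow> \<bar>F x y\<bar> \<le> G x y"
  shows "\<bar>integral_sq F\<bar> \<le> integral_sq G"
  using assms unfolding integral_sq_def sq_integrable_def set_lebesgue_integral_def set_integrable_def
  by (intro abs_integral_le) (auto simp: indicator_def abs_le_iff)

lemma integral_sq_fst:
  assumes "sq_integrable F"
  shows "integral_sq F = (LINT x:{-2..2}|lborel. LINT y:{-2..2}|lborel. F x y)"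
proof -
  have "integrable (lborel \<Otimes>\<^sub>M lborel) (\<lambda>p. indicator ({-2..2} \<times> {-2..2}) p *\<^sub>R (case p of (x, y) \<Rightarrow> F x y))"
    using assms unfolding sq_integrable_def set_integrable_def by (simp add: lborel_prod)
  from lborel_pair.integral_fst'[OF this]
  have "integral_sq F =
      (LINT x|lborel. LINT y|lborel. indicator ({-2..2} \<times> {-2..2}) (x, y) *\<^sub>R F x y)"
    unfolding integral_sq_def set_lebesgue_integral_def lborel_prod by simp
  also have "\<dots> = (LINT x:{-2..2}|lborel. LINT y:{-2..2}|lborel. F x y)"
    unfolding set_lebesgue_integral_def
    by (intro Bochner_Integration.integral_cong refl) (simp add: indicator_times mult.assoc)
  finally show ?thesis .
qed

lemma
  assumes "sq_integrable F"
  shows sq_integrable_swap: "sq_integrable (\<lambda>x y. F y x)"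
    and integral_sq_swap: "integral_sq (\<lambda>x y. F y x) = integral_sq F"
proof -
  let ?F = "\<lambda>p. indicator ({-2..2} \<times> {-2..2}) p *\<^sub>R (case p of (x, y) \<Rightarrow> F x y)"
  have *: "integrable (lborel \<Otimes>\<^sub>M lborel) ?F"
    using assms unfolding sq_integrable_def set_integrable_def by (simp add: lborel_prod)
  have eq: "(\<lambda>(x, y). ?F (y, x)) = (\<lambda>p. indicator ({-2..2} \<times> {-2..2}) p *\<^sub>R (case p of (x, y) \<Rightarrow> F y x))"
    by (auto simp: fun_eq_iff indicator_def)
  show "sq_integrable (\<lambda>x y. F y x)"
    using lborel_pair.integrable_product_swap[OF *]
    unfolding eq sq_integrable_def set_integrable_def by (simp add: lborel_prod)
  show "integral_sq (\<lambda>x y. F y x) = integral_sq F"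
    using lborel_pair.integral_product_swap[of ?F] *
    unfolding eq integral_sq_def set_lebesgue_integral_def by (simp add: lborel_prod)
qed

text \<open>Convergence within \<open>T\<close> is tested along sequences in \<open>T\<close> that
  avoid \<open>t0\<close>. The majorant is only available near \<open>t0\<close>, so an initial
  segment of each sequence is dropped and restored at the end by
  \<open>LIMSEQ_offset\<close>.\<close>

lemma integral_dominated_convergence_within:
  fixes f :: "real \<Rightarrow> 'a \<Rightarrow> real"
  assumes "g \<in> borel_measurable M" and "\<And>t. t \<in> T \<Longrightarrow> f t \<in> borel_measurable M" and "integrable M w"
    and ev: "\<forall>\<^sub>F t in at t0 within T. \<forall>x. \<bar>f t x\<bar> \<le> w x"
    and "\<And>x. ((\<lambda>t. f t x) \<longlongrightarrow> g x) (at t0 within T)"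
  shows "((\<lambda>t. integral\<^sup>L M (f t)) \<longlongrightarrow> integral\<^sup>L M g) (at t0 within T)"
  unfolding tendsto_at_iff_sequentially comp_def
proof (intro allI impI)
  fix X :: "nat \<Rightarrow> real"
  assume X: "\<forall>i. X i \<in> T - {t0}" and lim: "X \<longlonglongrightarrow> t0"
  have F: "filterlim X (at t0 within T) sequentially"
    using X lim by (auto simp: filterlim_at)
  obtain n0 where n0: "\<And>n. n \<ge> n0 \<Longrightarrow> \<forall>x. \<bar>f (X n) x\<bar> \<le> w x"
    using eventually_compose_filterlim[OF ev F]
    unfolding eventually_sequentially by blast
  have "(\<lambda>n. integral\<^sup>L M (f (X (n + n0)))) \<longlonglongrightarrow> integral\<^sup>L M g"
  proof (rule integral_dominated_convergence)
    show "AE x in M. (\<lambda>i. f (X (i + n0)) x) \<longlonglongrightarrow> g x"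
      using LIMSEQ_ignore_initial_segment[OF filterlim_compose[OF assms(5) F]] by (intro AE_I2) simp
    show "\<And>i. f (X (i + n0)) \<in> borel_measurable M"
      using X assms(2) by auto
    show "\<And>i. AE x in M. norm (f (X (i + n0)) x) \<le> w x"
      using n0 by auto
  qed (use assms in auto)
  then show "(\<lambda>n. integral\<^sup>L M (f (X n))) \<longlonglongrightarrow> integral\<^sup>L M g"
    by (rule LIMSEQ_offset)
qed

lemma integral_sq_dominated_convergence:
  fixes F :: "real \<Rightarrow> real \<Rightarrow> real \<Rightarrow> real"
  assumes [measurable]: "(\<lambda>(x, y). G x y) \<in> borel_measurable (borel \<Otimes>\<^sub>M borel)"
    and m: "\<And>t. t \<in> T \<Longrightarrow> (\<lambda>(x, y). F t x y) \<in> borel_measurable (borel \<Otimes>\<^sub>M borel)"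
    and W: "sq_integrable W"
    and ev: "\<forall>\<^sub>F t in at t0 within T. \<forall>x y. \<bar>x\<bar> \<le> 2 \<longrightarrow> \<bar>y\<bar> \<le> 2 \<longrightarrow> \<bar>F t x y\<bar> \<le> W x y"
    and lim: "\<And>x y. \<bar>x\<bar> \<le> 2 \<Longrightarrow> \<bar>y\<bar> \<le> 2 \<Longrightarrow> ((\<lambda>t. F t x y) \<longlongrightarrow> G x y) (at t0 within T)"
  shows "((\<lambda>t. integral_sq (F t)) \<longlongrightarrow> integral_sq G) (at t0 within T)"
  unfolding integral_sq_def set_lebesgue_integral_def
proof (rule integral_dominated_convergence_within)
  let ?I = "indicator ({-2..2} \<times> {-2..2}) :: real \<times> real \<Rightarrow> real"
  have "(\<lambda>p. ?I p *\<^sub>R (case p of (x, y) \<Rightarrow> G x y)) \<in> borel_measurable (borel \<Otimes>\<^sub>M borel)"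
    by measurable
  then show "(\<lambda>p. ?I p *\<^sub>R (case p of (x, y) \<Rightarrow> G x y)) \<in> borel_measurable lborel"
    by (simp add: borel_prod)
  show "(\<lambda>p. ?I p *\<^sub>R (case p of (x, y) \<Rightarrow> F t x y)) \<in> borel_measurable lborel" if "t \<in> T" for t
  proof -
    note [measurable] = m[OF that]
    have "(\<lambda>p. ?I p *\<^sub>R (case p of (x, y) \<Rightarrow> F t x y)) \<in> borel_measurable (borel \<Otimes>\<^sub>M borel)"
      by measurable
    then show ?thesis by (simp add: borel_prod)
  qed
  show "integrable lborel (\<lambda>p. ?I p *\<^sub>R (case p of (x, y) \<Rightarrow> W x y))"
    using W unfolding sq_integrable_def set_integrable_def .
  show "\<forall>\<^sub>F t in at t0 within T. \<forall>p. \<bar>?I p *\<^sub>R (case p of (x, y) \<Rightarrow> F t x y)\<bar>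
      \<le> ?I p *\<^sub>R (case p of (x, y) \<Rightarrow> W x y)"
    using ev by eventually_elim (auto simp: indicator_def abs_le_iff)
  show "((\<lambda>t. ?I p *\<^sub>R (case p of (x, y) \<Rightarrow> F t x y)) \<longlongrightarrow> ?I p *\<^sub>R (case p of (x, y) \<Rightarrow> G x y))
      (at t0 within T)" for p
  proof (cases "p \<in> {-2..2} \<times> {-2..2}")
    case True
    then show ?thesis
      using lim[of "fst p" "snd p"] by (auto simp: abs_le_iff)
  qed auto
qed

lemma has_integral_imp_set_lebesgue:
  fixes f :: "real \<Rightarrow> real"
  assumes "set_integrable lborel A f" and "(f has_integral I) A"
  shows "(LINT x:A|lborel. f x) = I"
  using set_borel_integral_eq_integral(2)[OF assms(1)] assms(2) by (simp add: integral_unique)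

section \<open>The logarithmic kernel\<close>

text \<open>Equal to 2 sin \<alpha> when x = 2 cos \<alpha> with \<alpha> in [0, \<pi>]. The real
  square root is odd, so the value is negative for |x| > 2; hence the explicit range conditions
  below.\<close>

definition edge :: "real \<Rightarrow> real" where
  "edge x = sqrt (4 - x\<^sup>2)"

lemma abs_le_2_square: "\<bar>x\<bar> \<le> 2 \<Longrightarrow> x\<^sup>2 \<le> (4::real)"
  using abs_le_square_iff[of x 2] by simp

lemma abs_less_2_square: "\<bar>x\<bar> < 2 \<Longrightarrow> x\<^sup>2 < (4::real)"
  using power_strict_mono[of "\<bar>x\<bar>" 2 2] by simp

lemma edge_square: "\<bar>x\<bar> \<le> 2 \<Longrightarrow> (edge x)\<^sup>2 = 4 - x\<^sup>2"
  using abs_le_2_square[of x] by (simp add: edge_def)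

lemma edge_nonneg: "\<bar>x\<bar> \<le> 2 \<Longrightarrow> 0 \<le> edge x"
  using abs_le_2_square[of x] by (simp add: edge_def)

lemma edge_pos: "\<bar>x\<bar> < 2 \<Longrightarrow> 0 < edge x"
  using abs_less_2_square[of x] by (simp add: edge_def)

lemma edge_le_2: "edge x \<le> 2"
  unfolding edge_def by (rule real_le_lsqrt) auto

lemma edge_2 [simp]: "edge 2 = 0" "edge (-2) = 0"
  by (auto simp: edge_def)

lemma edge_minus [simp]: "edge (- x) = edge x"
  by (simp add: edge_def)

text \<open>4 - (2 - \<delta>)^2 = \<delta> (4 - \<delta>) is at least \<delta>^2, because the
  hypotheses force \<delta> \<le> 2.\<close>

lemma edge_ge:
  assumes "\<bar>x\<bar> \<le> 2 - \<delta>" "0 \<le> \<delta>"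
  shows "\<delta> \<le> edge x"
  unfolding edge_def
proof (rule real_le_rsqrt)
  have "x\<^sup>2 \<le> (2 - \<delta>)\<^sup>2"
    using assms abs_le_square_iff[of x "2 - \<delta>"] by auto
  moreover have "0 \<le> \<delta> * (2 - \<delta>)"
    using assms by (intro mult_nonneg_nonneg) auto
  ultimately show "\<delta>\<^sup>2 \<le> 4 - x\<^sup>2"
    by (simp add: power2_eq_square algebra_simps)
qed

lemma sqrt_edge: "sqrt ((4 - x\<^sup>2) * (4 - y\<^sup>2)) = edge x * edge y"
  by (simp add: edge_def real_sqrt_mult)

lemma continuous_on_edge [continuous_intros]:
  "continuous_on A f \<Longrightarrow> continuous_on A (\<lambda>x. edge (f x))"
  unfolding edge_def by (intro continuous_intros)

lemma borel_measurable_edge [measurable]: "edge \<in> borel_measurable borel"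
  by (intro borel_measurable_continuous_onI continuous_intros)

lemma DERIV_edge:
  assumes "\<bar>x\<bar> < 2"
  shows "(edge has_real_derivative - x / edge x) (at x)"
  unfolding edge_def using abs_less_2_square[OF assms]
  by (auto intro!: derivative_eq_intros simp: field_simps)

text \<open>The primitive arcsin (x / 2) is continuous up to the endpoints although the integrand is
  unbounded there, so the fundamental theorem with interior derivatives applies. This function is
  the universal majorant of the development.\<close>

lemma has_integral_inverse_edge: "((\<lambda>x. 1 / edge x) has_integral pi) {-2..2}"
proof -
  have "((\<lambda>x. 1 / edge x) has_integral (arcsin (2 / 2) - arcsin (- 2 / 2))) {-2..2}"
  proof (rule fundamental_theorem_of_calculus_interior)
    show "continuous_on {-2..2} (\<lambda>x::real. arcsin (x / 2))"
      by (intro continuous_intros) auto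
    fix x :: real
    assume "x \<in> {-2<..<2}"
    then have x: "\<bar>x\<bar> < 2" by auto
    have *: "sqrt (1 - (x / 2)\<^sup>2) = edge x / 2"
    proof -
      have "sqrt (1 - (x / 2)\<^sup>2) = sqrt ((4 - x\<^sup>2) / 4)"
        by (rule arg_cong[where f = sqrt]) (simp add: power2_eq_square field_simps)
      also have "\<dots> = edge x / 2" by (simp only: real_sqrt_divide edge_def real_sqrt_four)
      finally show ?thesis .
    qed
    show "((\<lambda>x. arcsin (x / 2)) has_vector_derivative 1 / edge x) (at x)"
      unfolding has_real_derivative_iff_has_vector_derivative[symmetric]
    proof -
      have "((\<lambda>x. arcsin (x / 2)) has_real_derivative inverse (sqrt (1 - (x / 2)\<^sup>2)) * (1 / 2)) (at x)"
        by (rule DERIV_chain2[OF DERIV_arcsin]) (use x in \<open>auto intro!: derivative_eq_intros\<close>)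
      then show "((\<lambda>x. arcsin (x / 2)) has_real_derivative 1 / edge x) (at x)"
        unfolding * by (simp add: field_simps)
    qed
  qed auto
  then show ?thesis by simp
qed

lemma set_integrable_inverse_edge: "set_integrable lborel {-2..2} (\<lambda>x. 1 / edge x)"
proof -
  have "(\<lambda>x. 1 / edge x) absolutely_integrable_on {-2..2}"
    using has_integral_inverse_edge edge_nonneg
    by (intro nonnegative_absolutely_integrable_1) (auto intro: has_integral_integrable simp: abs_le_iff)
  moreover have "(\<lambda>x. indicator {-2..2} x *\<^sub>R (1 / edge x)) \<in> borel_measurable borel"
    by measurable
  ultimately show ?thesis
    unfolding set_integrable_def by (simp add: integrable_completion)
qed

lemma integral_inverse_edge: "(LINT x:{-2..2}|lborel. 1 / edge x) = pi"
  by (rule has_integral_imp_set_lebesgue[OF set_integrable_inverse_edge has_integral_inverse_edge])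

text \<open>At x = 2 and x = -2 the bound reads \<open>B / 0 = 0\<close> and asks \<open>f\<close>
  to vanish. The kernels comply, having either a factor \<open>edge\<close> or a division by
  it.\<close>

lemma set_integrable_bounded_by_inverse_edge:
  assumes "f \<in> borel_measurable borel" and "\<And>x. \<bar>x\<bar> \<le> 2 \<Longrightarrow> \<bar>f x\<bar> \<le> B / edge x"
  shows "set_integrable lborel {-2..2} f"
proof (rule set_integrable_bound_real)
  show "set_integrable lborel {-2..2} (\<lambda>x. B * (1 / edge x))"
    by (rule set_integrable_mult_right) (rule set_integrable_inverse_edge)
qed (use assms in auto)

text \<open>With \<open>x = 2 cos \<alpha>\<close> and \<open>y = 2 cos \<beta>\<close> these are the cosines and sines of \<open>\<alpha> + \<beta>\<close> (index \<open>p\<close>)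
  and of \<open>\<alpha> - \<beta>\<close> (index \<open>m\<close>).\<close>

definition "cosp x y = (x * y - edge x * edge y) / 4"
definition "cosm x y = (x * y + edge x * edge y) / 4"
definition "sinp x y = (x * edge y + y * edge x) / 4"
definition "sinm x y = (y * edge x - x * edge y) / 4"

text \<open>For c = cos \<theta> this is |1 - \<sigma> e^{i\<theta>}|^2, the denominator of the
  Poisson kernel (1 - \<sigma>^2) / |1 - \<sigma> e^{i\<theta>}|^2.\<close>

definition pden :: "real \<Rightarrow> real \<Rightarrow> real" where
  "pden \<sigma> c = 1 + \<sigma>\<^sup>2 - 2 * \<sigma> * c"

section \<open>Trigonometric identities at the angles \<alpha> + \<beta> and \<alpha> -
  \<beta>\<close>

lemma cosp_sinp: 
  assumes "\<bar>x\<bar> \<le> 2" "\<bar>y\<bar> \<le> 2"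
  shows "(cosp x y)\<^sup>2 + (sinp x y)\<^sup>2 = 1"
proof -
  have "16 * ((cosp x y)\<^sup>2 + (sinp x y)\<^sup>2) = (x\<^sup>2 + (edge x)\<^sup>2) * (y\<^sup>2 + (edge y)\<^sup>2)"
    by (simp add: cosp_def sinp_def power_divide) (simp add: power2_eq_square algebra_simps)
  then show ?thesis using assms by (simp add: edge_square)
qed

lemma cosm_sinm: 
  assumes "\<bar>x\<bar> \<le> 2" "\<bar>y\<bar> \<le> 2"
  shows "(cosm x y)\<^sup>2 + (sinm x y)\<^sup>2 = 1"
proof -
  have "16 * ((cosm x y)\<^sup>2 + (sinm x y)\<^sup>2) = (x\<^sup>2 + (edge x)\<^sup>2) * (y\<^sup>2 + (edge y)\<^sup>2)"
    by (simp add: cosm_def sinm_def power_divide) (simp add: power2_eq_square algebra_simps)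
  then show ?thesis using assms by (simp add: edge_square)
qed

lemma abs_cosp_le: "\<bar>x\<bar> \<le> 2 \<Longrightarrow> \<bar>y\<bar> \<le> 2 \<Longrightarrow> \<bar>cosp x y\<bar> \<le> 1"
  unfolding abs_square_le_1[symmetric] using cosp_sinp[of x y] zero_le_power2[of "sinp x y"] by linarith

lemma abs_cosm_le: "\<bar>x\<bar> \<le> 2 \<Longrightarrow> \<bar>y\<bar> \<le> 2 \<Longrightarrow> \<bar>cosm x y\<bar> \<le> 1"
  unfolding abs_square_le_1[symmetric] using cosm_sinm[of x y] zero_le_power2[of "sinm x y"] by linarith

lemma cos_sym:
  "cosp x y = cosp y x" "cosm x y = cosm y x" "sinp x y = sinp y x" "sinm x y = - sinm y x"
  by (simp_all add: cosp_def cosm_def sinp_def sinm_def algebra_simps diff_divide_distrib)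

text \<open>In angles, (1 - cos(\<alpha> + \<beta>)) (1 - cos(\<alpha> - \<beta>)) = (cos \<alpha> -
  cos \<beta>)^2. This is how the singularities of the two angular pieces combine into the single
  factor (x - y)^-2.\<close>

lemma cosp_cosm_prod:
  assumes "\<bar>x\<bar> \<le> 2" "\<bar>y\<bar> \<le> 2"
  shows "(1 - cosp x y) * (1 - cosm x y) = (x - y)\<^sup>2 / 4"
proof -
  have "16 * ((1 - cosp x y) * (1 - cosm x y)) = (4 - x * y)\<^sup>2 - (edge x)\<^sup>2 * (edge y)\<^sup>2"
    by (simp add: cosp_def cosm_def power2_eq_square field_simps)
  also have "\<dots> = 4 * (x - y)\<^sup>2"
    using assms by (simp add: edge_square) (simp add: power2_eq_square algebra_simps)
  finally show ?thesis by (simp add: mult.commute)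
qed

text \<open>The squared reverse triangle inequality for |1 - \<sigma> e^{i\<theta>}|.\<close>

lemma pden_ge:
  assumes "\<bar>c\<bar> \<le> 1"
  shows "(1 - \<bar>\<sigma>\<bar>)\<^sup>2 \<le> pden \<sigma> c"
proof -
  have "\<sigma> * c \<le> \<bar>\<sigma>\<bar> * 1"
    using abs_ge_self[of "\<sigma> * c"] mult_left_mono[OF assms, of "\<bar>\<sigma>\<bar>"] by (simp add: abs_mult)
  moreover have "\<bar>\<sigma>\<bar>\<^sup>2 = \<sigma>\<^sup>2" by simp
  ultimately show ?thesis by (simp add: pden_def power2_diff)
qed

lemma pden_pos: "\<bar>\<sigma>\<bar> < 1 \<Longrightarrow> \<bar>c\<bar> \<le> 1 \<Longrightarrow> 0 < pden \<sigma> c"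
  using pden_ge[of c \<sigma>] zero_less_power2[of "1 - \<bar>\<sigma>\<bar>"] by linarith

text \<open>The denominator in \<open>V_d2\<close> factors into the Poisson denominators at the two
  angles, which makes its positivity for |\<sigma>| < 1 visible.\<close>

lemma pden_product:
  assumes "\<bar>x\<bar> \<le> 2" "\<bar>y\<bar> \<le> 2"
  shows "pden \<sigma> (cosp x y) * pden \<sigma> (cosm x y)
    = \<sigma>\<^sup>2 * (x\<^sup>2 + y\<^sup>2) + (1 - \<sigma>\<^sup>2)\<^sup>2 - x * y * \<sigma> * (1 + \<sigma>\<^sup>2)"
proof -
  have "4 * (pden \<sigma> (cosp x y) * pden \<sigma> (cosm x y))
      = 4 * (1 + \<sigma>\<^sup>2)\<^sup>2 - 4 * \<sigma> * (1 + \<sigma>\<^sup>2) * (x * y) + \<sigma>\<^sup>2 * (x\<^sup>2 * y\<^sup>2 - (edge x)\<^sup>2 * (edge y)\<^sup>2)"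
    by (simp add: pden_def cosp_def cosm_def power2_eq_square field_simps)
  also have "\<dots> = 4 * (\<sigma>\<^sup>2 * (x\<^sup>2 + y\<^sup>2) + (1 - \<sigma>\<^sup>2)\<^sup>2 - x * y * \<sigma> * (1 + \<sigma>\<^sup>2))"
    using assms by (simp add: edge_square) (simp add: power2_eq_square algebra_simps)
  finally show ?thesis by (simp add: mult.commute)
qed

text \<open>The mixed derivative of \<open>log_kernel\<close>. Each quotient times \<sigma> is the
  real part of \<sigma> e^{i\<theta>} / (1 - \<sigma> e^{i\<theta>})^2, that is the sum of k
  \<sigma>^k cos(k\<theta>) over k \<ge> 1. Hence \<open>kern\<close> is 4 / (edge x * edge y) times
  the sum of k \<sigma>^k cos(k\<alpha>) cos(k\<beta>); the absence of a term with k = 0 is the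
  reason for the zero marginal.\<close>

definition kern :: "real \<Rightarrow> real \<Rightarrow> real \<Rightarrow> real" where
  "kern \<sigma> x y = 2 * \<sigma> / (edge x * edge y) *
     (((1 + \<sigma>\<^sup>2) * cosp x y - 2 * \<sigma>) / (pden \<sigma> (cosp x y))\<^sup>2
      + ((1 + \<sigma>\<^sup>2) * cosm x y - 2 * \<sigma>) / (pden \<sigma> (cosm x y))\<^sup>2)"

text \<open>Plays two roles: it is the derivative of \<open>log_kernel\<close> in \<open>y\<close>,
  and in the argument \<open>x\<close> it is a primitive of \<open>kern\<close>.\<close>

definition kern_prim :: "real \<Rightarrow> real \<Rightarrow> real \<Rightarrow> real" where
  "kern_prim \<sigma> x y = - (2 * \<sigma> / edge y) *
     (sinp x y / pden \<sigma> (cosp x y) + sinm x y / pden \<sigma> (cosm x y))"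

lemma kern_sym: "kern \<sigma> x y = kern \<sigma> y x"
  using cos_sym[of x y] by (simp add: kern_def mult.commute)

text \<open>Replacing y by -y means replacing \<beta> by \<pi> - \<beta>, which exchanges the two
  cosines and changes their signs. The sign is absorbed by \<sigma>, since \<open>pden\<close>
  depends on \<sigma> c and \<sigma>^2 only.\<close>

lemma kern_uminus: "kern (- \<sigma>) x y = kern \<sigma> x (- y)"
proof -
  have *: "cosp x (- y) = - cosm x y" "cosm x (- y) = - cosp x y"
    by (auto simp: cosp_def cosm_def field_simps)
  have d: "pden (- \<sigma>) c = pden \<sigma> (- c)" for c by (simp add: pden_def)
  have n: "(1 + (- \<sigma>)\<^sup>2) * c - 2 * - \<sigma> = - ((1 + \<sigma>\<^sup>2) * (- c) - 2 * \<sigma>)" for c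
    by (simp add: algebra_simps)
  have a: "2 * - \<sigma> / E * (- P / p + - Q / q) = 2 * \<sigma> / E * (Q / q + P / p)" for E P Q p q
    by (simp add: divide_inverse algebra_simps)
  show ?thesis
    unfolding kern_def * d n a edge_minus ..
qed

text \<open>The chain rule, with d\<alpha>/dx = -1 / \<open>edge x\<close>.\<close>

lemma
  assumes "\<bar>x\<bar> < 2" "\<bar>y\<bar> < 2"
  shows DERIV_cosp: "((\<lambda>u. cosp u y) has_real_derivative sinp x y / edge x) (at x)"
    and DERIV_cosm: "((\<lambda>u. cosm u y) has_real_derivative sinm x y / edge x) (at x)"
    and DERIV_sinp: "((\<lambda>u. sinp u y) has_real_derivative - cosp x y / edge x) (at x)"
    and DERIV_sinm: "((\<lambda>u. sinm u y) has_real_derivative - cosm x y / edge x) (at x)"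
  unfolding cosp_def cosm_def sinp_def sinm_def using edge_pos[OF assms(1)] DERIV_edge[OF assms(1)]
  by (auto intro!: derivative_eq_intros simp: field_simps)

text \<open>The numerator inside the logarithm is 4 |e^{i\<alpha>} - \<sigma> e^{-i\<beta>}|^2 and
  the denominator is 4 |e^{i\<alpha>} - \<sigma> e^{i\<beta>}|^2. A rotation turns them into Poisson
  denominators at \<alpha> + \<beta> and \<alpha> - \<beta>.\<close>

lemma log_kernel_eq:
  assumes "\<bar>\<sigma>\<bar> < 1" "\<bar>x\<bar> \<le> 2" "\<bar>y\<bar> \<le> 2"
  shows "log_kernel \<sigma> x y = ln (pden \<sigma> (cosp x y)) - ln (pden \<sigma> (cosm x y))"
proof -
  have a: "(x - \<sigma> * y)\<^sup>2 + (sqrt (4 - x\<^sup>2) + \<sigma> * sqrt (4 - y\<^sup>2))\<^sup>2 = 4 * pden \<sigma> (cosp x y)"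
  proof -
    have "(x - \<sigma> * y)\<^sup>2 + (edge x + \<sigma> * edge y)\<^sup>2
        = x\<^sup>2 + (edge x)\<^sup>2 + \<sigma>\<^sup>2 * (y\<^sup>2 + (edge y)\<^sup>2) - 2 * \<sigma> * (x * y - edge x * edge y)"
      by (simp add: power2_eq_square algebra_simps)
    then show ?thesis
      using assms by (simp add: edge_square cosp_def pden_def) (simp add: edge_def)
  qed
  have b: "(x - \<sigma> * y)\<^sup>2 + (sqrt (4 - x\<^sup>2) - \<sigma> * sqrt (4 - y\<^sup>2))\<^sup>2 = 4 * pden \<sigma> (cosm x y)"
  proof -
    have "(x - \<sigma> * y)\<^sup>2 + (edge x - \<sigma> * edge y)\<^sup>2
        = x\<^sup>2 + (edge x)\<^sup>2 + \<sigma>\<^sup>2 * (y\<^sup>2 + (edge y)\<^sup>2) - 2 * \<sigma> * (x * y + edge x * edge y)"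
      by (simp add: power2_eq_square algebra_simps)
    then show ?thesis
      using assms by (simp add: edge_square cosm_def pden_def) (simp add: edge_def)
  qed
  show ?thesis
    unfolding log_kernel_def a b
    using pden_pos[OF assms(1) abs_cosp_le[OF assms(2,3)]] pden_pos[OF assms(1) abs_cosm_le[OF assms(2,3)]]
    by (simp add: ln_div)
qed

lemma DERIV_log_kernel:
  assumes "\<bar>\<sigma>\<bar> < 1" "\<bar>x\<bar> < 2" "\<bar>y\<bar> < 2"
  shows "((\<lambda>v. log_kernel \<sigma> x v) has_real_derivative kern_prim \<sigma> x y) (at y)"
proof (rule has_field_derivative_transform_within_open)
  have cp: "((\<lambda>v. cosp x v) has_real_derivative sinp x y / edge y) (at y)"
    using DERIV_cosp[OF assms(3,2)] by (simp add: cos_sym[of x])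
  have cm: "((\<lambda>v. cosm x v) has_real_derivative - sinm x y / edge y) (at y)"
    using DERIV_cosm[OF assms(3,2)] by (simp add: cos_sym[of x])
  have p: "0 < pden \<sigma> (cosp x y)" "0 < pden \<sigma> (cosm x y)"
    using assms by (auto intro!: pden_pos abs_cosp_le abs_cosm_le)
  have "((\<lambda>v. ln (pden \<sigma> (cosp x v)) - ln (pden \<sigma> (cosm x v))) has_real_derivative
      1 / pden \<sigma> (cosp x y) * (- (2 * \<sigma> * (sinp x y / edge y)))
      - 1 / pden \<sigma> (cosm x y) * (- (2 * \<sigma> * (- sinm x y / edge y)))) (at y)"
    using p unfolding pden_def
    by (intro DERIV_diff DERIV_chain2[OF DERIV_ln_divide]) (auto intro!: derivative_eq_intros cp cm)
  also have "1 / pden \<sigma> (cosp x y) * (- (2 * \<sigma> * (sinp x y / edge y)))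
      - 1 / pden \<sigma> (cosm x y) * (- (2 * \<sigma> * (- sinm x y / edge y))) = kern_prim \<sigma> x y"
    by (simp add: kern_prim_def divide_inverse algebra_simps)
  finally show "((\<lambda>v. ln (pden \<sigma> (cosp x v)) - ln (pden \<sigma> (cosm x v)))
      has_real_derivative kern_prim \<sigma> x y) (at y)" .
  show "open {-2<..<(2::real)}" "y \<in> {-2<..<2}"
    using assms by auto
  show "ln (pden \<sigma> (cosp x v)) - ln (pden \<sigma> (cosm x v)) = log_kernel \<sigma> x v"
    if "v \<in> {-2<..<2}" for v
    using that assms by (subst log_kernel_eq) auto
qed

lemma DERIV_kern_prim:
  assumes "\<bar>\<sigma>\<bar> < 1" "\<bar>x\<bar> < 2" "\<bar>y\<bar> < 2"
  shows "((\<lambda>u. kern_prim \<sigma> u y) has_real_derivative kern \<sigma> x y) (at x)"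
proof -
  have p: "0 < pden \<sigma> (cosp x y)" "0 < pden \<sigma> (cosm x y)"
    using assms by (auto intro!: pden_pos abs_cosp_le abs_cosm_le)
  have e: "0 < edge x" "0 < edge y" using assms by (auto intro: edge_pos)
  have n: "- c * pden \<sigma> c + 2 * \<sigma> * s\<^sup>2 = - ((1 + \<sigma>\<^sup>2) * c - 2 * \<sigma>)" if "c\<^sup>2 + s\<^sup>2 = 1" for c s
  proof -
    have "s\<^sup>2 = 1 - c\<^sup>2" using that by simp
    then have "- c * pden \<sigma> c + 2 * \<sigma> * s\<^sup>2 = - c * pden \<sigma> c + 2 * \<sigma> * (1 - c\<^sup>2)" by (simp only:)
    then show ?thesis by (simp add: pden_def power2_eq_square algebra_simps)
  qed
  \<comment> \<open>The \<theta>-derivative of sin \<theta> /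
    \<open>pden \<sigma> (cos \<theta>)\<close>, times d\<theta>/dx = -1 / \<open>edge x\<close>.
    The abstract pair \<open>c\<close>, \<open>s\<close> is instantiated at both angles.\<close>
  have quot: "((\<lambda>u. s u / pden \<sigma> (c u)) has_real_derivative
      - ((1 + \<sigma>\<^sup>2) * c x - 2 * \<sigma>) / (edge x * (pden \<sigma> (c x))\<^sup>2)) (at x)"
    if c: "(c has_real_derivative s x / edge x) (at x)" and s: "(s has_real_derivative - c x / edge x) (at x)"
      and 1: "(c x)\<^sup>2 + (s x)\<^sup>2 = 1" and pp: "0 < pden \<sigma> (c x)" for s c :: "real \<Rightarrow> real"
  proof -
    have "((\<lambda>u. s u / pden \<sigma> (c u)) has_real_derivative
        ((- c x / edge x) * pden \<sigma> (c x) - s x * (- (2 * \<sigma> * (s x / edge x)))) / (pden \<sigma> (c x) * pden \<sigma> (c x))) (at x)"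
      using pp unfolding pden_def by (auto intro!: derivative_eq_intros c s)
    also have "((- c x / edge x) * pden \<sigma> (c x) - s x * (- (2 * \<sigma> * (s x / edge x)))) / (pden \<sigma> (c x) * pden \<sigma> (c x))
        = (- c x * pden \<sigma> (c x) + 2 * \<sigma> * (s x)\<^sup>2) / (edge x * (pden \<sigma> (c x))\<^sup>2)"
      using e pp by (simp add: field_simps power2_eq_square)
    finally show ?thesis using n[OF 1] by simp
  qed
  have "((\<lambda>u. kern_prim \<sigma> u y) has_real_derivative
      - (2 * \<sigma> / edge y) * (- ((1 + \<sigma>\<^sup>2) * cosp x y - 2 * \<sigma>) / (edge x * (pden \<sigma> (cosp x y))\<^sup>2)
        + - ((1 + \<sigma>\<^sup>2) * cosm x y - 2 * \<sigma>) / (edge x * (pden \<sigma> (cosm x y))\<^sup>2))) (at x)"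
    unfolding kern_prim_def
    using assms p cosp_sinp[of x y] cosm_sinm[of x y]
    by (intro DERIV_cmult DERIV_add quot DERIV_cosp DERIV_sinp DERIV_cosm DERIV_sinm) auto
  also have "- (2 * \<sigma> / edge y) * (- ((1 + \<sigma>\<^sup>2) * cosp x y - 2 * \<sigma>) / (edge x * (pden \<sigma> (cosp x y))\<^sup>2)
        + - ((1 + \<sigma>\<^sup>2) * cosm x y - 2 * \<sigma>) / (edge x * (pden \<sigma> (cosm x y))\<^sup>2)) = kern \<sigma> x y"
  proof -
    have *: "- (b / E) * (- P / (F * p) + - Q / (F * q)) = b / (F * E) * (P / p + Q / q)" for b E F P Q p q :: real
      by (simp add: divide_inverse algebra_simps)
    show ?thesis unfolding kern_def by (rule *)
  qed
  finally show ?thesis .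
qed

lemma deriv_log_kernel:
  assumes "\<bar>\<sigma>\<bar> < 1" "\<bar>x\<bar> < 2" "\<bar>y\<bar> < 2"
  shows "deriv (\<lambda>u. deriv (\<lambda>v. log_kernel \<sigma> u v) y) x = kern \<sigma> x y"
proof (rule DERIV_imp_deriv, rule has_field_derivative_transform_within_open)
  show "((\<lambda>u. kern_prim \<sigma> u y) has_real_derivative kern \<sigma> x y) (at x)"
    by (rule DERIV_kern_prim[OF assms])
  show "open {-2<..<(2::real)}" "x \<in> {-2<..<2}" using assms by auto
  show "kern_prim \<sigma> u y = deriv (\<lambda>v. log_kernel \<sigma> u v) y" if "u \<in> {-2<..<2}" for u
    using that assms by (intro DERIV_imp_deriv[symmetric] DERIV_log_kernel) auto
qed

text \<open>Each numerator is at most 4 and each squared denominator at least (1 - |\<sigma>|)^4, so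
  16 = 2 * (4 + 4). The edge factors are kept because their reciprocals are integrable.\<close>

lemma abs_kern_le:
  assumes "\<bar>\<sigma>\<bar> < 1" "\<bar>x\<bar> \<le> 2" "\<bar>y\<bar> \<le> 2"
  shows "\<bar>kern \<sigma> x y\<bar> \<le> 16 / (1 - \<bar>\<sigma>\<bar>) ^ 4 / (edge x * edge y)"
proof -
  have 1: "\<bar>((1 + \<sigma>\<^sup>2) * c - 2 * \<sigma>) / (pden \<sigma> c)\<^sup>2\<bar> \<le> 4 / (1 - \<bar>\<sigma>\<bar>) ^ 4" if "\<bar>c\<bar> \<le> 1" for c
  proof -
    have "\<sigma>\<^sup>2 \<le> 1" using assms(1) by (simp add: abs_square_le_1)
    then have "(1 + \<sigma>\<^sup>2) * \<bar>c\<bar> \<le> 2 * 1"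
      using that by (intro mult_mono) auto
    then have "\<bar>(1 + \<sigma>\<^sup>2) * c\<bar> \<le> 2"
      by (simp add: abs_mult)
    then have a: "\<bar>(1 + \<sigma>\<^sup>2) * c - 2 * \<sigma>\<bar> \<le> 4"
      using assms(1) by linarith
    have "((1 - \<bar>\<sigma>\<bar>)\<^sup>2)\<^sup>2 \<le> (pden \<sigma> c)\<^sup>2"
      using pden_ge[OF that, of \<sigma>] by (intro power_mono) auto
    then have b: "(1 - \<bar>\<sigma>\<bar>) ^ 4 \<le> (pden \<sigma> c)\<^sup>2" by (simp flip: power_mult)
    have "0 < (1 - \<bar>\<sigma>\<bar>) ^ 4" using assms(1) by simp
    then show ?thesis
      unfolding abs_divide using a b by (intro frac_le) auto
  qed
  have e: "0 \<le> edge x * edge y" using assms edge_nonneg by simp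
  have f: "\<bar>2 * \<sigma> / (edge x * edge y)\<bar> \<le> 2 * 1 / (edge x * edge y)"
    unfolding abs_divide abs_of_nonneg[OF e] using e assms(1) by (intro divide_right_mono) auto
  have "\<bar>kern \<sigma> x y\<bar> \<le> 2 * 1 / (edge x * edge y) * (4 / (1 - \<bar>\<sigma>\<bar>) ^ 4 + 4 / (1 - \<bar>\<sigma>\<bar>) ^ 4)"
    unfolding kern_def abs_mult[of "2 * \<sigma> / (edge x * edge y)"]
    using 1[OF abs_cosp_le[OF assms(2,3)]] 1[OF abs_cosm_le[OF assms(2,3)]] e
    by (intro mult_mono f order_trans[OF abs_triangle_ineq] add_mono) auto
  then show ?thesis by (simp add: mult.commute)
qed

section \<open>Measurability and the vanishing marginal of the logarithmic kernel\<close>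

lemma borel_measurable_pden [measurable]: "pden \<sigma> \<in> borel_measurable borel"
  unfolding pden_def by measurable

lemma borel_measurable_cosp [measurable]:
  assumes [measurable]: "f \<in> borel_measurable M" "g \<in> borel_measurable M"
  shows "(\<lambda>p. cosp (f p) (g p)) \<in> borel_measurable M"
  unfolding cosp_def by measurable

lemma borel_measurable_cosm [measurable]:
  assumes [measurable]: "f \<in> borel_measurable M" "g \<in> borel_measurable M"
  shows "(\<lambda>p. cosm (f p) (g p)) \<in> borel_measurable M"
  unfolding cosm_def by measurable

lemma borel_measurable_kern [measurable]:
  assumes [measurable]: "f \<in> borel_measurable M" "g \<in> borel_measurable M"
  shows "(\<lambda>p. kern \<sigma> (f p) (g p)) \<in> borel_measurable M"
  unfolding kern_def by measurable

lemma integral_kern: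
  assumes "\<bar>\<sigma>\<bar> < 1" "\<bar>x\<bar> < 2"
  shows "(LINT y:{-2..2}|lborel. kern \<sigma> x y) = 0"
proof (rule has_integral_imp_set_lebesgue)
  have e: "0 < edge x" by (rule edge_pos) fact
  show "set_integrable lborel {-2..2} (kern \<sigma> x)"
  proof (rule set_integrable_bounded_by_inverse_edge)
    show "\<bar>kern \<sigma> x y\<bar> \<le> 16 / (1 - \<bar>\<sigma>\<bar>) ^ 4 / edge x / edge y" if "\<bar>y\<bar> \<le> 2" for y
      using abs_kern_le[OF assms(1), of x y] assms(2) that by (simp add: mult.assoc)
  qed measurable
  \<comment> \<open>By symmetry of \<open>kern\<close> the integration variable may sit in the first
    argument, where \<open>kern_prim\<close> is a primitive.\<close>
  have "((\<lambda>y. kern \<sigma> x y) has_integral (kern_prim \<sigma> 2 x - kern_prim \<sigma> (-2) x)) {-2..2}"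
  proof (rule fundamental_theorem_of_calculus_interior)
    have "0 < pden \<sigma> (cosp u x)" "0 < pden \<sigma> (cosm u x)" if "u \<in> {-2..2}" for u
      using assms that by (auto intro!: pden_pos abs_cosp_le abs_cosm_le)
    then have "pden \<sigma> (cosp u x) \<noteq> 0" "pden \<sigma> (cosm u x) \<noteq> 0" if "u \<in> {-2..2}" for u
      using that by force+
    moreover have "continuous_on {-2..2} (\<lambda>u. pden \<sigma> (cosp u x))"
      "continuous_on {-2..2} (\<lambda>u. pden \<sigma> (cosm u x))"
      by (auto simp: pden_def cosp_def cosm_def intro!: continuous_intros)
    ultimately show "continuous_on {-2..2} (\<lambda>u. kern_prim \<sigma> u x)"
      unfolding kern_prim_def sinp_def sinm_def using e
      by (intro continuous_on_mult continuous_on_add continuous_on_divide continuous_on_diff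
          continuous_on_edge continuous_on_const continuous_on_id continuous_on_minus) auto
    show "((\<lambda>u. kern_prim \<sigma> u x) has_vector_derivative kern \<sigma> x y) (at y)" if "y \<in> {-2<..<2}" for y
      unfolding has_real_derivative_iff_has_vector_derivative[symmetric] kern_sym[of \<sigma> x y]
      using assms that by (intro DERIV_kern_prim) auto
  qed auto
  \<comment> \<open>At the two edges the cosines of the two angles agree while the sines are
    opposite, so the two terms of \<open>kern_prim\<close> cancel.\<close>
  moreover have "kern_prim \<sigma> 2 x = 0" "kern_prim \<sigma> (-2) x = 0"
    by (simp_all add: kern_prim_def sinp_def sinm_def cosp_def cosm_def)
  ultimately show "(kern \<sigma> x has_integral 0) {-2..2}" by simp
qed

lemma sq_integrable_inverse_edge: "sq_integrable (\<lambda>x y. C / (edge x * edge y))"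
  using sq_integrable_cmult[OF sq_integrable_tensor[OF set_integrable_inverse_edge set_integrable_inverse_edge], of C]
  by simp

lemma sq_integrable_bounded_by_inverse_edge:
  assumes "(\<lambda>(x, y). F x y) \<in> borel_measurable (borel \<Otimes>\<^sub>M borel)"
    and "\<And>x y. \<bar>x\<bar> \<le> 2 \<Longrightarrow> \<bar>y\<bar> \<le> 2 \<Longrightarrow> \<bar>F x y\<bar> \<le> C / (edge x * edge y)"
  shows "sq_integrable F"
  by (rule sq_integrable_bound[OF assms(1) sq_integrable_inverse_edge assms(2)])

text \<open>Writing \<open>f x * h y + f y * h x\<close> as \<open>f x * h x + f y * h y - (f x - f y) * (h x - h y)\<close> trades the
  off-diagonal mass of a kernel for its marginal and a form that vanishes on the diagonal.\<close>

lemma integral_sq_polarize: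
  assumes [measurable]: "(\<lambda>(x, y). K x y) \<in> borel_measurable (borel \<Otimes>\<^sub>M borel)"
      "f \<in> borel_measurable borel" "h \<in> borel_measurable borel"
    and sym: "\<And>x y. K x y = K y x"
    and K: "\<And>x y. \<bar>x\<bar> \<le> 2 \<Longrightarrow> \<bar>y\<bar> \<le> 2 \<Longrightarrow> \<bar>K x y\<bar> \<le> C / (edge x * edge y)"
    and marg: "\<And>x. \<bar>x\<bar> \<le> 2 \<Longrightarrow> (LINT y:{-2..2}|lborel. K x y) = \<kappa> x"
    and f: "\<And>x. \<bar>x\<bar> \<le> 2 \<Longrightarrow> \<bar>f x\<bar> \<le> B" and h: "\<And>x. \<bar>x\<bar> \<le> 2 \<Longrightarrow> \<bar>h x\<bar> \<le> B"
  shows "integral_sq (\<lambda>x y. f x * h y * K x y) = (LINT x:{-2..2}|lborel. f x * h x * \<kappa> x)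
    - 1 / 2 * integral_sq (\<lambda>x y. (f x - f y) * (h x - h y) * K x y)"
proof -
  have dom: "sq_integrable (\<lambda>x y. u x y * K x y)"
    if [measurable]: "(\<lambda>(x, y). u x y) \<in> borel_measurable (borel \<Otimes>\<^sub>M borel)"
      and u: "\<And>x y. \<bar>x\<bar> \<le> 2 \<Longrightarrow> \<bar>y\<bar> \<le> 2 \<Longrightarrow> \<bar>u x y\<bar> \<le> B * B" for u
  proof (rule sq_integrable_bounded_by_inverse_edge)
    show "\<bar>u x y * K x y\<bar> \<le> B * B * C / (edge x * edge y)" if "\<bar>x\<bar> \<le> 2" "\<bar>y\<bar> \<le> 2" for x y
    proof -
      have "\<bar>u x y * K x y\<bar> \<le> (B * B) * (C / (edge x * edge y))"
        unfolding abs_mult using u[OF that] K[OF that] by (intro mult_mono) auto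
      then show ?thesis by simp
    qed
  qed measurable
  have BB: "\<bar>a * b\<bar> \<le> B * B" if "\<bar>a\<bar> \<le> B" "\<bar>b\<bar> \<le> B" for a b
    unfolding abs_mult using that by (intro mult_mono) auto
  have i1: "sq_integrable (\<lambda>x y. f x * h x * K x y)" by (rule dom) (use f h BB in auto)
  have i2: "sq_integrable (\<lambda>x y. f x * h y * K x y)" by (rule dom) (use f h BB in auto)
  have j1: "sq_integrable (\<lambda>x y. f y * h y * K x y)" "integral_sq (\<lambda>x y. f y * h y * K x y) = integral_sq (\<lambda>x y. f x * h x * K x y)"
    using sq_integrable_swap[OF i1] integral_sq_swap[OF i1] by (simp_all add: sym)
  have j2: "sq_integrable (\<lambda>x y. f y * h x * K x y)" "integral_sq (\<lambda>x y. f y * h x * K x y) = integral_sq (\<lambda>x y. f x * h y * K x y)"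
    using sq_integrable_swap[OF i2] integral_sq_swap[OF i2] by (simp_all add: sym)
  have "integral_sq (\<lambda>x y. (f x - f y) * (h x - h y) * K x y)
      = integral_sq (\<lambda>x y. (f x * h x * K x y + f y * h y * K x y)
          + (-1) * (f x * h y * K x y + f y * h x * K x y))"
    by (rule integral_sq_cong) (simp add: algebra_simps)
  also have "\<dots> = 2 * integral_sq (\<lambda>x y. f x * h x * K x y) - 2 * integral_sq (\<lambda>x y. f x * h y * K x y)"
    by (simp only: integral_sq_add[OF sq_integrable_add[OF i1 j1(1)]
          sq_integrable_cmult[OF sq_integrable_add[OF i2 j2(1)]]] integral_sq_cmult
        integral_sq_add[OF i1 j1(1)] integral_sq_add[OF i2 j2(1)] j1(2) j2(2)) simp
  also have "integral_sq (\<lambda>x y. f x * h x * K x y) = (LINT x:{-2..2}|lborel. f x * h x * \<kappa> x)"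
    unfolding integral_sq_fst[OF i1] by (rule set_lebesgue_integral_cong) (auto simp: marg abs_le_iff)
  finally show ?thesis by (simp only: right_diff_distrib)
qed

lemma integral_sq_reflect:
  assumes "sq_integrable F" "sq_integrable (\<lambda>x y. F x (- y))"
  shows "integral_sq (\<lambda>x y. F x (- y)) = integral_sq F"
proof -
  have "(LINT y:{-2..2}|lborel. F x (- y)) = (LINT y:{-2..2}|lborel. F x y)" for x
  proof -
    have "(LINT y:{-2..2}|lborel. F x y) = (LINT y|lborel. indicator {-2..2} (- y) *\<^sub>R F x (- y))"
      unfolding set_lebesgue_integral_def by (subst lborel_integral_real_affine[of "-1" _ 0]) auto
    also have "(\<lambda>y::real. indicator {-2..2} (- y) :: real) = indicator {-2..2}"
      by (auto simp: fun_eq_iff indicator_def)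
    finally show ?thesis unfolding set_lebesgue_integral_def by simp
  qed
  then show ?thesis
    unfolding integral_sq_fst[OF assms(1)] integral_sq_fst[OF assms(2)] by simp
qed

section \<open>Lipschitz functions and the limit of the logarithmic form at \<sigma> = 1\<close>

lemma lipschitz_bounded:
  fixes f :: "real \<Rightarrow> real"
  assumes "M-lipschitz_on UNIV f" and "\<bar>x\<bar> \<le> 2"
  shows "\<bar>f x\<bar> \<le> \<bar>f 0\<bar> + 2 * M"
proof -
  have "\<bar>f x - f 0\<bar> \<le> M * \<bar>x\<bar>"
    using lipschitz_onD[OF assms(1), of x 0] by (simp add: dist_real_def)
  also have "\<dots> \<le> M * 2"
    using assms lipschitz_on_nonneg[OF assms(1)] by (intro mult_left_mono) auto
  finally show ?thesis by linarith
qed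

lemma lipschitz_borel_measurable:
  fixes f :: "real \<Rightarrow> real"
  shows "M-lipschitz_on UNIV f \<Longrightarrow> f \<in> borel_measurable borel"
  by (intro borel_measurable_continuous_onI lipschitz_on_continuous_on)

lemma abs_lipschitz_product:
  fixes f h :: "real \<Rightarrow> real"
  assumes "M-lipschitz_on UNIV f" "M'-lipschitz_on UNIV h"
  shows "\<bar>(f x - f y) * (h x - h y)\<bar> \<le> M * M' * (x - y)\<^sup>2"
proof -
  have "\<bar>(f x - f y) * (h x - h y)\<bar> \<le> (M * \<bar>x - y\<bar>) * (M' * \<bar>x - y\<bar>)"
    unfolding abs_mult
    using lipschitz_onD[OF assms(1), of x y] lipschitz_onD[OF assms(2), of x y]
      lipschitz_on_nonneg[OF assms(1)]
    by (intro mult_mono) (auto simp: dist_real_def)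
  also have "\<dots> = M * M' * \<bar>x - y\<bar>\<^sup>2"
    by (simp only: power2_eq_square) (simp add: algebra_simps)
  finally show ?thesis by simp
qed

lemma lipschitz_reflect:
  fixes f :: "real \<Rightarrow> real"
  assumes "M-lipschitz_on UNIV f"
  shows "M-lipschitz_on UNIV (\<lambda>x. f (- x))"
proof (rule lipschitz_onI)
  show "dist (f (- x)) (f (- y)) \<le> M * dist x y" for x y
    using lipschitz_onD[OF assms, of "- x" "- y"] by (simp add: dist_minus)
qed (rule lipschitz_on_nonneg[OF assms])

text \<open>The algebra that produces the weight of \<open>V_tr1\<close>: the common denominator
  comes from \<open>cosp_cosm_prod\<close>, and the numerators add up to 2 - 2 cos \<alpha> cos
  \<beta> = (4 - x y) / 2. Both cosines stay below 1 since their product of distances to 1 is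
  nonzero off the diagonal.\<close>

lemma sum_inverse_one_minus_cos:
  assumes "\<bar>x\<bar> \<le> 2" "\<bar>y\<bar> \<le> 2" "x \<noteq> y"
  shows "1 / (1 - cosp x y) + 1 / (1 - cosm x y) = 2 * (4 - x * y) / (x - y)\<^sup>2"
    and "cosp x y < 1" "cosm x y < 1"
proof -
  have p: "(1 - cosp x y) * (1 - cosm x y) = (x - y)\<^sup>2 / 4" "0 < (x - y)\<^sup>2"
    using cosp_cosm_prod[OF assms(1,2)] assms(3) by auto
  then have "1 - cosp x y \<noteq> 0" "1 - cosm x y \<noteq> 0" by auto
  moreover from this show "cosp x y < 1" "cosm x y < 1"
    using abs_cosp_le[OF assms(1,2)] abs_cosm_le[OF assms(1,2)] by auto
  ultimately have "1 / (1 - cosp x y) + 1 / (1 - cosm x y)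
      = ((1 - cosm x y) + (1 - cosp x y)) / ((1 - cosp x y) * (1 - cosm x y))"
    by (subst add_frac_eq) auto
  also have "\<dots> = 2 * (4 - x * y) / (x - y)\<^sup>2"
  proof -
    have "(1 - cosm x y) + (1 - cosp x y) = (4 - x * y) / 2"
      by (simp add: cosp_def cosm_def field_simps)
    then show ?thesis unfolding p by simp
  qed
  finally show "1 / (1 - cosp x y) + 1 / (1 - cosm x y) = 2 * (4 - x * y) / (x - y)\<^sup>2" .
qed

text \<open>A majorant free of \<sigma>. Its price is the non-integrable factor (x - y)^-2, which
  two Lipschitz increments pay for exactly.\<close>

lemma abs_kern_le_uniform:
  assumes "1 / 2 \<le> \<sigma>" "\<sigma> < 1" "\<bar>x\<bar> \<le> 2" "\<bar>y\<bar> \<le> 2" "x \<noteq> y"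
  shows "\<bar>kern \<sigma> x y\<bar> \<le> 8 * (4 - x * y) / (edge x * edge y * (x - y)\<^sup>2)"
proof -
  have 1: "\<bar>((1 + \<sigma>\<^sup>2) * c - 2 * \<sigma>) / (pden \<sigma> c)\<^sup>2\<bar> \<le> 2 * (1 / (1 - c))" if "\<bar>c\<bar> \<le> 1" "c < 1" for c
  proof -
    have s: "\<sigma>\<^sup>2 \<le> 1" using assms(1,2) by (simp add: abs_square_le_1)
    \<comment> \<open>The denominator is \<open>r + 2 * t\<close> and the numerator is
      \<open>r - u\<close>. For \<sigma> \<ge> 1/2 one has \<open>1 - c \<le> 2 * t\<close> and
      \<open>u \<le> 2 * (1 - c)\<close>, so the numerator is at most twice the denominator, and the
      denominator is at least \<open>1 - c\<close>.\<close>
    define r t u where "r = (1 - \<sigma>)\<^sup>2" and "t = \<sigma> * (1 - c)" and "u = (1 + \<sigma>\<^sup>2) * (1 - c)"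
    have r: "0 \<le> r" by (simp add: r_def)
    have D: "pden \<sigma> c = r + 2 * t"
      by (simp add: pden_def t_def r_def power2_eq_square algebra_simps)
    have a: "1 - c \<le> 2 * t"
      using mult_right_mono[of "1 / 2" \<sigma> "1 - c"] assms that by (simp add: t_def)
    then have Dc: "1 - c \<le> pden \<sigma> c" using D r by linarith
    have "u \<le> 2 * (1 - c)" unfolding u_def using s that by (intro mult_right_mono) auto
    moreover have "0 \<le> u" using that by (simp add: u_def)
    moreover have eq: "(1 + \<sigma>\<^sup>2) * c - 2 * \<sigma> = r - u"
      by (simp add: u_def r_def power2_eq_square algebra_simps)
    ultimately have n: "\<bar>(1 + \<sigma>\<^sup>2) * c - 2 * \<sigma>\<bar> \<le> 2 * pden \<sigma> c"
      unfolding eq D using a r by (simp add: abs_le_iff)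
    have "\<bar>((1 + \<sigma>\<^sup>2) * c - 2 * \<sigma>) / (pden \<sigma> c)\<^sup>2\<bar> \<le> 2 * pden \<sigma> c / (pden \<sigma> c)\<^sup>2"
      unfolding abs_divide using n by (simp add: divide_right_mono)
    also have "\<dots> = 2 / pden \<sigma> c"
      using Dc that by (simp add: power2_eq_square)
    also have "\<dots> \<le> 2 / (1 - c)"
      using Dc that by (intro frac_le) auto
    finally show ?thesis by simp
  qed
  have e: "0 \<le> edge x * edge y" using assms edge_nonneg by simp
  have f: "\<bar>2 * \<sigma> / (edge x * edge y)\<bar> \<le> 2 * 1 / (edge x * edge y)"
    unfolding abs_divide abs_of_nonneg[OF e] using e assms(1,2) by (intro divide_right_mono) auto
  have "\<bar>kern \<sigma> x y\<bar> \<le> 2 * 1 / (edge x * edge y) * (2 * (1 / (1 - cosp x y)) + 2 * (1 / (1 - cosm x y)))"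
    unfolding kern_def abs_mult[of "2 * \<sigma> / (edge x * edge y)"]
    using e sum_inverse_one_minus_cos(2,3)[OF assms(3-5)] abs_cosp_le[OF assms(3,4)] abs_cosm_le[OF assms(3,4)]
    by (intro mult_mono f order_trans[OF abs_triangle_ineq] add_mono 1) auto
  also have "\<dots> = 4 / (edge x * edge y) * (1 / (1 - cosp x y) + 1 / (1 - cosm x y))"
    by (simp add: algebra_simps)
  also have "\<dots> = 8 * (4 - x * y) / (edge x * edge y * (x - y)\<^sup>2)"
    unfolding sum_inverse_one_minus_cos(1)[OF assms(3-5)] by simp
  finally show ?thesis .
qed

text \<open>At \<sigma> = 1 each quotient becomes (2c - 2) / (2 - 2c)^2 = -1 / (2 (1 - c)). The
  limit is nonpositive off the diagonal: with zero marginals, the compensating positive mass has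
  escaped to the diagonal. At the edges both sides are divisions by zero.\<close>

lemma kern_tendsto:
  assumes "\<bar>x\<bar> \<le> 2" "\<bar>y\<bar> \<le> 2" "x \<noteq> y"
  shows "((\<lambda>\<sigma>. kern \<sigma> x y) \<longlongrightarrow> - 2 * ((4 - x * y) / (edge x * edge y) / (x - y)\<^sup>2)) (at 1 within T)"
proof -
  have alg: "2 * 1 / E * (- 1 / 2 * p + - 1 / 2 * q) = - (1 / E) * (p + q)" for E p q :: real
    by (cases "E = 0") (auto simp: field_simps)
  have alg': "- (1 / E) * (2 * n / d) = - 2 * (n / E / d)" for E n d :: real
    by simp
  have 1: "((\<lambda>\<sigma>. ((1 + \<sigma>\<^sup>2) * c - 2 * \<sigma>) / (pden \<sigma> c)\<^sup>2) \<longlongrightarrow> - 1 / 2 * (1 / (1 - c))) (at 1 within T)"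
    if "c < 1" for c
  proof -
    have "((\<lambda>\<sigma>. ((1 + \<sigma>\<^sup>2) * c - 2 * \<sigma>) / (pden \<sigma> c)\<^sup>2)
        \<longlongrightarrow> ((1 + 1\<^sup>2) * c - 2 * 1) / (1 + 1\<^sup>2 - 2 * 1 * c)\<^sup>2) (at 1 within T)"
      unfolding pden_def using that by (intro tendsto_intros) auto
    also have "((1 + 1\<^sup>2) * c - 2 * 1) / (1 + 1\<^sup>2 - 2 * 1 * c)\<^sup>2 = - 1 / 2 * (1 / (1 - c))"
      using that by (simp add: divide_simps) (simp add: power2_eq_square algebra_simps)
    finally show ?thesis .
  qed
  have "((\<lambda>\<sigma>. kern \<sigma> x y) \<longlongrightarrow> 2 * 1 / (edge x * edge y)
      * (- 1 / 2 * (1 / (1 - cosp x y)) + - 1 / 2 * (1 / (1 - cosm x y)))) (at 1 within T)"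
  proof (cases "edge x * edge y = 0")
    case False
    then show ?thesis
      unfolding kern_def using sum_inverse_one_minus_cos(2,3)[OF assms]
      by (intro tendsto_mult tendsto_add tendsto_divide tendsto_const tendsto_ident_at 1) auto
  next
    case True
    then show ?thesis by (auto simp: kern_def)
  qed
  also have "2 * 1 / (edge x * edge y) * (- 1 / 2 * (1 / (1 - cosp x y)) + - 1 / 2 * (1 / (1 - cosm x y)))
      = - (1 / (edge x * edge y)) * (1 / (1 - cosp x y) + 1 / (1 - cosm x y))"
    by (rule alg)
  also have "\<dots> = - 2 * ((4 - x * y) / (edge x * edge y) / (x - y)\<^sup>2)"
    unfolding sum_inverse_one_minus_cos(1)[OF assms] by (rule alg')
  finally show ?thesis .
qed

text \<open>The bilinear form behind \<open>V_tr1\<close>, without the prefactor. Two arguments are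
  needed since at \<sigma> = -1 the second one is the reflection of the first.\<close>

definition tr_form :: "(real \<Rightarrow> real) \<Rightarrow> (real \<Rightarrow> real) \<Rightarrow> real" where
  "tr_form f h = integral_sq (\<lambda>x y. (f x - f y) / (x - y) * ((h x - h y) / (x - y))
      * ((4 - x * y) / (edge x * edge y)))"

lemma abs_4_minus_mult:
  assumes "\<bar>x\<bar> \<le> 2" "\<bar>y\<bar> \<le> (2::real)"
  shows "0 \<le> 4 - x * y" "4 - x * y \<le> 8"
proof -
  have "\<bar>x * y\<bar> \<le> 2 * 2" unfolding abs_mult using assms by (intro mult_mono) auto
  then show "0 \<le> 4 - x * y" "4 - x * y \<le> 8" by (auto simp: abs_le_iff)
qed

text \<open>The zero marginal leaves only -1/2 times the integral of the increments against
  \<open>kern\<close>. Dominated convergence applies there, and the factor -1/2 cancels the -2 in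
  \<open>kern_tendsto\<close>.\<close>

lemma integral_kern_tendsto:
  assumes f: "M-lipschitz_on UNIV f" and h: "M-lipschitz_on UNIV h"
  shows "((\<lambda>\<sigma>. integral_sq (\<lambda>x y. f x * h y * kern \<sigma> x y)) \<longlongrightarrow> tr_form f h) (at 1 within {-1<..<1})"
proof -
  note [measurable] = lipschitz_borel_measurable[OF f] lipschitz_borel_measurable[OF h]
  let ?D = "\<lambda>x y. (f x - f y) * (h x - h y)"
  let ?G = "\<lambda>x y. - 2 * (?D x y * ((4 - x * y) / (edge x * edge y) / (x - y)\<^sup>2))"
  have "((\<lambda>\<sigma>. integral_sq (\<lambda>x y. ?D x y * kern \<sigma> x y)) \<longlongrightarrow> integral_sq ?G) (at 1 within {-1<..<1})"
  proof (rule integral_sq_dominated_convergence)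
    \<comment> \<open>64 = 8 * 8: one factor from \<open>abs_kern_le_uniform\<close>, the other from
      4 - x y \<le> 8.\<close>
    show "sq_integrable (\<lambda>x y. (64 * M * M) / (edge x * edge y))"
      by (rule sq_integrable_inverse_edge)
    have "\<forall>\<^sub>F \<sigma> in at 1 within {-1<..<1}. 1 / 2 < \<sigma> \<and> \<sigma> < (1::real)"
      by (auto simp: eventually_at dist_real_def intro!: exI[of _ "1 / 4"])
    then show "\<forall>\<^sub>F \<sigma> in at 1 within {-1<..<1}. \<forall>x y. \<bar>x\<bar> \<le> 2 \<longrightarrow> \<bar>y\<bar> \<le> 2 \<longrightarrow>
        \<bar>?D x y * kern \<sigma> x y\<bar> \<le> (64 * M * M) / (edge x * edge y)"
    proof eventually_elim
      case (elim \<sigma>)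
      show ?case
      proof (intro allI impI)
        fix x y :: real
        assume xy: "\<bar>x\<bar> \<le> 2" "\<bar>y\<bar> \<le> 2"
        have e: "0 \<le> edge x * edge y" using xy edge_nonneg by simp
        show "\<bar>?D x y * kern \<sigma> x y\<bar> \<le> (64 * M * M) / (edge x * edge y)"
        proof (cases "x = y")
          case False
          have "\<bar>?D x y * kern \<sigma> x y\<bar>
              \<le> (M * M * (x - y)\<^sup>2) * (8 * (4 - x * y) / (edge x * edge y * (x - y)\<^sup>2))"
            unfolding abs_mult[of "?D x y"]
            using abs_lipschitz_product[OF f h, of x y] abs_kern_le_uniform[of \<sigma> x y] elim xy False
            by (intro mult_mono) auto
          also have "\<dots> = M * M * (8 * (4 - x * y)) / (edge x * edge y)"
            using False by simp
          also have "\<dots> \<le> M * M * 64 / (edge x * edge y)"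
            using abs_4_minus_mult[OF xy] e by (intro divide_right_mono mult_left_mono) auto
          finally show ?thesis by (simp add: mult.commute)
        qed (use e in simp)
      qed
    qed
    show "((\<lambda>\<sigma>. ?D x y * kern \<sigma> x y) \<longlongrightarrow> ?G x y) (at 1 within {-1<..<1})"
      if "\<bar>x\<bar> \<le> 2" "\<bar>y\<bar> \<le> 2" for x y
    proof (cases "x = y")
      case False
      then show ?thesis
        using tendsto_mult[OF tendsto_const kern_tendsto[OF that False], of "?D x y"] unfolding mult.left_commute[of "?D x y" "- 2"] by blast
    qed simp
  qed measurable
  then have "((\<lambda>\<sigma>. - 1 / 2 * integral_sq (\<lambda>x y. ?D x y * kern \<sigma> x y)) \<longlongrightarrow> - 1 / 2 * integral_sq ?G)
      (at 1 within {-1<..<1})"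
    by (rule tendsto_mult_left)
  also have "- 1 / 2 * integral_sq ?G = tr_form f h"
    unfolding integral_sq_cmult tr_form_def by (simp add: power2_eq_square mult.commute)
  finally show ?thesis
  proof (rule Lim_transform_eventually)
    show "\<forall>\<^sub>F \<sigma> in at 1 within {-1<..<1}. - 1 / 2 * integral_sq (\<lambda>x y. ?D x y * kern \<sigma> x y)
        = integral_sq (\<lambda>x y. f x * h y * kern \<sigma> x y)"
      unfolding eventually_at_filter
    proof (intro always_eventually allI impI)
      fix \<sigma> :: real
      assume "\<sigma> \<in> {-1<..<1}"
      then have s: "\<bar>\<sigma>\<bar> < 1" by auto
      let ?B = "max (\<bar>f 0\<bar> + 2 * M) (\<bar>h 0\<bar> + 2 * M)"
      have "integral_sq (\<lambda>x y. f x * h y * kern \<sigma> x y) = (LINT x:{-2..2}|lborel. f x * h x * 0)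
          - 1 / 2 * integral_sq (\<lambda>x y. ?D x y * kern \<sigma> x y)"
      proof (rule integral_sq_polarize[where C = "16 / (1 - \<bar>\<sigma>\<bar>) ^ 4" and B = ?B])
        \<comment> \<open>At |x| = 2 the marginal is 0 as well, because the prefactor of
          \<open>kern\<close> is then a division by zero.\<close>
        show "(LINT y:{-2..2}|lborel. kern \<sigma> x y) = 0" if "\<bar>x\<bar> \<le> 2" for x
        proof (cases "\<bar>x\<bar> < 2")
          case False
          then have "x = 2 \<or> x = - 2" using that by linarith
          then have "edge x = 0" by auto
          then show ?thesis by (simp add: kern_def)
        qed (rule integral_kern[OF s])
        show "\<bar>f x\<bar> \<le> ?B" "\<bar>h x\<bar> \<le> ?B" if "\<bar>x\<bar> \<le> 2" for x
          using lipschitz_bounded[OF f that] lipschitz_bounded[OF h that] by auto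
      qed (use abs_kern_le[OF s] kern_sym in \<open>auto\<close>)
      then show "- 1 / 2 * integral_sq (\<lambda>x y. ?D x y * kern \<sigma> x y)
          = integral_sq (\<lambda>x y. f x * h y * kern \<sigma> x y)" by simp
    qed
  qed
qed

section \<open>Poisson kernels\<close>

text \<open>In angles this is 4 times the sum of \<sigma>^(k-1) sin(k\<alpha>) sin(k\<beta>) over k
  \<ge> 1. Integrating in y brings the weight 2 sin \<beta>, which selects k = 1 and explains the
  marginal 4 \<pi> sin \<alpha>, independent of \<sigma>.\<close>

definition pker :: "real \<Rightarrow> real \<Rightarrow> real \<Rightarrow> real" where
  "pker \<sigma> x y = (1 - \<sigma>\<^sup>2) * (edge x * edge y) /
     (\<sigma>\<^sup>2 * (x\<^sup>2 + y\<^sup>2) + (1 - \<sigma>\<^sup>2)\<^sup>2 - x * y * \<sigma> * (1 + \<sigma>\<^sup>2))"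

lemma pker_sym: "pker \<sigma> x y = pker \<sigma> y x"
  by (simp add: pker_def mult_ac add.commute)

lemma pker_uminus: "pker (- \<sigma>) x y = pker \<sigma> x (- y)"
  by (simp add: pker_def)

lemma borel_measurable_pker [measurable]:
  assumes [measurable]: "f \<in> borel_measurable M" "g \<in> borel_measurable M"
  shows "(\<lambda>p. pker \<sigma> (f p) (g p)) \<in> borel_measurable M"
  unfolding pker_def by measurable

lemma pden_product_ge:
  fixes \<sigma> x y :: real
  assumes "\<bar>\<sigma>\<bar> < 1" "\<bar>x\<bar> \<le> 2" "\<bar>y\<bar> \<le> 2"
  shows "(1 - \<bar>\<sigma>\<bar>) ^ 4 \<le> \<sigma>\<^sup>2 * (x\<^sup>2 + y\<^sup>2) + (1 - \<sigma>\<^sup>2)\<^sup>2 - x * y * \<sigma> * (1 + \<sigma>\<^sup>2)"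
proof -
  have "(1 - \<bar>\<sigma>\<bar>) ^ 4 = (1 - \<bar>\<sigma>\<bar>)\<^sup>2 * (1 - \<bar>\<sigma>\<bar>)\<^sup>2"
    by (simp flip: power_add)
  also have "\<dots> \<le> pden \<sigma> (cosp x y) * pden \<sigma> (cosm x y)"
    using pden_ge[OF abs_cosp_le[OF assms(2,3)], of \<sigma>] pden_ge[OF abs_cosm_le[OF assms(2,3)], of \<sigma>]
      pden_pos[OF assms(1) abs_cosp_le[OF assms(2,3)]]
    by (intro mult_mono) simp_all
  finally show ?thesis
    unfolding pden_product[OF assms(2,3)] .
qed

lemma edge_prod_bounds:
  assumes "\<bar>x\<bar> \<le> 2" "\<bar>y\<bar> \<le> 2"
  shows "0 \<le> edge x * edge y" "edge x * edge y \<le> 4"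
  using mult_mono[OF edge_le_2[of x] edge_le_2[of y]] edge_nonneg[OF assms(1)] edge_nonneg[OF assms(2)] by auto

text \<open>The last bound is weaker than the second, by edge x * edge y \<le> 4; it has the shape
  that \<open>integral_sq_polarize\<close> asks for.\<close>

lemma
  assumes "\<bar>\<sigma>\<bar> < 1" "\<bar>x\<bar> \<le> 2" "\<bar>y\<bar> \<le> 2"
  shows pker_nonneg: "0 \<le> pker \<sigma> x y" 
    and pker_le: "pker \<sigma> x y \<le> 4 / (1 - \<bar>\<sigma>\<bar>) ^ 4"
    and pker_le': "pker \<sigma> x y \<le> 16 / (1 - \<bar>\<sigma>\<bar>) ^ 4 / (edge x * edge y)"
proof -
  note e = edge_prod_bounds[OF assms(2,3)]
  have s: "\<sigma>\<^sup>2 < 1" using assms(1) by (simp add: abs_square_less_1)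
  have d: "0 < (1 - \<bar>\<sigma>\<bar>) ^ 4" using assms(1) by simp
  note q = pden_product_ge[OF assms]
  show "0 \<le> pker \<sigma> x y"
    unfolding pker_def by (rule divide_nonneg_nonneg[OF mult_nonneg_nonneg[OF _ e(1)]]) (use s d q in linarith)+
  have "(1 - \<sigma>\<^sup>2) * (edge x * edge y) \<le> 1 * 4"
    using e s by (intro mult_mono) auto
  then show 1: "pker \<sigma> x y \<le> 4 / (1 - \<bar>\<sigma>\<bar>) ^ 4"
    unfolding pker_def using d q by (intro frac_le) auto
  show "pker \<sigma> x y \<le> 16 / (1 - \<bar>\<sigma>\<bar>) ^ 4 / (edge x * edge y)"
  proof (cases "edge x * edge y = 0")
    case True
    then show ?thesis by (auto simp: pker_def)
  next
    case False
    then have "0 < edge x * edge y" using e by linarith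
    then have "4 \<le> 16 / (edge x * edge y)" using e(2) by (subst pos_le_divide_eq) auto
    then have "4 / (1 - \<bar>\<sigma>\<bar>) ^ 4 \<le> 16 / (edge x * edge y) / (1 - \<bar>\<sigma>\<bar>) ^ 4"
      using d by (intro divide_right_mono) auto
    then show ?thesis using 1 by (simp add: mult.commute)
  qed
qed

text \<open>The denominator q equals \<sigma>^2 (x - y)^2 plus a nonnegative multiple of (1 -
  \<sigma>)^2, so (x - y)^2 \<le> 4 q once \<sigma> \<ge> 1/2. The factor 1 - \<sigma>^2 survives
  and makes the off-diagonal part disappear in the limit.\<close>

lemma pker_diag_le:
  assumes "1 / 2 \<le> \<sigma>" "\<sigma> < 1" "\<bar>x\<bar> \<le> 2" "\<bar>y\<bar> \<le> 2"
  shows "(x - y)\<^sup>2 * pker \<sigma> x y \<le> 16 * (1 - \<sigma>\<^sup>2)"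
proof -
  define q where "q = \<sigma>\<^sup>2 * (x\<^sup>2 + y\<^sup>2) + (1 - \<sigma>\<^sup>2)\<^sup>2 - x * y * \<sigma> * (1 + \<sigma>\<^sup>2)"
  have "q = \<sigma>\<^sup>2 * (x - y)\<^sup>2 + (1 - \<sigma>)\<^sup>2 * ((1 - \<sigma>)\<^sup>2 + \<sigma> * (4 - x * y))"
    unfolding q_def by (simp add: power2_eq_square algebra_simps)
  moreover have "0 \<le> (1 - \<sigma>)\<^sup>2 * ((1 - \<sigma>)\<^sup>2 + \<sigma> * (4 - x * y))"
    using abs_4_minus_mult[OF assms(3,4)] assms(1) by simp
  moreover have "1 / 4 \<le> \<sigma>\<^sup>2"
    using power_mono[OF assms(1), of 2] by (simp add: power_divide)
  then have "1 / 4 * (x - y)\<^sup>2 \<le> \<sigma>\<^sup>2 * (x - y)\<^sup>2"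
    by (rule mult_right_mono) simp
  ultimately have q: "(x - y)\<^sup>2 \<le> 4 * q" by linarith
  have qp: "0 < q"
  proof -
    have "\<bar>\<sigma>\<bar> < 1" "0 < (1 - \<bar>\<sigma>\<bar>) ^ 4" using assms(1,2) by auto
    then show ?thesis
      using pden_product_ge[OF _ assms(3,4), of \<sigma>] unfolding q_def by linarith
  qed
  have s: "\<sigma>\<^sup>2 \<le> 1" using assms(1,2) by (simp add: abs_square_le_1)
  note e = edge_prod_bounds[OF assms(3,4)]
  have "(x - y)\<^sup>2 * pker \<sigma> x y = (1 - \<sigma>\<^sup>2) * (edge x * edge y) * ((x - y)\<^sup>2 / q)"
    by (simp add: pker_def q_def)
  also have "\<dots> \<le> ((1 - \<sigma>\<^sup>2) * 4) * 4"
  proof (rule mult_mono)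
    show "(x - y)\<^sup>2 / q \<le> 4" using q qp by (simp add: pos_divide_le_eq)
    show "(1 - \<sigma>\<^sup>2) * (edge x * edge y) \<le> (1 - \<sigma>\<^sup>2) * 4" using s e by (intro mult_left_mono) auto
  qed (use s qp in auto)
  finally show ?thesis by simp
qed

text \<open>If \<open>(c, s)\<close> moves along the unit circle with angular velocity \<open>- e\<close>, then so does, up to the
  Poisson weight, the argument of \<open>1 - \<sigma> (c + i s)\<close>.\<close>

lemma DERIV_arctan_circle:
  assumes c: "(c has_real_derivative e * s x) (at x)" and s: "(s has_real_derivative - e * c x) (at x)"
    and 1: "(c x)\<^sup>2 + (s x)\<^sup>2 = 1" and \<sigma>: "\<bar>\<sigma>\<bar> < 1"
  shows "((\<lambda>u. arctan (\<sigma> * s u / (1 - \<sigma> * c u))) has_real_derivative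
      - e * (\<sigma> * c x - \<sigma>\<^sup>2) / pden \<sigma> (c x)) (at x)"
proof -
  let ?r = "1 - \<sigma> * c x"
  have c1: "\<bar>c x\<bar> \<le> 1" unfolding abs_square_le_1[symmetric] using 1 zero_le_power2[of "s x"] by linarith
  have "\<bar>\<sigma> * c x\<bar> \<le> \<bar>\<sigma>\<bar> * 1" unfolding abs_mult using c1 by (intro mult_left_mono) auto
  then have r: "0 < ?r" using \<sigma> by linarith
  have pd: "pden \<sigma> (c x) = ?r\<^sup>2 + (\<sigma> * s x)\<^sup>2"
  proof -
    have "?r\<^sup>2 + (\<sigma> * s x)\<^sup>2 = 1 - 2 * \<sigma> * c x + \<sigma>\<^sup>2 * ((c x)\<^sup>2 + (s x)\<^sup>2)"
      by (simp add: power2_eq_square algebra_simps)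
    then show ?thesis using 1 by (simp add: pden_def)
  qed
  have p: "0 < pden \<sigma> (c x)" by (rule pden_pos[OF \<sigma> c1])
  have "((\<lambda>u. arctan (\<sigma> * s u / (1 - \<sigma> * c u))) has_real_derivative
      inverse (1 + (\<sigma> * s x / ?r)\<^sup>2) * (((\<sigma> * (- e * c x)) * ?r - \<sigma> * s x * (- (\<sigma> * (e * s x)))) / (?r * ?r))) (at x)"
    using r by (intro DERIV_chain2[OF DERIV_arctan]) (auto intro!: derivative_eq_intros c s)
  also have "inverse (1 + (\<sigma> * s x / ?r)\<^sup>2) = ?r\<^sup>2 / pden \<sigma> (c x)"
    using r p unfolding pd by (simp add: power_divide field_simps)
  also have "(\<sigma> * (- e * c x)) * ?r - \<sigma> * s x * (- (\<sigma> * (e * s x))) = - e * (\<sigma> * c x - \<sigma>\<^sup>2 * ((c x)\<^sup>2 + (s x)\<^sup>2))"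
    by (simp add: power2_eq_square algebra_simps)
  also have "?r\<^sup>2 / pden \<sigma> (c x) * (- e * (\<sigma> * c x - \<sigma>\<^sup>2 * ((c x)\<^sup>2 + (s x)\<^sup>2)) / (?r * ?r))
      = - e * (\<sigma> * c x - \<sigma>\<^sup>2) / pden \<sigma> (c x)"
    using r unfolding 1 by (simp add: power2_eq_square)
  finally show ?thesis .
qed

text \<open>For c = cos \<theta> the fraction on the left is the real part of \<sigma> e^{i\<theta>}
  / (1 - \<sigma> e^{i\<theta>}), the sum of \<sigma>^k cos(k\<theta>) over k \<ge> 1, and the
  Poisson kernel is 1 plus twice this sum.\<close>

lemma poisson_weight: "pden \<sigma> c \<noteq> 0 \<Longrightarrow> 2 * ((\<sigma> * c - \<sigma>\<^sup>2) / pden \<sigma> c) = (1 - \<sigma>\<^sup>2) / pden \<sigma> c - 1"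
  by (simp add: field_simps) (simp add: pden_def algebra_simps)

lemma DERIV_arccos_half:
  assumes "\<bar>y\<bar> < 2"
  shows "((\<lambda>y. arccos (y / 2)) has_real_derivative - 1 / edge y) (at y)"
proof -
  have "sqrt (1 - (y / 2)\<^sup>2) = sqrt ((4 - y\<^sup>2) / 4)"
    by (rule arg_cong[where f = sqrt]) (simp add: power2_eq_square field_simps)
  also have "\<dots> = edge y / 2" by (simp only: real_sqrt_divide edge_def real_sqrt_four)
  finally have *: "sqrt (1 - (y / 2)\<^sup>2) = edge y / 2" .
  have "((\<lambda>y. arccos (y / 2)) has_real_derivative inverse (- sqrt (1 - (y / 2)\<^sup>2)) * (1 / 2)) (at y)"
    by (rule DERIV_chain2[OF DERIV_arccos]) (use assms in \<open>auto intro!: derivative_eq_intros\<close>)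
  then show ?thesis unfolding * by (simp add: inverse_eq_divide)
qed

text \<open>In angles, \<open>2 sin \<beta> * pker\<close> is a difference of two Poisson kernels at \<open>\<alpha> - \<beta>\<close> and \<open>\<alpha> + \<beta>\<close>
  times \<open>2 sin \<beta> / \<sigma>\<close>, and this is its primitive.\<close>

definition pker_prim :: "real \<Rightarrow> real \<Rightarrow> real \<Rightarrow> real" where
  "pker_prim \<sigma> x y = - (1 / (2 * \<sigma>\<^sup>2)) *
     (x * (1 - \<sigma>\<^sup>2) * (ln (pden \<sigma> (cosm x y)) - ln (pden \<sigma> (cosp x y)))
      + edge x * (4 * \<sigma>\<^sup>2 * arccos (y / 2) + 2 * (1 + \<sigma>\<^sup>2) *
         (arctan (\<sigma> * sinp x y / (1 - \<sigma> * cosp x y)) - arctan (\<sigma> * sinm x y / (1 - \<sigma> * cosm x y)))))"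

lemma DERIV_pker_prim:
  assumes \<sigma>: "0 < \<sigma>" "\<sigma> < 1" and x: "\<bar>x\<bar> < 2" and y: "\<bar>y\<bar> < 2"
  shows "((\<lambda>y. pker_prim \<sigma> x y) has_real_derivative pker \<sigma> x y) (at y)"
proof -
  define e where "e = 1 / edge y"
  have ey: "0 < edge y" using y by (rule edge_pos)
  have s1: "\<bar>\<sigma>\<bar> < 1" using \<sigma> by simp
  have cp: "((\<lambda>v. cosp x v) has_real_derivative e * sinp x y) (at y)"
    using DERIV_cosp[OF y x] by (simp add: cos_sym[of x] e_def)
  have sp: "((\<lambda>v. sinp x v) has_real_derivative - e * cosp x y) (at y)"
    using DERIV_sinp[OF y x] by (simp add: cos_sym[of x] e_def)
  have cm: "((\<lambda>v. cosm x v) has_real_derivative (- e) * sinm x y) (at y)"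
    using DERIV_cosm[OF y x] by (simp add: cos_sym[of x] e_def)
  have sm: "((\<lambda>v. sinm x v) has_real_derivative - (- e) * cosm x y) (at y)"
    using DERIV_minus[OF DERIV_sinm[OF y x]] by (simp add: cos_sym[of x] e_def)
  define P Q where "P = pden \<sigma> (cosp x y)" and "Q = pden \<sigma> (cosm x y)"
  have P: "0 < P" and Q: "0 < Q"
    unfolding P_def Q_def using x y by (auto intro!: pden_pos[OF s1] abs_cosp_le abs_cosm_le)
  have ap: "((\<lambda>v. arctan (\<sigma> * sinp x v / (1 - \<sigma> * cosp x v))) has_real_derivative
      - e * (\<sigma> * cosp x y - \<sigma>\<^sup>2) / P) (at y)"
    unfolding P_def using x y by (intro DERIV_arctan_circle cp sp s1 cosp_sinp) auto
  have am: "((\<lambda>v. arctan (\<sigma> * sinm x v / (1 - \<sigma> * cosm x v))) has_real_derivative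
      - (- e) * (\<sigma> * cosm x y - \<sigma>\<^sup>2) / Q) (at y)"
    unfolding Q_def using x y by (intro DERIV_arctan_circle cm sm s1 cosm_sinm) auto
  have lp: "((\<lambda>v. ln (pden \<sigma> (cosp x v))) has_real_derivative 1 / P * (- (2 * \<sigma> * (e * sinp x y)))) (at y)"
    unfolding P_def using P unfolding P_def pden_def
    by (intro DERIV_chain2[OF DERIV_ln_divide]) (auto intro!: derivative_eq_intros cp)
  have lm: "((\<lambda>v. ln (pden \<sigma> (cosm x v))) has_real_derivative 1 / Q * (- (2 * \<sigma> * ((- e) * sinm x y)))) (at y)"
    unfolding Q_def using Q unfolding Q_def pden_def
    by (intro DERIV_chain2[OF DERIV_ln_divide]) (auto intro!: derivative_eq_intros cm)
  have "((\<lambda>y. pker_prim \<sigma> x y) has_real_derivative - (1 / (2 * \<sigma>\<^sup>2)) *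
     (x * (1 - \<sigma>\<^sup>2) * (1 / Q * (- (2 * \<sigma> * ((- e) * sinm x y))) - 1 / P * (- (2 * \<sigma> * (e * sinp x y))))
      + edge x * (4 * \<sigma>\<^sup>2 * (- 1 / edge y) + 2 * (1 + \<sigma>\<^sup>2) *
         (- e * (\<sigma> * cosp x y - \<sigma>\<^sup>2) / P - - (- e) * (\<sigma> * cosm x y - \<sigma>\<^sup>2) / Q)))) (at y)"
    unfolding pker_prim_def
    by (intro DERIV_cmult DERIV_add DERIV_diff ap am lp lm DERIV_arccos_half y)
  also have "- (1 / (2 * \<sigma>\<^sup>2)) *
     (x * (1 - \<sigma>\<^sup>2) * (1 / Q * (- (2 * \<sigma> * ((- e) * sinm x y))) - 1 / P * (- (2 * \<sigma> * (e * sinp x y))))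
      + edge x * (4 * \<sigma>\<^sup>2 * (- 1 / edge y) + 2 * (1 + \<sigma>\<^sup>2) *
         (- e * (\<sigma> * cosp x y - \<sigma>\<^sup>2) / P - - (- e) * (\<sigma> * cosm x y - \<sigma>\<^sup>2) / Q)))
    = - (e / (2 * \<sigma>\<^sup>2)) * (x * (1 - \<sigma>\<^sup>2) * (2 * \<sigma>) * (sinm x y / Q + sinp x y / P)
      - edge x * (4 * \<sigma>\<^sup>2 + (1 + \<sigma>\<^sup>2) *
         (2 * ((\<sigma> * cosp x y - \<sigma>\<^sup>2) / P) + 2 * ((\<sigma> * cosm x y - \<sigma>\<^sup>2) / Q))))"
  proof -
    have "- w * (X * (Q' * (- (2 * \<sigma> * ((- e) * B))) - P' * (- (2 * \<sigma> * (e * A))))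
      + E * (4 * \<sigma>\<^sup>2 * (- 1 * e) + 2 * r * ((- e * u) * P' - (- (- e) * v) * Q')))
      = - (e * w) * (X * (2 * \<sigma>) * (B * Q' + A * P') - E * (4 * \<sigma>\<^sup>2 + r * (2 * (u * P') + 2 * (v * Q'))))"
      for w X P' Q' A B E r u v by (simp add: algebra_simps)
    from this[of "1 / (2 * \<sigma>\<^sup>2)" "x * (1 - \<sigma>\<^sup>2)" "1 / Q" "sinm x y" "1 / P" "sinp x y" "edge x" "1 + \<sigma>\<^sup>2"
        "\<sigma> * cosp x y - \<sigma>\<^sup>2" "\<sigma> * cosm x y - \<sigma>\<^sup>2"]
    show ?thesis by (simp only: e_def divide_inverse mult_1_left mult_1_right mult_minus_left)
  qed
  also have "\<dots> = - (e / (2 * \<sigma>\<^sup>2)) * (x * (1 - \<sigma>\<^sup>2) * (2 * \<sigma>) * (sinm x y / Q + sinp x y / P)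
      - edge x * (4 * \<sigma>\<^sup>2 + (1 + \<sigma>\<^sup>2) * (((1 - \<sigma>\<^sup>2) / P - 1) + ((1 - \<sigma>\<^sup>2) / Q - 1))))"
    using P Q unfolding P_def Q_def by (subst (1 2) poisson_weight) auto
  also have "\<dots> = - (e * (1 - \<sigma>\<^sup>2) / (2 * \<sigma>\<^sup>2)) *
      ((2 * \<sigma> * x * sinp x y + edge x * (P - (1 + \<sigma>\<^sup>2))) / P + (2 * \<sigma> * x * sinm x y + edge x * (Q - (1 + \<sigma>\<^sup>2))) / Q)"
  proof -
    \<comment> \<open>Used with r = 1 + \<sigma>^2 and t = 1 - \<sigma>^2. The side condition says
      that the arccos term of the primitive exactly absorbs the constants -1 left by
      \<open>poisson_weight\<close>.\<close>
    have "x * t * (2 * \<sigma>) * (B / Q + A / P) - E * (4 * \<sigma>\<^sup>2 + r * ((t / P - 1) + (t / Q - 1)))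
      = t * ((2 * \<sigma> * x * A + E * (P - r)) / P + (2 * \<sigma> * x * B + E * (Q - r)) / Q)"
      if "4 * \<sigma>\<^sup>2 - 2 * r = - 2 * t" for A B E r t
    proof -
      have "4 * \<sigma>\<^sup>2 = 2 * r - 2 * t" using that by simp
      have "(a + E * (R - r)) / R = a / R + E - E * r / R" if "0 < R" for a R
        using that by (simp add: field_simps)
      note * = this[OF P] this[OF Q]
      show ?thesis
        unfolding * \<open>4 * \<sigma>\<^sup>2 = 2 * r - 2 * t\<close> unfolding divide_inverse by (simp add: algebra_simps)
    qed
    from this[of "1 + \<sigma>\<^sup>2" "1 - \<sigma>\<^sup>2"] show ?thesis by simp
  qed
  \<comment> \<open>An addition theorem: x sin(\<alpha> + \<beta>) - edge x cos(\<alpha> + \<beta>)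
    = 2 sin \<beta>. With \<alpha> - \<beta> in place of \<alpha> + \<beta> the sign is
    reversed.\<close>
  also have "2 * \<sigma> * x * sinp x y + edge x * (P - (1 + \<sigma>\<^sup>2)) = 2 * \<sigma> * edge y"
  proof -
    have "2 * \<sigma> * x * sinp x y + edge x * (P - (1 + \<sigma>\<^sup>2)) = 2 * \<sigma> * (edge y * (x\<^sup>2 + (edge x)\<^sup>2) / 4)"
      by (simp add: P_def pden_def sinp_def cosp_def power2_eq_square field_simps)
    then show ?thesis using x by (simp add: edge_square)
  qed
  also have "2 * \<sigma> * x * sinm x y + edge x * (Q - (1 + \<sigma>\<^sup>2)) = - (2 * \<sigma> * edge y)"
  proof -
    have "2 * \<sigma> * x * sinm x y + edge x * (Q - (1 + \<sigma>\<^sup>2)) = - (2 * \<sigma> * (edge y * (x\<^sup>2 + (edge x)\<^sup>2) / 4))"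
      by (simp add: Q_def pden_def sinm_def cosm_def power2_eq_square field_simps)
    then show ?thesis using x by (simp add: edge_square)
  qed
  also have "- (e * (1 - \<sigma>\<^sup>2) / (2 * \<sigma>\<^sup>2)) * (2 * \<sigma> * edge y / P + - (2 * \<sigma> * edge y) / Q)
      = (1 - \<sigma>\<^sup>2) * ((P - Q) / \<sigma>) / (P * Q)"
  proof -
    have *: "2 * \<sigma> * edge y / P + - (2 * \<sigma> * edge y) / Q = 2 * \<sigma> * edge y * (Q - P) / (P * Q)"
      using P Q by (simp add: field_simps)
    have "- (1 / edge y * t / (2 * \<sigma>\<^sup>2)) * (2 * \<sigma> * edge y * (Q - P) / R) = t * ((P - Q) / \<sigma>) / R" for t R
      using ey \<sigma> by (simp add: power2_eq_square divide_simps) (simp add: algebra_simps)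
    then show ?thesis unfolding * e_def .
  qed
  \<comment> \<open>The difference of the two Poisson denominators restores the numerator of
    \<open>pker\<close>, their product its denominator.\<close>
  also have "(P - Q) / \<sigma> = edge x * edge y"
    using \<sigma> by (simp add: P_def Q_def pden_def cosp_def cosm_def field_simps)
  also have "P * Q = \<sigma>\<^sup>2 * (x\<^sup>2 + y\<^sup>2) + (1 - \<sigma>\<^sup>2)\<^sup>2 - x * y * \<sigma> * (1 + \<sigma>\<^sup>2)"
    unfolding P_def Q_def using x y by (intro pden_product) auto
  also have "(1 - \<sigma>\<^sup>2) * (edge x * edge y) / (\<sigma>\<^sup>2 * (x\<^sup>2 + y\<^sup>2) + (1 - \<sigma>\<^sup>2)\<^sup>2 - x * y * \<sigma> * (1 + \<sigma>\<^sup>2)) = pker \<sigma> x y"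
    by (simp add: pker_def)
  finally show ?thesis .
qed

lemma one_minus_mult_pos: "\<bar>\<sigma>\<bar> < 1 \<Longrightarrow> \<bar>c\<bar> \<le> 1 \<Longrightarrow> 0 < 1 - \<sigma> * (c::real)"
  using mult_mono[of "\<bar>\<sigma>\<bar>" "\<bar>\<sigma>\<bar>" "\<bar>c\<bar>" 1] abs_ge_self[of "\<sigma> * c"] by (simp add: abs_mult)

text \<open>Positivity of \<sigma> serves the primitive, which divides by \<sigma>^2; the limit at
  \<sigma> = -1 is reached through \<open>pker_uminus\<close>. At |x| = 2 both sides vanish.\<close>

lemma integral_pker:
  assumes \<sigma>: "0 < \<sigma>" "\<sigma> < 1" and x: "\<bar>x\<bar> \<le> 2"
  shows "(LINT y:{-2..2}|lborel. pker \<sigma> x y) = 2 * pi * edge x"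
proof (cases "\<bar>x\<bar> < 2")
  case False
  then have "x = 2 \<or> x = - 2" using x by linarith
  then have "edge x = 0" by auto
  then show ?thesis by (simp add: pker_def)
next
  case x: True
  have s1: "\<bar>\<sigma>\<bar> < 1" using \<sigma> by simp
  have nz: "pden \<sigma> (cosp x y) \<noteq> 0" "pden \<sigma> (cosm x y) \<noteq> 0" 
     "1 - \<sigma> * cosp x y \<noteq> 0" "1 - \<sigma> * cosm x y \<noteq> 0" if "y \<in> {-2..2}" for y
  proof -
    have xy: "\<bar>x\<bar> \<le> 2" "\<bar>y\<bar> \<le> 2" using x that by auto
    show "pden \<sigma> (cosp x y) \<noteq> 0" "pden \<sigma> (cosm x y) \<noteq> 0" 
     "1 - \<sigma> * cosp x y \<noteq> 0" "1 - \<sigma> * cosm x y \<noteq> 0"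
      using pden_pos[OF s1 abs_cosp_le[OF xy]] pden_pos[OF s1 abs_cosm_le[OF xy]]
      one_minus_mult_pos[OF s1 abs_cosp_le[OF xy]] one_minus_mult_pos[OF s1 abs_cosm_le[OF xy]] by linarith+
  qed
  show ?thesis
  proof (rule has_integral_imp_set_lebesgue)
    show "set_integrable lborel {-2..2} (pker \<sigma> x)"
    proof (rule set_integrable_bounded_by_inverse_edge)
      show "\<bar>pker \<sigma> x y\<bar> \<le> 16 / (1 - \<bar>\<sigma>\<bar>) ^ 4 / edge x / edge y" if "\<bar>y\<bar> \<le> 2" for y
        using pker_le'[OF s1, of x y] pker_nonneg[OF s1, of x y] x that by (simp add: mult.assoc)
    qed measurable
    have "(pker \<sigma> x has_integral (pker_prim \<sigma> x 2 - pker_prim \<sigma> x (-2))) {-2..2}"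
    proof (rule fundamental_theorem_of_calculus_interior)
      have c: "continuous_on {-2..2} (\<lambda>y. cosp x y)" "continuous_on {-2..2} (\<lambda>y. cosm x y)"
        "continuous_on {-2..2} (\<lambda>y. sinp x y)" "continuous_on {-2..2} (\<lambda>y. sinm x y)"
        by (auto simp: cosp_def cosm_def sinp_def sinm_def intro!: continuous_intros)
      then have d: "continuous_on {-2..2} (\<lambda>y. pden \<sigma> (cosp x y))" "continuous_on {-2..2} (\<lambda>y. pden \<sigma> (cosm x y))"
        by (auto simp: pden_def intro!: continuous_intros)
      show "continuous_on {-2..2} (\<lambda>y. pker_prim \<sigma> x y)"
        unfolding pker_prim_def using \<sigma>
        by (intro continuous_intros c d) (use nz in auto)
      show "((\<lambda>y. pker_prim \<sigma> x y) has_vector_derivative pker \<sigma> x y) (at y)" if "y \<in> {-2<..<2}" for y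
        unfolding has_real_derivative_iff_has_vector_derivative[symmetric]
        using \<sigma> x that by (intro DERIV_pker_prim) auto
    qed auto
    \<comment> \<open>At the edges the angles \<alpha> + \<beta> and \<alpha> - \<beta> agree modulo
      2\<pi>, so the logarithms and arctangents cancel in pairs. Only arccos remains, which is 0 at
      y = 2 and \<pi> at y = -2.\<close>
    moreover have "pker_prim \<sigma> x 2 = 0"
      by (simp add: pker_prim_def sinp_def sinm_def cosp_def cosm_def)
    moreover have "pker_prim \<sigma> x (-2) = - 2 * pi * edge x"
      using \<sigma> by (simp add: pker_prim_def sinp_def sinm_def cosp_def cosm_def)
    ultimately show "(pker \<sigma> x has_integral 2 * pi * edge x) {-2..2}" by simp
  qed
qed

text \<open>In contrast to \<open>kern\<close>, the marginal carries the whole limit here: the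
  kernel concentrates on the diagonal, and the polarized remainder tends to 0 by
  \<open>pker_diag_le\<close>.\<close>

lemma integral_pker_tendsto:
  assumes f: "M-lipschitz_on UNIV f" and h: "M-lipschitz_on UNIV h"
  shows "((\<lambda>\<sigma>. integral_sq (\<lambda>x y. f x * h y * pker \<sigma> x y))
    \<longlongrightarrow> (4 * pi\<^sup>2) * avg_sc (\<lambda>x. f x * h x)) (at 1 within {-1<..<1})"
proof -
  note [measurable] = lipschitz_borel_measurable[OF f] lipschitz_borel_measurable[OF h]
  have M: "0 \<le> M" by (rule lipschitz_on_nonneg[OF f])
  let ?D = "\<lambda>x y. (f x - f y) * (h x - h y)"
  have const: "set_integrable lborel {-2..2} (\<lambda>x::real. 1::real)"
    unfolding set_integrable_def by (simp add: integrable_indicator_iff)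
  have sqc: "sq_integrable (\<lambda>x y. c)" "integral_sq (\<lambda>x y. c) = 16 * c" for c
    using sq_integrable_cmult[OF sq_integrable_tensor[OF const const], of c]
      integral_sq_cmult[of c "\<lambda>x y. 1 * 1"] integral_sq_tensor[OF const const]
    by (simp_all add: set_lebesgue_integral_def)
  have ev: "\<forall>\<^sub>F \<sigma> in at 1 within {-1<..<1}. 1 / 2 < \<sigma> \<and> \<sigma> < (1::real)"
    by (auto simp: eventually_at dist_real_def intro!: exI[of _ "1 / 4"])
  \<comment> \<open>256 = 16 * 16, the constant of \<open>pker_diag_le\<close> times the area of the
    square.\<close>
  have bnd: "\<bar>integral_sq (\<lambda>x y. ?D x y * pker \<sigma> x y)\<bar> \<le> 256 * M * M * (1 - \<sigma>\<^sup>2)" if s: "1 / 2 < \<sigma>" "\<sigma> < 1" for \<sigma>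
  proof -
    have "\<bar>integral_sq (\<lambda>x y. ?D x y * pker \<sigma> x y)\<bar> \<le> integral_sq (\<lambda>x y. M * M * (16 * (1 - \<sigma>\<^sup>2)))"
    proof (rule abs_integral_sq_le)
      fix x y :: real
      assume xy: "\<bar>x\<bar> \<le> 2" "\<bar>y\<bar> \<le> 2"
      have p: "0 \<le> pker \<sigma> x y" by (rule pker_nonneg) (use s xy in auto)
      have "\<bar>?D x y * pker \<sigma> x y\<bar> \<le> (M * M * (x - y)\<^sup>2) * pker \<sigma> x y"
        unfolding abs_mult[of "?D x y"] using abs_lipschitz_product[OF f h, of x y] p
        by (intro mult_mono) auto
      also have "\<dots> = M * M * ((x - y)\<^sup>2 * pker \<sigma> x y)" by simp
      also have "\<dots> \<le> M * M * (16 * (1 - \<sigma>\<^sup>2))"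
        using s xy M by (intro mult_left_mono pker_diag_le) auto
      finally show "\<bar>?D x y * pker \<sigma> x y\<bar> \<le> M * M * (16 * (1 - \<sigma>\<^sup>2))" .
    qed (rule sqc)
    then show ?thesis unfolding sqc by (simp only: mult_ac)
  qed
  have "((\<lambda>\<sigma>. 256 * M * M * (1 - \<sigma>\<^sup>2)) \<longlongrightarrow> 256 * M * M * (1 - 1\<^sup>2)) (at 1 within {-1<..<1})"
    by (intro tendsto_intros)
  then have "((\<lambda>\<sigma>. 256 * M * M * (1 - \<sigma>\<^sup>2)) \<longlongrightarrow> 0) (at 1 within {-1<..<1})" by simp
  then have "((\<lambda>\<sigma>. integral_sq (\<lambda>x y. ?D x y * pker \<sigma> x y)) \<longlongrightarrow> 0) (at 1 within {-1<..<1})"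
    by (rule Lim_null_comparison[rotated]) (use ev bnd in \<open>auto elim!: eventually_mono\<close>)
  then have "((\<lambda>\<sigma>. (LINT x:{-2..2}|lborel. f x * h x * (2 * pi * edge x))
      - 1 / 2 * integral_sq (\<lambda>x y. ?D x y * pker \<sigma> x y))
      \<longlongrightarrow> (LINT x:{-2..2}|lborel. f x * h x * (2 * pi * edge x)) - 1 / 2 * 0) (at 1 within {-1<..<1})"
    by (intro tendsto_intros)
  also have "(LINT x:{-2..2}|lborel. f x * h x * (2 * pi * edge x)) - 1 / 2 * 0 = (4 * pi\<^sup>2) * avg_sc (\<lambda>x. f x * h x)"
  proof -
    have "(4 * pi\<^sup>2) * avg_sc (\<lambda>x. f x * h x)
        = (LINT x:{-2..2}|lborel. (4 * pi\<^sup>2) * (f x * h x * sqrt (4 - x\<^sup>2) / (2 * pi)))"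
      unfolding avg_sc_def by (rule set_integral_mult_right[symmetric])
    also have "(\<lambda>x. (4 * pi\<^sup>2) * (f x * h x * sqrt (4 - x\<^sup>2) / (2 * pi))) = (\<lambda>x. f x * h x * (2 * pi * edge x))"
      by (rule ext) (simp add: edge_def power2_eq_square)
    finally show ?thesis by simp
  qed
  finally show ?thesis
  proof (rule Lim_transform_eventually)
    show "\<forall>\<^sub>F \<sigma> in at 1 within {-1<..<1}. (LINT x:{-2..2}|lborel. f x * h x * (2 * pi * edge x))
      - 1 / 2 * integral_sq (\<lambda>x y. ?D x y * pker \<sigma> x y) = integral_sq (\<lambda>x y. f x * h y * pker \<sigma> x y)"
      using ev
    proof eventually_elim
      case (elim \<sigma>)
      let ?B = "max (\<bar>f 0\<bar> + 2 * M) (\<bar>h 0\<bar> + 2 * M)"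
      show ?case
      proof (rule integral_sq_polarize[symmetric, where C = "16 / (1 - \<bar>\<sigma>\<bar>) ^ 4" and B = ?B])
        show "\<bar>f x\<bar> \<le> ?B" "\<bar>h x\<bar> \<le> ?B" if "\<bar>x\<bar> \<le> 2" for x
          using lipschitz_bounded[OF f that] lipschitz_bounded[OF h that] by auto
        show "(LINT y:{-2..2}|lborel. pker \<sigma> x y) = 2 * pi * edge x" if "\<bar>x\<bar> \<le> 2" for x
          using elim that by (intro integral_pker) auto
        show "\<bar>pker \<sigma> x y\<bar> \<le> 16 / (1 - \<bar>\<sigma>\<bar>) ^ 4 / (edge x * edge y)" if "\<bar>x\<bar> \<le> 2" "\<bar>y\<bar> \<le> 2" for x y
          using pker_le'[OF _ that, of \<sigma>] pker_nonneg[OF _ that, of \<sigma>] elim by auto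
      qed (auto simp: pker_sym[of \<sigma>] intro: pker_sym)
    qed
  qed
qed

text \<open>The weight in \<^const>\<open>E_tr\<close> is a Poisson kernel at the doubled angle, \<open>cosp x x = cos (2 \<alpha>)\<close>.\<close>

definition eker :: "real \<Rightarrow> real \<Rightarrow> real" where
  "eker \<sigma> x = (1 - \<sigma>\<^sup>2) / ((1 + \<sigma>)\<^sup>2 - \<sigma> * x\<^sup>2)"

lemma borel_measurable_eker [measurable]: "eker \<sigma> \<in> borel_measurable borel"
  unfolding eker_def by measurable

lemma pden_diag:
  assumes "\<bar>x\<bar> \<le> 2"
  shows "pden \<sigma> (cosp x x) = (1 + \<sigma>)\<^sup>2 - \<sigma> * x\<^sup>2"
proof -
  have "cosp x x = (x\<^sup>2 - (edge x)\<^sup>2) / 4" by (simp add: cosp_def power2_eq_square)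
  then have "cosp x x = x\<^sup>2 / 2 - 1" using assms by (simp add: edge_square field_simps)
  then show ?thesis unfolding pden_def by (simp only:) (simp add: power2_eq_square field_simps)
qed

lemma eker_bounds:
  assumes "\<bar>\<sigma>\<bar> < 1" "\<bar>x\<bar> \<le> 2"
  shows "0 \<le> eker \<sigma> x" "eker \<sigma> x \<le> 1 / (1 - \<bar>\<sigma>\<bar>)\<^sup>2"
proof -
  have p: "(1 - \<bar>\<sigma>\<bar>)\<^sup>2 \<le> (1 + \<sigma>)\<^sup>2 - \<sigma> * x\<^sup>2"
    unfolding pden_diag[OF assms(2), symmetric] using assms(2) by (intro pden_ge abs_cosp_le)
  have d: "0 < (1 - \<bar>\<sigma>\<bar>)\<^sup>2" using assms(1) by simp
  have s: "\<sigma>\<^sup>2 < 1" using assms(1) by (simp add: abs_square_less_1)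
  show "0 \<le> eker \<sigma> x" unfolding eker_def by (rule divide_nonneg_nonneg) (use p d s in linarith)+
  show "eker \<sigma> x \<le> 1 / (1 - \<bar>\<sigma>\<bar>)\<^sup>2" unfolding eker_def by (rule frac_le) (use p d s in auto)
qed

text \<open>The primitive is -\<alpha> plus the argument of 1 - \<sigma> e^{2i\<alpha>}, by
  \<open>poisson_weight\<close> at the doubled angle. As sin(2\<alpha>) vanishes at both edges, only
  the arccos contributes.\<close>

lemma integral_eker:
  assumes \<sigma>: "\<bar>\<sigma>\<bar> < 1"
  shows "set_integrable lborel {-2..2} (\<lambda>x. eker \<sigma> x / edge x)"
    and "(LINT x:{-2..2}|lborel. eker \<sigma> x / edge x) = pi"
proof -
  show 1: "set_integrable lborel {-2..2} (\<lambda>x. eker \<sigma> x / edge x)"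
  proof (rule set_integrable_bounded_by_inverse_edge)
    show "\<bar>eker \<sigma> x / edge x\<bar> \<le> 1 / (1 - \<bar>\<sigma>\<bar>)\<^sup>2 / edge x" if "\<bar>x\<bar> \<le> 2" for x
      unfolding abs_divide using eker_bounds[OF \<sigma> that] edge_nonneg[OF that] by (simp only: abs_of_nonneg divide_right_mono)
  qed measurable
  let ?F = "\<lambda>x. - arccos (x / 2) - arctan (\<sigma> * sinp x x / (1 - \<sigma> * cosp x x))"
  have "((\<lambda>x. eker \<sigma> x / edge x) has_integral (?F 2 - ?F (-2))) {-2..2}"
  proof (rule fundamental_theorem_of_calculus_interior)
    have "1 - \<sigma> * cosp x x \<noteq> 0" if "x \<in> {-2..2}" for x
    proof -
      have "\<bar>x\<bar> \<le> 2" using that by auto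
      from one_minus_mult_pos[OF \<sigma> abs_cosp_le[OF this this]] show ?thesis by linarith
    qed
    moreover have "continuous_on {-2..2} (\<lambda>x. cosp x x)" "continuous_on {-2..2} (\<lambda>x. sinp x x)"
      by (auto simp: cosp_def sinp_def intro!: continuous_intros)
    ultimately show "continuous_on {-2..2} ?F"
      by (intro continuous_intros) auto
    fix x :: real
    assume "x \<in> {-2<..<2}"
    then have x: "\<bar>x\<bar> < 2" by auto
    note e = edge_pos[OF x]
    have c: "((\<lambda>x. cosp x x) has_real_derivative 2 / edge x * sinp x x) (at x)"
      unfolding cosp_def sinp_def using e
      by (auto intro!: derivative_eq_intros DERIV_edge[OF x] simp: field_simps)
    have s: "((\<lambda>x. sinp x x) has_real_derivative - (2 / edge x) * cosp x x) (at x)"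
      unfolding cosp_def sinp_def using e
      by (auto intro!: derivative_eq_intros DERIV_edge[OF x] simp: field_simps)
    have p: "pden \<sigma> (cosp x x) \<noteq> 0" using pden_pos[OF \<sigma> abs_cosp_le, of x x] x by auto
    have "(?F has_real_derivative - (- 1 / edge x) - - (2 / edge x) * (\<sigma> * cosp x x - \<sigma>\<^sup>2) / pden \<sigma> (cosp x x)) (at x)"
      by (intro DERIV_diff DERIV_minus DERIV_arccos_half DERIV_arctan_circle c s \<sigma> cosp_sinp x) (use x in auto)
    also have "- (- 1 / edge x) - - (2 / edge x) * (\<sigma> * cosp x x - \<sigma>\<^sup>2) / pden \<sigma> (cosp x x)
        = (1 + 2 * ((\<sigma> * cosp x x - \<sigma>\<^sup>2) / pden \<sigma> (cosp x x))) / edge x"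
      by (simp add: add_divide_distrib)
    also have "\<dots> = eker \<sigma> x / edge x"
      unfolding poisson_weight[OF p] eker_def using x by (simp add: pden_diag)
    finally show "(?F has_vector_derivative eker \<sigma> x / edge x) (at x)"
      unfolding has_real_derivative_iff_has_vector_derivative[symmetric] .
  qed auto
  then have "((\<lambda>x. eker \<sigma> x / edge x) has_integral pi) {-2..2}"
    by (simp add: sinp_def)
  with 1 show "(LINT x:{-2..2}|lborel. eker \<sigma> x / edge x) = pi"
    by (rule has_integral_imp_set_lebesgue)
qed

section \<open>Regularity of functions in the Sobolev ball\<close>

lemma
  shows integrable_cauchy: "integrable lborel (\<lambda>x::real. 1 / (1 + x\<^sup>2))"
    and integral_cauchy: "(LINT x|lborel. 1 / (1 + x\<^sup>2)) = pi"
proof -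
  have nz: "1 + x\<^sup>2 \<noteq> 0" for x :: real
    using zero_le_power2[of x] by linarith
  have d: "DERIV arctan x :> 1 / (1 + x\<^sup>2)" for x
    using DERIV_arctan[of x] by (simp add: inverse_eq_divide)
  have c: "isCont (\<lambda>x. 1 / (1 + x\<^sup>2)) x" for x :: real
    using nz by (intro continuous_intros) auto
  have A: "((arctan \<circ> real_of_ereal) \<longlongrightarrow> - (pi / 2)) (at_right (- \<infinity>))"
    "((arctan \<circ> real_of_ereal) \<longlongrightarrow> pi / 2) (at_left \<infinity>)"
    using tendsto_arctan_at_bot tendsto_arctan_at_top by (simp_all only: ereal_tendsto_simps)
  have *: "set_integrable lborel (einterval (- \<infinity>) \<infinity>) (\<lambda>x::real. 1 / (1 + x\<^sup>2))"
    "(LBINT x=-\<infinity>..\<infinity>. 1 / (1 + x\<^sup>2)) = pi / 2 - - (pi / 2)"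
    by (rule interval_integral_FTC_nonneg[where F = arctan]; use d c A in simp)+
  show "integrable lborel (\<lambda>x::real. 1 / (1 + x\<^sup>2))"
    using *(1) by (simp add: set_integrable_def)
  show "(LINT x|lborel. 1 / (1 + x\<^sup>2)) = pi"
    using *(2) by (simp add: interval_lebesgue_integral_def set_lebesgue_integral_def)
qed

section \<open>Test functions and the one-dimensional Sobolev embedding\<close>

lemma test_function_deriv: 
  assumes "test_function \<phi>"
  shows "test_function (deriv \<phi>)" "(\<phi> has_real_derivative deriv \<phi> x) (at x)"
proof -
  have d: "(deriv ^^ n) \<phi> differentiable (at x)" for n x
    using assms by (auto simp: test_function_def)
  show "(\<phi> has_real_derivative deriv \<phi> x) (at x)"
    using d[of 0 x] by (simp add: DERIV_deriv_iff_real_differentiable)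
  have "supp (deriv \<phi>) \<subseteq> supp \<phi>"
    unfolding supp_def
  proof (rule closure_minimal)
    show "{x. deriv \<phi> x \<noteq> 0} \<subseteq> closure {x. \<phi> x \<noteq> 0}"
    proof (rule subsetI, rule ccontr)
      fix x
      assume "x \<in> {x. deriv \<phi> x \<noteq> 0}" and x: "x \<notin> closure {x. \<phi> x \<noteq> 0}"
      have "((\<lambda>_. 0) has_real_derivative 0) (at x)" by simp
      then have "(\<phi> has_real_derivative 0) (at x)"
      proof (rule has_field_derivative_transform_within_open)
        show "open (- closure {x. \<phi> x \<noteq> 0})" by (simp add: open_Compl)
        show "0 = \<phi> y" if "y \<in> - closure {x. \<phi> x \<noteq> 0}" for y
          using that closure_subset[of "{x. \<phi> x \<noteq> 0}"] by auto
      qed (use x in simp)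
      then have "deriv \<phi> x = 0" by (rule DERIV_imp_deriv)
      with \<open>x \<in> {x. deriv \<phi> x \<noteq> 0}\<close> show False by simp
    qed
  qed simp
  moreover have "closed (supp (deriv \<phi>))" by (simp add: supp_def)
  ultimately have "compact (supp (deriv \<phi>))"
    using assms compact_Int_closed[of "supp \<phi>" "supp (deriv \<phi>)"]
    by (simp add: test_function_def inf.absorb2)
  moreover have "(deriv ^^ n) (deriv \<phi>) differentiable (at x)" for n x
    using d[of "Suc n" x] by (simp add: funpow_swap1)
  ultimately show "test_function (deriv \<phi>)" by (simp add: test_function_def)
qed

lemma test_function_continuous: "test_function \<phi> \<Longrightarrow> continuous_on A \<phi>"
  by (rule DERIV_continuous_on, rule has_field_derivative_at_within, rule test_function_deriv(2))

lemma test_function_bounded_support: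
  assumes "test_function \<phi>"
  obtains R where "\<And>x. \<phi> x \<noteq> 0 \<Longrightarrow> \<bar>x\<bar> \<le> R"
proof -
  have "bounded (supp \<phi>)" using assms by (simp add: test_function_def compact_imp_bounded)
  then obtain R where "\<forall>x \<in> supp \<phi>. \<bar>x\<bar> \<le> R" by (auto simp: bounded_iff)
  then show ?thesis
    using that closure_subset[of "{x. \<phi> x \<noteq> 0}"] by (auto simp: supp_def)
qed

lemma test_function_square_integrable:
  assumes "test_function \<phi>"
  shows "square_integrable \<phi>"
proof -
  obtain R where R: "\<And>x. \<phi> x \<noteq> 0 \<Longrightarrow> \<bar>x\<bar> \<le> R"
    using test_function_bounded_support[OF assms] by blast
  have "integrable lborel (\<lambda>x. indicator {-R..R} x *\<^sub>R (\<phi> x)\<^sup>2)"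
    by (intro borel_integrable_compact continuous_intros test_function_continuous assms) auto
  also have "(\<lambda>x. indicator {-R..R} x *\<^sub>R (\<phi> x)\<^sup>2) = (\<lambda>x. (\<phi> x)\<^sup>2)"
    using R by (force simp: fun_eq_iff indicator_def)
  finally show ?thesis
    using test_function_continuous[OF assms, of UNIV]
    by (simp add: square_integrable_def borel_measurable_continuous_onI)
qed

lemma L2_norm_square: "(L2_norm g)\<^sup>2 = (LINT x|lborel. (g x)\<^sup>2)"
  by (simp add: L2_norm_def L2_inner_def power2_eq_square)

lemma square_add_le: "(a + b)\<^sup>2 \<le> 2 * a\<^sup>2 + 2 * (b::real)\<^sup>2"
proof -
  have "(a + b)\<^sup>2 + (a - b)\<^sup>2 = 2 * a\<^sup>2 + 2 * b\<^sup>2"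
    by (simp add: power2_eq_square algebra_simps)
  then show ?thesis using zero_le_power2[of "a - b"] by linarith
qed

lemma square_integrable_diff:
  assumes "square_integrable f" "square_integrable g"
  shows "square_integrable (\<lambda>x. f x - g x)"
proof -
  have [measurable]: "f \<in> borel_measurable borel" "g \<in> borel_measurable borel"
    using assms by (auto simp: square_integrable_def)
  have "integrable lborel (\<lambda>x. 2 * (f x)\<^sup>2 + 2 * (g x)\<^sup>2)"
    using assms by (auto simp: square_integrable_def)
  then have "integrable lborel (\<lambda>x. (f x - g x)\<^sup>2)"
    by (rule Bochner_Integration.integrable_bound)
       (use square_add_le[of "f _" "- g _"] in \<open>auto simp: abs_of_nonneg\<close>)
  then show ?thesis by (simp add: square_integrable_def)
qed

lemma L2_norm_square_approx:
  assumes "square_integrable f" "square_integrable g"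
  shows "(L2_norm g)\<^sup>2 \<le> 2 * (L2_norm f)\<^sup>2 + 2 * (L2_norm (\<lambda>x. f x - g x))\<^sup>2"
proof -
  note d = square_integrable_diff[OF assms]
  have "(LINT x|lborel. (g x)\<^sup>2) \<le> (LINT x|lborel. 2 * (f x)\<^sup>2 + 2 * (f x - g x)\<^sup>2)"
  proof (rule integral_mono)
    show "(g x)\<^sup>2 \<le> 2 * (f x)\<^sup>2 + 2 * (f x - g x)\<^sup>2" for x
      using square_add_le[of "f x" "- (f x - g x)"] by (simp only: power2_minus) simp
  qed (use assms d in \<open>auto simp: square_integrable_def\<close>)
  also have "\<dots> = 2 * (LINT x|lborel. (f x)\<^sup>2) + 2 * (LINT x|lborel. (f x - g x)\<^sup>2)"
    using assms d by (simp add: square_integrable_def)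
  finally show ?thesis by (simp add: L2_norm_square)
qed

text \<open>\<open>\<phi>(x)\<^sup>2\<close> is the integral of \<open>2 \<phi> \<phi>'\<close> up to \<open>x\<close>.\<close>

lemma test_function_sup_bound:
  assumes "test_function \<phi>"
  shows "(\<phi> x)\<^sup>2 \<le> (L2_norm \<phi>)\<^sup>2 + (L2_norm (deriv \<phi>))\<^sup>2"
proof -
  note d = test_function_deriv[OF assms]
  note si = test_function_square_integrable[OF assms] test_function_square_integrable[OF d(1)]
  obtain R where R: "\<And>x. \<phi> x \<noteq> 0 \<Longrightarrow> \<bar>x\<bar> \<le> R"
    using test_function_bounded_support[OF assms] by blast
  define b where "b = min x (- R - 1)"
  have "b \<le> - R - 1" "b \<le> x" by (auto simp: b_def)
  then have b: "\<phi> b = 0" "b \<le> x" using R[of b] by (auto simp: abs_le_iff)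
  let ?F = "\<lambda>x. 2 * \<phi> x * deriv \<phi> x"
  have c: "continuous_on {b..x} ?F"
    by (intro continuous_intros test_function_continuous assms d)
  have "((\<lambda>x. (\<phi> x)\<^sup>2) has_vector_derivative ?F y) (at y within {b..x})" for y
    unfolding has_real_derivative_iff_has_vector_derivative[symmetric]
    by (rule has_field_derivative_at_within) (auto intro!: derivative_eq_intros d(2))
  then have "(?F has_integral (\<phi> x)\<^sup>2 - (\<phi> b)\<^sup>2) {b..x}"
    using b by (intro fundamental_theorem_of_calculus) auto
  moreover have "set_integrable lborel {b..x} ?F"
    unfolding set_integrable_def by (intro borel_integrable_compact c) simp
  ultimately have "(\<phi> x)\<^sup>2 = (LINT y:{b..x}|lborel. ?F y)"
    using b by (simp add: has_integral_imp_set_lebesgue)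
  also have "\<dots> \<le> \<bar>LINT y:{b..x}|lborel. ?F y\<bar>" by simp
  also have "\<dots> \<le> (LINT y|lborel. (\<phi> y)\<^sup>2 + (deriv \<phi> y)\<^sup>2)"
    unfolding set_lebesgue_integral_def
  proof (rule abs_integral_le)
    have "\<bar>2 * p * q\<bar> \<le> p\<^sup>2 + q\<^sup>2" for p q :: real
      using zero_le_power2[of "p - q"] zero_le_power2[of "p + q"]
      by (auto simp: abs_le_iff power2_eq_square algebra_simps)
    then show "\<bar>indicator {b..x} y *\<^sub>R ?F y\<bar> \<le> (\<phi> y)\<^sup>2 + (deriv \<phi> y)\<^sup>2" for y
      by (simp add: indicator_def)
  qed (use si in \<open>auto simp: square_integrable_def\<close>)
  also have "\<dots> = (L2_norm \<phi>)\<^sup>2 + (L2_norm (deriv \<phi>))\<^sup>2"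
    using si by (simp add: square_integrable_def L2_norm_square)
  finally show ?thesis .
qed

text \<open>The complement of the closure is open and a null set, hence empty.\<close>

lemma AE_lborel_dense:
  assumes "AE x in lborel. P (x::real)"
  shows "closure {x. P x} = UNIV"
proof (rule ccontr)
  assume *: "closure {x. P x} \<noteq> UNIV"
  let ?U = "- closure {x. P x}"
  have "AE x in lborel. x \<notin> ?U"
    using assms by eventually_elim (use closure_subset[of "{x. P x}"] in auto)
  then have "?U \<in> null_sets lborel"
    by (subst AE_iff_null_sets) auto
  then have "negligible ?U"
    by (simp add: negligible_iff_null_sets null_sets_completionI)
  moreover have "open ?U" "?U \<noteq> {}" using * by (auto simp: open_Compl)
  ultimately show False using open_not_negligible by blast
qed

text \<open>The squared differences tend to 0 in L1, and L1 convergence provides a subsequence that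
  converges almost everywhere.\<close>

lemma L2_approx_AE:
  assumes g: "square_integrable g" and \<phi>: "\<And>n. square_integrable (\<phi> n)"
    and lim: "(\<lambda>n. L2_norm (\<lambda>x. g x - \<phi> n x)) \<longlonglongrightarrow> 0"
  obtains r where "strict_mono r" "AE x in lborel. (\<lambda>n. \<phi> (r n) x) \<longlonglongrightarrow> g x"
proof -
  have "(\<lambda>n. (L2_norm (\<lambda>x. g x - \<phi> n x))\<^sup>2) \<longlonglongrightarrow> 0\<^sup>2"
    by (intro tendsto_intros lim)
  then have "(\<lambda>n. LINT x|lborel. norm ((g x - \<phi> n x)\<^sup>2)) \<longlonglongrightarrow> 0"
    by (simp add: L2_norm_square)
  moreover have "integrable lborel (\<lambda>x. (g x - \<phi> n x)\<^sup>2)" for n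
    using square_integrable_diff[OF g \<phi>, of n] by (simp add: square_integrable_def)
  ultimately obtain r where r: "strict_mono (r :: nat \<Rightarrow> nat)" 
    and ae: "AE x in lborel. (\<lambda>n. (g x - \<phi> (r n) x)\<^sup>2) \<longlonglongrightarrow> 0"
    using tendsto_L1_AE_subseq[of lborel "\<lambda>n x. (g x - \<phi> n x)\<^sup>2"] by blast
  have "AE x in lborel. (\<lambda>n. \<phi> (r n) x) \<longlonglongrightarrow> g x"
    using ae
  proof eventually_elim
    case (elim x)
    have "(\<lambda>n. sqrt ((g x - \<phi> (r n) x)\<^sup>2)) \<longlonglongrightarrow> sqrt 0"
      by (intro tendsto_real_sqrt elim)
    then have "(\<lambda>n. g x - \<phi> (r n) x) \<longlonglongrightarrow> 0"
      by (simp add: tendsto_rabs_zero_iff)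
    then have "(\<lambda>n. g x - (g x - \<phi> (r n) x)) \<longlonglongrightarrow> g x - 0"
      by (intro tendsto_intros)
    then show ?case by simp
  qed
  with r show ?thesis using that by blast
qed

text \<open>Sobolev embedding for g': applied to the derivatives of the approximating test
  functions, the supremum bound makes these uniformly Lipschitz. The Lipschitz bound passes to the
  limit on a set of full measure, which is dense, and extends by continuity of
  \<open>g\<close>.\<close>

lemma H20_lipschitz:
  assumes g: "continuous_on UNIV g" and H: "H20_derivs g g1 g2"
    and K: "(L2_norm g1)\<^sup>2 + (L2_norm g2)\<^sup>2 \<le> K\<^sup>2" "0 \<le> K"
  shows "(2 * K + 1)-lipschitz_on UNIV g"
proof -
  obtain \<phi> where \<phi>: "\<And>n. test_function (\<phi> n)"
      and l0: "(\<lambda>n. L2_norm (\<lambda>x. g x - \<phi> n x)) \<longlonglongrightarrow> 0"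
      and l1: "(\<lambda>n. L2_norm (\<lambda>x. g1 x - deriv (\<phi> n) x)) \<longlonglongrightarrow> 0"
      and l2: "(\<lambda>n. L2_norm (\<lambda>x. g2 x - deriv (deriv (\<phi> n)) x)) \<longlonglongrightarrow> 0"
    and si: "square_integrable g" "square_integrable g1" "square_integrable g2"
    using H unfolding H20_derivs_def by blast
  note d = test_function_deriv[OF \<phi>]
  note dd = test_function_deriv[OF d(1)]
  note s = test_function_square_integrable
  have "(\<lambda>n. 2 * (L2_norm (\<lambda>x. g1 x - deriv (\<phi> n) x))\<^sup>2 + 2 * (L2_norm (\<lambda>x. g2 x - deriv (deriv (\<phi> n)) x))\<^sup>2)
      \<longlonglongrightarrow> 2 * 0\<^sup>2 + 2 * 0\<^sup>2"
    by (intro tendsto_intros l1 l2)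
  then have "\<forall>\<^sub>F n in sequentially. 2 * (L2_norm (\<lambda>x. g1 x - deriv (\<phi> n) x))\<^sup>2
      + 2 * (L2_norm (\<lambda>x. g2 x - deriv (deriv (\<phi> n)) x))\<^sup>2 < 1"
    by (rule order_tendstoD) simp
  then have lip: "\<forall>\<^sub>F n in sequentially. (2 * K + 1)-lipschitz_on UNIV (\<phi> n)"
  proof eventually_elim
    case (elim n)
    have "\<bar>deriv (\<phi> n) x\<bar> \<le> 2 * K + 1" for x
    proof (rule power2_le_imp_le[OF order_trans])
      \<comment> \<open>The approximation costs a factor 2 in front of K^2 and an error below 1; 2
        K^2 + 1 \<le> (2 K + 1)^2 then gives the stated constant.\<close>
      have "(deriv (\<phi> n) x)\<^sup>2 \<le> 2 * K\<^sup>2 + 1"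
        using test_function_sup_bound[OF d(1)[of n], of x] L2_norm_square_approx[OF si(2) s[OF d(1)[of n]]]
          L2_norm_square_approx[OF si(3) s[OF dd(1)[of n]]] elim K by linarith
      then show "\<bar>deriv (\<phi> n) x\<bar>\<^sup>2 \<le> 2 * K\<^sup>2 + 1" by simp
      show "2 * K\<^sup>2 + 1 \<le> (2 * K + 1)\<^sup>2" "0 \<le> 2 * K + 1"
        using K(2) by (simp_all add: power2_eq_square algebra_simps)
    qed
    then have "norm (\<phi> n x - \<phi> n y) \<le> (2 * K + 1) * norm (x - y)" for x y
      by (intro field_differentiable_bound[where S = UNIV and f' = "deriv (\<phi> n)"]) (auto intro: d(2))
    then show ?case
      using K(2) by (intro lipschitz_onI) (auto simp: dist_norm)
  qed
  obtain r where r: "strict_mono r" and ae: "AE x in lborel. (\<lambda>n. \<phi> (r n) x) \<longlonglongrightarrow> g x"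
    using L2_approx_AE[OF si(1) s[OF \<phi>] l0] by blast
  let ?S = "{x. (\<lambda>n. \<phi> (r n) x) \<longlonglongrightarrow> g x}"
  let ?T = "{p. \<bar>g (fst p) - g (snd p)\<bar> \<le> (2 * K + 1) * \<bar>fst p - snd p\<bar>}"
  have lip': "\<forall>\<^sub>F n in sequentially. (2 * K + 1)-lipschitz_on UNIV (\<phi> (r n))"
    using lip r by (rule eventually_subseq[rotated])
  \<comment> \<open>\<open>?T\<close> is closed because \<open>g\<close> is continuous, so it
    contains the closure of \<open>?S \<times> ?S\<close>, which is the whole plane.\<close>
  have "?S \<times> ?S \<subseteq> ?T"
  proof safe
    fix x y
    assume "(\<lambda>n. \<phi> (r n) x) \<longlonglongrightarrow> g x" "(\<lambda>n. \<phi> (r n) y) \<longlonglongrightarrow> g y"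
    then have "(\<lambda>n. \<bar>\<phi> (r n) x - \<phi> (r n) y\<bar>) \<longlonglongrightarrow> \<bar>g x - g y\<bar>"
      by (intro tendsto_intros)
    moreover have "\<forall>\<^sub>F n in sequentially. \<bar>\<phi> (r n) x - \<phi> (r n) y\<bar> \<le> (2 * K + 1) * \<bar>x - y\<bar>"
      using lip'
    proof eventually_elim
      case (elim n)
      then show ?case using lipschitz_onD[OF elim, of x y] by (simp add: dist_real_def)
    qed
    ultimately have "\<bar>g x - g y\<bar> \<le> (2 * K + 1) * \<bar>x - y\<bar>"
      by (rule tendsto_upperbound) simp
    then show "\<bar>g (fst (x, y)) - g (snd (x, y))\<bar> \<le> (2 * K + 1) * \<bar>fst (x, y) - snd (x, y)\<bar>" by simp
  qed
  moreover have "closed ?T"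
    by (intro closed_Collect_le continuous_intros continuous_on_compose2[OF g]) auto
  ultimately have "closure (?S \<times> ?S) \<subseteq> ?T" by (rule closure_minimal)
  then have "UNIV \<subseteq> ?T"
    unfolding closure_Times AE_lborel_dense[OF ae] by simp
  then have "\<bar>g x - g y\<bar> \<le> (2 * K + 1) * \<bar>x - y\<bar>" for x y
    using subsetD[of UNIV ?T "(x, y)"] by simp
  then show ?thesis
    using K(2) by (intro lipschitz_onI) (auto simp: dist_real_def)
qed

lemma H20_ball_properties:
  assumes "g \<in> H20_ball K L"
  shows "(2 * K + 1)-lipschitz_on UNIV g" "0 \<le> K" "\<And>x. g x \<noteq> 0 \<Longrightarrow> \<bar>x\<bar> \<le> L"
proof -
  have g: "continuous_on UNIV g" "\<exists>g1 g2. H20_derivs g g1 g2" "H20_norm g \<le> K" "supp g \<subseteq> {-L..L}"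
    using assms by (auto simp: H20_ball_def H20_def)
  define p where "p = (SOME (g1, g2). H20_derivs g g1 g2)"
  \<comment> \<open>\<open>p\<close> is the pair chosen inside \<open>H20_norm\<close>. As some pair
    of weak derivatives exists, the chosen one is genuine, and the norm bound controls it.\<close>
  have "\<exists>q. case q of (g1, g2) \<Rightarrow> H20_derivs g g1 g2" using g(2) by auto
  then have "case p of (g1, g2) \<Rightarrow> H20_derivs g g1 g2" unfolding p_def by (rule someI_ex)
  then have p: "H20_derivs g (fst p) (snd p)" by (simp add: case_prod_unfold)
  have n: "H20_norm g = sqrt ((L2_norm g)\<^sup>2 + (L2_norm (fst p))\<^sup>2 + (L2_norm (snd p))\<^sup>2)"
    unfolding H20_norm_def p_def[symmetric] by (simp add: case_prod_unfold Let_def)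
  have "0 \<le> H20_norm g" unfolding n by simp
  then show K: "0 \<le> K" using g(3) by linarith
  have "(L2_norm g)\<^sup>2 + (L2_norm (fst p))\<^sup>2 + (L2_norm (snd p))\<^sup>2 \<le> K\<^sup>2"
    using g(3) unfolding n by (rule sqrt_le_D)
  then have "(L2_norm (fst p))\<^sup>2 + (L2_norm (snd p))\<^sup>2 \<le> K\<^sup>2"
    using zero_le_power2[of "L2_norm g"] by linarith
  then show "(2 * K + 1)-lipschitz_on UNIV g"
    by (rule H20_lipschitz[OF g(1) p _ K])
  show "\<bar>x\<bar> \<le> L" if "g x \<noteq> 0" for x
    using g(4) that closure_subset[of "{x. g x \<noteq> 0}"] by (force simp: supp_def)
qed

section \<open>Comparison with the Sobolev form on the plane\<close>

lemma integrable_bounded_support: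
  fixes f :: "real \<Rightarrow> real"
  assumes "continuous_on UNIV f" and "\<And>x. f x \<noteq> 0 \<Longrightarrow> \<bar>x\<bar> \<le> R"
  shows "integrable lborel f"
proof -
  have "integrable lborel (\<lambda>x. indicator {-R..R} x *\<^sub>R f x)"
    by (intro borel_integrable_compact continuous_on_subset[OF assms(1)]) auto
  also have "(\<lambda>x. indicator {-R..R} x *\<^sub>R f x) = f"
    using assms(2) by (force simp: fun_eq_iff indicator_def abs_le_iff)
  finally show ?thesis .
qed

text \<open>With n = 4 - x y and e = edge x * edge y one has n^2 - e^2 = 4 (x - y)^2, hence n / e -
  1 = 4 (x - y)^2 / ((n + e) e); the summand e in n + e is dropped.\<close>

lemma semicircle_weight_bound:
  assumes "\<bar>x\<bar> < 2" "\<bar>y\<bar> < 2"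
  shows "0 \<le> (4 - x * y) / (edge x * edge y) - 1"
    and "(4 - x * y) / (edge x * edge y) - 1 \<le> 4 * (x - y)\<^sup>2 / ((4 - x * y) * (edge x * edge y))"
proof -
  define n e where "n = 4 - x * y" and "e = edge x * edge y"
  have e: "0 < e" using assms by (simp add: e_def edge_pos)
  have "\<bar>x * y\<bar> < 2 * 2" unfolding abs_mult using assms by (intro mult_strict_mono') auto
  then have n: "0 < n" by (simp add: n_def abs_if split: if_splits)
  have ne: "n\<^sup>2 - e\<^sup>2 = 4 * (x - y)\<^sup>2"
    unfolding n_def e_def power_mult_distrib using assms
    by (simp add: edge_square) (simp add: power2_eq_square algebra_simps)
  then have "e\<^sup>2 \<le> n\<^sup>2" using zero_le_power2[of "x - y"] by linarith
  then have en: "e \<le> n" by (rule power2_le_imp_le) (use n in simp)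
  then have "1 \<le> n / e" using e by simp
  then show "0 \<le> (4 - x * y) / (edge x * edge y) - 1" by (simp add: n_def e_def)
  have "n / e - 1 = (n\<^sup>2 - e\<^sup>2) / ((n + e) * e)"
  proof -
    have "n\<^sup>2 - e\<^sup>2 = (n + e) * (n - e)" by (simp add: power2_eq_square algebra_simps)
    then show ?thesis using e n by (simp add: diff_divide_distrib)
  qed
  also have "\<dots> \<le> (n\<^sup>2 - e\<^sup>2) / (n * e)"
    using e n ne by (intro divide_left_mono mult_right_mono) auto
  finally show "(4 - x * y) / (edge x * edge y) - 1 \<le> 4 * (x - y)\<^sup>2 / ((4 - x * y) * (edge x * edge y))"
    unfolding ne by (simp add: n_def e_def)
qed

lemma abs_diff_mult_le: "\<bar>(a - b) * (c - d)\<bar> \<le> (a\<^sup>2 + c\<^sup>2) + (b\<^sup>2 + (d::real)\<^sup>2)"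
proof -
  have "2 * \<bar>p * q\<bar> \<le> p\<^sup>2 + q\<^sup>2" for p q :: real
    using zero_le_power2[of "\<bar>p\<bar> - \<bar>q\<bar>"] by (simp add: power2_diff abs_mult)
  from this[of "a - b" "c - d"] show ?thesis
    using square_add_le[of a "- b"] square_add_le[of c "- d"] by simp
qed

text \<open>On the diagonal the weight of \<^const>\<open>tr_form\<close> is \<open>1\<close> up to \<open>O((x - y)\<^sup>2)\<close>, which
  cancels the denominator.\<close>

lemma tr_form_Hhalf_inner:
  assumes f: "M-lipschitz_on UNIV f" and h: "M-lipschitz_on UNIV h" and \<delta>: "0 < \<delta>"
    and fs: "\<And>x. f x \<noteq> 0 \<Longrightarrow> \<bar>x\<bar> \<le> 2 - \<delta>" and hs: "\<And>x. h x \<noteq> 0 \<Longrightarrow> \<bar>x\<bar> \<le> 2 - \<delta>"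
  shows "\<bar>tr_form f h - Hhalf_inner f h\<bar> \<le> 14 * pi / \<delta>\<^sup>2 * ((LINT x|lborel. (f x)\<^sup>2) + (LINT x|lborel. (h x)\<^sup>2))"
proof -
  note [measurable] = lipschitz_borel_measurable[OF f] lipschitz_borel_measurable[OF h]
  note cont = lipschitz_on_continuous_on[OF f] lipschitz_on_continuous_on[OF h]
  define u where "u x = (f x)\<^sup>2 + (h x)\<^sup>2" for x
  \<comment> \<open>The majorant will be \<open>u x * v y + v x * u y\<close>. The edge term of
    \<open>v\<close> covers points inside the square, the Cauchy term the tail with |y| \<ge> 2. The
    integrals 2\<pi>/\<delta>^2 and 5\<pi>/\<delta>^2 add up to 7\<pi>/\<delta>^2, and the two
    halves of the majorant double this to 14.\<close>
  define v where "v x = indicator {-2..2} x *\<^sub>R (2 / \<delta>\<^sup>2 * (1 / edge x)) + 5 / \<delta>\<^sup>2 * (1 / (1 + x\<^sup>2))" for x :: real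
  define A where "A x y = (f x - f y) / (x - y) * ((h x - h y) / (x - y))" for x y
  define w where "w x y = (4 - x * y) / (edge x * edge y)" for x y
  \<comment> \<open>The difference of the two integrands on the whole plane: the weighted one is cut
    off to the square, the Sobolev one is not.\<close>
  define D where "D x y = indicator ({-2..2} \<times> {-2..2}) (x, y) *\<^sub>R (A x y * w x y) - A x y" for x y
  have [measurable]: "(\<lambda>(x, y). A x y) \<in> borel_measurable (borel \<Otimes>\<^sub>M borel)"
    "(\<lambda>(x, y). w x y) \<in> borel_measurable (borel \<Otimes>\<^sub>M borel)"
    unfolding A_def w_def by measurable
  have [measurable]: "(\<lambda>(x, y). D x y) \<in> borel_measurable (borel \<Otimes>\<^sub>M borel)"
    unfolding D_def by measurable
  have u0: "0 \<le> u x" for x by (simp add: u_def)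
  have us: "\<bar>x\<bar> \<le> 2 - \<delta>" if "u x \<noteq> 0" for x
    using that fs[of x] hs[of x] by (auto simp: u_def)
  have v1: "5 / \<delta>\<^sup>2 * (1 / (1 + x\<^sup>2)) \<le> v x" for x
    unfolding v_def using edge_nonneg[of x] by (auto simp: indicator_def abs_le_iff)
  have v2: "2 / (\<delta>\<^sup>2 * edge x) \<le> v x" if "\<bar>x\<bar> \<le> 2" for x
    unfolding v_def using that by (auto simp: indicator_def abs_le_iff)
  have v0: "0 \<le> v x" for x
    by (rule order_trans[OF _ v1]) (intro mult_nonneg_nonneg divide_nonneg_nonneg add_nonneg_nonneg, auto)
  have iu: "integrable lborel u"
    unfolding u_def
    by (intro Bochner_Integration.integrable_add integrable_bounded_support[where R = "2 - \<delta>"] continuous_intros cont)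
       (use fs hs in auto)
  have Iu: "integral\<^sup>L lborel u = (LINT x|lborel. (f x)\<^sup>2) + (LINT x|lborel. (h x)\<^sup>2)"
    unfolding u_def
    by (intro Bochner_Integration.integral_add integrable_bounded_support[where R = "2 - \<delta>"] continuous_intros cont)
       (use fs hs in auto)
  have se: "integrable lborel (\<lambda>x. indicator {-2..2} x *\<^sub>R (2 / \<delta>\<^sup>2 * (1 / edge x)))"
    using set_integrable_mult_right[OF set_integrable_inverse_edge, of "2 / \<delta>\<^sup>2"]
    by (simp add: set_integrable_def)
  have iv: "integrable lborel v"
    unfolding v_def by (intro Bochner_Integration.integrable_add se integrable_mult_right integrable_cauchy)
  have Iv: "integral\<^sup>L lborel v = 7 * pi / \<delta>\<^sup>2"
  proof -
    have "integral\<^sup>L lborel v = (LINT x:{-2..2}|lborel. 2 / \<delta>\<^sup>2 * (1 / edge x)) + (LINT x|lborel. 5 / \<delta>\<^sup>2 * (1 / (1 + x\<^sup>2)))"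
      unfolding v_def set_lebesgue_integral_def
      by (intro Bochner_Integration.integral_add se integrable_mult_right integrable_cauchy)
    also have "\<dots> = 2 / \<delta>\<^sup>2 * pi + 5 / \<delta>\<^sup>2 * pi"
      unfolding set_integral_mult_right integral_inverse_edge integral_mult_right_zero integral_cauchy ..
    finally show ?thesis by (simp add: add_divide_distrib)
  qed
  \<comment> \<open>Here x is in the support of \<open>u\<close>, so 4 - x y \<ge> 2\<delta> and
    edge x \<ge> \<delta>; the factor 1 / edge y is left to \<open>v\<close>.\<close>
  have near: "u x * 4 / ((4 - x * y) * (edge x * edge y)) \<le> u x * v y" if xy: "\<bar>x\<bar> < 2" "\<bar>y\<bar> < 2" for x y
  proof (cases "u x = 0")
    case False
    then have x: "\<bar>x\<bar> \<le> 2 - \<delta>" by (rule us)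
    have "\<bar>x * y\<bar> \<le> (2 - \<delta>) * 2" unfolding abs_mult using x xy by (intro mult_mono) auto
    then have n: "2 * \<delta> \<le> 4 - x * y" by (simp add: abs_le_iff)
    have e: "\<delta> \<le> edge x" "0 < edge y" using x xy \<delta> by (auto intro: edge_ge edge_pos)
    have "2 * \<delta> * (\<delta> * edge y) \<le> (4 - x * y) * (edge x * edge y)"
      using n e \<delta> by (intro mult_mono) auto
    then have "4 / ((4 - x * y) * (edge x * edge y)) \<le> 4 / (2 * \<delta> * (\<delta> * edge y))"
      using \<delta> e n by (intro divide_left_mono mult_pos_pos) linarith+
    also have "\<dots> = 2 / (\<delta>\<^sup>2 * edge y)" by (simp add: power2_eq_square)
    also have "\<dots> \<le> v y" using xy by (intro v2) auto
    finally show ?thesis using mult_left_mono[OF _ u0[of x]] by fastforce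
  qed simp
  \<comment> \<open>For x in the bulk and |y| \<ge> 2 the distance |x - y| is at least \<delta> |y|
    / 2. Since y^2 \<ge> 4, also 1 + y^2 \<le> 5 y^2 / 4, which is the origin of the constant
    5.\<close>
  have far: "u x / (x - y)\<^sup>2 \<le> u x * v y" if y: "2 \<le> \<bar>y\<bar>" for x y
  proof (cases "u x = 0")
    case False
    then have x: "\<bar>x\<bar> \<le> 2 - \<delta>" by (rule us)
    then have \<delta>2: "\<delta> \<le> 2" by linarith
    have "(2 - \<delta>) * 2 \<le> (2 - \<delta>) * \<bar>y\<bar>" using y \<delta>2 by (intro mult_left_mono) auto
    then have "\<delta> * \<bar>y\<bar> / 2 \<le> \<bar>y\<bar> - \<bar>x\<bar>" using x by (simp add: algebra_simps)
    also have "\<dots> \<le> \<bar>x - y\<bar>" by linarith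
    finally have "(\<delta> * \<bar>y\<bar> / 2)\<^sup>2 \<le> \<bar>x - y\<bar>\<^sup>2" using \<delta> by (intro power_mono) auto
    then have 1: "\<delta>\<^sup>2 * y\<^sup>2 / 4 \<le> (x - y)\<^sup>2" by (simp add: power_mult_distrib power_divide)
    have "4 \<le> y\<^sup>2" using power_mono[OF y, of 2] by simp
    then have "\<delta>\<^sup>2 * (1 + y\<^sup>2) \<le> \<delta>\<^sup>2 * (5 * y\<^sup>2 / 4)" by (intro mult_left_mono) auto
    then have 2: "\<delta>\<^sup>2 * (1 + y\<^sup>2) / 5 \<le> (x - y)\<^sup>2" using 1 by simp
    have 3: "0 < \<delta>\<^sup>2 * (1 + y\<^sup>2) / 5" using \<delta> zero_le_power2[of y] by (simp add: add_pos_nonneg)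
    have "1 / (x - y)\<^sup>2 \<le> 1 / (\<delta>\<^sup>2 * (1 + y\<^sup>2) / 5)"
      using 2 3 by (intro divide_left_mono) (auto intro!: mult_pos_pos)
    also have "\<dots> = 5 / \<delta>\<^sup>2 * (1 / (1 + y\<^sup>2))" by simp
    also have "\<dots> \<le> v y" by (rule v1)
    finally show ?thesis using mult_left_mono[OF _ u0[of x]] by fastforce
  qed simp
  have A: "A x y = (f x - f y) * (h x - h y) / (x - y)\<^sup>2" for x y
    by (simp add: A_def power2_eq_square)
  have numer: "\<bar>(f x - f y) * (h x - h y)\<bar> \<le> u x + u y" for x y
    unfolding u_def by (rule abs_diff_mult_le)
  have Dbound: "\<bar>D x y\<bar> \<le> u x * v y + v x * u y" for x y
  proof (cases "\<bar>x\<bar> < 2 \<and> \<bar>y\<bar> < 2")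
    case True
    then have xy: "\<bar>x\<bar> < 2" "\<bar>y\<bar> < 2" by auto
    then have "D x y = A x y * (w x y - 1)" by (auto simp: D_def indicator_def abs_le_iff algebra_simps)
    then have "\<bar>D x y\<bar> = \<bar>(f x - f y) * (h x - h y)\<bar> / (x - y)\<^sup>2 * (w x y - 1)"
      using semicircle_weight_bound(1)[OF xy] by (simp add: A abs_mult w_def)
    also have "\<dots> \<le> \<bar>(f x - f y) * (h x - h y)\<bar> / (x - y)\<^sup>2 * (4 * (x - y)\<^sup>2 / ((4 - x * y) * (edge x * edge y)))"
      unfolding w_def by (intro mult_left_mono semicircle_weight_bound(2)[OF xy]) auto
    also have "\<dots> = \<bar>(f x - f y) * (h x - h y)\<bar> * (4 / ((4 - x * y) * (edge x * edge y)))"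
      by (cases "x = y") auto
    also have "\<dots> \<le> (u x + u y) * (4 / ((4 - x * y) * (edge x * edge y)))"
      using edge_nonneg[of x] edge_nonneg[of y] abs_4_minus_mult[of x y] xy
      by (intro mult_right_mono numer divide_nonneg_nonneg mult_nonneg_nonneg) auto
    also have "\<dots> = u x * 4 / ((4 - x * y) * (edge x * edge y)) + u y * 4 / ((4 - y * x) * (edge y * edge x))"
      by (simp add: distrib_right mult.commute add_divide_distrib)
    also have "\<dots> \<le> u x * v y + u y * v x"
      using near[OF xy] near[OF xy(2,1)] by linarith
    finally show ?thesis by (simp add: mult.commute)
  next
    case False
    then have "edge x * edge y = 0 \<or> \<not> (\<bar>x\<bar> \<le> 2 \<and> \<bar>y\<bar> \<le> 2)"
    proof -
      have "edge z = 0" if "\<bar>z\<bar> = 2" for z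
      proof -
        have "z = 2 \<or> z = - 2" using that by linarith
        then show ?thesis by auto
      qed
      moreover have "\<bar>x\<bar> = 2 \<or> \<bar>y\<bar> = 2 \<or> \<not> (\<bar>x\<bar> \<le> 2 \<and> \<bar>y\<bar> \<le> 2)" using False by linarith
      ultimately show ?thesis by auto
    qed
    \<comment> \<open>On the boundary of the square the weight is a division by zero, so D is -A
      there just as it is outside.\<close>
    then have "\<bar>D x y\<bar> = \<bar>(f x - f y) * (h x - h y)\<bar> / (x - y)\<^sup>2"
      by (auto simp: D_def A w_def indicator_def abs_le_iff)
    also have "\<dots> \<le> (u x + u y) / (x - y)\<^sup>2"
      by (intro divide_right_mono numer) simp
    also have "\<dots> = u x / (x - y)\<^sup>2 + u y / (y - x)\<^sup>2"
      by (simp add: add_divide_distrib power2_commute)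
    also have "\<dots> \<le> u x * v y + u y * v x"
    proof (cases "2 \<le> \<bar>y\<bar>")
      case True
      then have "u y = 0" using us[of y] \<delta> by fastforce
      then show ?thesis using far[OF True, of x] by simp
    next
      case y: False
      then have x: "2 \<le> \<bar>x\<bar>" using False by auto
      then have "u x = 0" using us[of x] \<delta> by fastforce
      then show ?thesis using far[OF x, of y] by simp
    qed
    finally show ?thesis by (simp add: mult.commute)
  qed
  have iB: "integrable (lborel :: (real \<times> real) measure) (\<lambda>p. (case p of (x, y) \<Rightarrow> u x * v y) + (case p of (x, y) \<Rightarrow> v x * u y))"
    by (intro Bochner_Integration.integrable_add integrable_tensor iu iv)
  have IB: "(LINT p|(lborel :: (real \<times> real) measure). (case p of (x, y) \<Rightarrow> u x * v y) + (case p of (x, y) \<Rightarrow> v x * u y))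
      = 2 * (integral\<^sup>L lborel u * integral\<^sup>L lborel v)"
    by (subst Bochner_Integration.integral_add) (auto simp: integral_tensor iu iv integrable_tensor)
  have Db: "\<bar>case p of (x, y) \<Rightarrow> D x y\<bar> \<le> (case p of (x, y) \<Rightarrow> u x * v y) + (case p of (x, y) \<Rightarrow> v x * u y)" for p
    using Dbound by (cases p) auto
  have iD: "integrable (lborel :: (real \<times> real) measure) (\<lambda>(x, y). D x y)"
  proof (rule Bochner_Integration.integrable_bound[OF iB])
    show "(\<lambda>(x, y). D x y) \<in> borel_measurable lborel" 
      using \<open>(\<lambda>(x, y). D x y) \<in> borel_measurable (borel \<Otimes>\<^sub>M borel)\<close> by (simp add: borel_prod)
    show "AE p in lborel. norm (case p of (x, y) \<Rightarrow> D x y)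
        \<le> norm ((case p of (x, y) \<Rightarrow> u x * v y) + (case p of (x, y) \<Rightarrow> v x * u y))"
      unfolding real_norm_def by (intro AE_I2 order_trans[OF Db abs_ge_self])
  qed
  have sqA: "sq_integrable (\<lambda>x y. A x y * w x y)"
  proof (rule sq_integrable_bounded_by_inverse_edge)
    fix x y :: real
    assume xy: "\<bar>x\<bar> \<le> 2" "\<bar>y\<bar> \<le> 2"
    have MM: "0 \<le> M * M" by simp
    have a: "\<bar>A x y\<bar> \<le> M * M"
      unfolding A abs_divide using abs_lipschitz_product[OF f h, of x y] MM
      by (cases "x = y") (auto simp: pos_divide_le_eq)
    have b: "\<bar>w x y\<bar> \<le> 8 / (edge x * edge y)"
      unfolding w_def abs_divide using abs_4_minus_mult[OF xy] edge_prod_bounds[OF xy] 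
      by (simp add: divide_right_mono)
    show "\<bar>A x y * w x y\<bar> \<le> M * M * 8 / (edge x * edge y)"
      unfolding abs_mult using mult_mono[OF a b] MM by simp
  qed measurable
  \<comment> \<open>Both terms on the right are integrable, which also supplies the integrability of
    the Sobolev integrand over the plane.\<close>
  have eq: "(\<lambda>(x, y). A x y)
    = (\<lambda>p. indicator ({-2..2} \<times> {-2..2}) p *\<^sub>R (case p of (x, y) \<Rightarrow> A x y * w x y) - (case p of (x, y) \<Rightarrow> D x y))"
    by (auto simp: fun_eq_iff D_def)
  have "Hhalf_inner f h = integral\<^sup>L lborel (\<lambda>(x, y). A x y)"
    by (simp add: Hhalf_inner_def A_def)
  also have "\<dots> = tr_form f h - integral\<^sup>L lborel (\<lambda>(x, y). D x y)"
    unfolding eq using sqA iD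
    by (subst Bochner_Integration.integral_diff)
       (simp_all add: sq_integrable_def set_integrable_def tr_form_def integral_sq_def set_lebesgue_integral_def A_def w_def)
  finally have "\<bar>tr_form f h - Hhalf_inner f h\<bar> = \<bar>integral\<^sup>L lborel (\<lambda>(x, y). D x y)\<bar>"
    by simp
  also have "\<dots> \<le> 2 * (integral\<^sup>L lborel u * integral\<^sup>L lborel v)"
    unfolding IB[symmetric] by (rule abs_integral_le[OF iB Db])
  also have "\<dots> = 14 * pi / \<delta>\<^sup>2 * ((LINT x|lborel. (f x)\<^sup>2) + (LINT x|lborel. (h x)\<^sup>2))"
    unfolding Iu Iv by simp
  finally show ?thesis .
qed

text \<open>The Jacobian c^2 of the planar dilation cancels the factor c^-2 of the two difference
  quotients. This invariance is why the trace variances need no normalization in N.\<close>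

lemma Hhalf_inner_rescale:
  assumes [measurable]: "f \<in> borel_measurable borel" "h \<in> borel_measurable borel" and c: "0 < c"
  shows "Hhalf_inner (\<lambda>x. f (c * (x - E))) (\<lambda>x. h (c * (x - E))) = Hhalf_inner f h"
proof -
  let ?F = "\<lambda>p. case p of (x, y) \<Rightarrow> (f x - f y) / (x - y) * ((h x - h y) / (x - y))"
  let ?T = "\<lambda>p. (- (c * E), - (c * E)) + c *\<^sub>R p :: real \<times> real"
  have m: "?F \<in> borel_measurable borel"
  proof -
    have "?F \<in> borel_measurable (borel \<Otimes>\<^sub>M borel)" by measurable
    then show ?thesis by (simp add: borel_prod)
  qed
  have "integral\<^sup>L lborel ?F = integral\<^sup>L (density (distr lborel borel ?T) (\<lambda>_. ennreal (\<bar>c\<bar> ^ DIM(real \<times> real)))) ?F"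
    using lborel_affine[of c "(- (c * E), - (c * E))"] c by simp
  also have "\<dots> = integral\<^sup>L (distr lborel borel ?T) (\<lambda>p. \<bar>c\<bar> ^ DIM(real \<times> real) *\<^sub>R ?F p)"
    using m by (subst integral_density) auto
  also have "\<dots> = integral\<^sup>L lborel (\<lambda>p. \<bar>c\<bar> ^ DIM(real \<times> real) *\<^sub>R ?F (?T p))"
    using m by (subst integral_distr) (auto intro!: borel_measurable_continuous_onI continuous_intros)
  also have "\<dots> = Hhalf_inner (\<lambda>x. f (c * (x - E))) (\<lambda>x. h (c * (x - E)))"
    unfolding Hhalf_inner_def
  proof (rule Bochner_Integration.integral_cong[OF refl])
    fix p :: "real \<times> real"
    obtain x y where p: "p = (x, y)" by (cases p)
    have T: "?T p = (c * (x - E), c * (y - E))" by (simp add: p algebra_simps)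
    show "\<bar>c\<bar> ^ DIM(real \<times> real) *\<^sub>R ?F (?T p) = (case p of (x, y) \<Rightarrow>
        (f (c * (x - E)) - f (c * (y - E))) / (x - y) * ((h (c * (x - E)) - h (c * (y - E))) / (x - y)))"
    proof -
      have d: "c * (x - E) - c * (y - E) = c * (x - y)" by (simp add: algebra_simps)
      show ?thesis
        unfolding T unfolding p prod.case d using c by (simp add: power2_eq_square)
    qed
  qed
  finally show ?thesis by (simp add: Hhalf_inner_def)
qed

section \<open>The density of states in the bulk\<close>

lemma edge_diff:
  assumes "\<bar>x\<bar> \<le> 2" "\<bar>y\<bar> \<le> 2"
  shows "(edge x - edge y) * (edge x + edge y) = y\<^sup>2 - x\<^sup>2"
proof -
  have "(edge x - edge y) * (edge x + edge y) = (edge x)\<^sup>2 - (edge y)\<^sup>2"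
    by (simp add: power2_eq_square algebra_simps)
  then show ?thesis using assms by (simp add: edge_square)
qed

lemma edge_lipschitz:
  assumes "0 < \<delta>" "\<bar>x\<bar> \<le> 2 - \<delta>" "\<bar>y\<bar> \<le> 2 - \<delta>"
  shows "\<bar>edge x - edge y\<bar> \<le> 2 / \<delta> * \<bar>x - y\<bar>"
proof -
  have e: "\<delta> \<le> edge x" "\<delta> \<le> edge y" using assms by (auto intro: edge_ge)
  have "(2 * \<delta>) * \<bar>edge x - edge y\<bar> \<le> \<bar>edge x + edge y\<bar> * \<bar>edge x - edge y\<bar>"
    using e by (intro mult_right_mono) auto
  also have "\<dots> = \<bar>y\<^sup>2 - x\<^sup>2\<bar>"
    using edge_diff[of x y] assms by (simp add: abs_mult[symmetric] mult.commute)
  also have "\<dots> = \<bar>x + y\<bar> * \<bar>x - y\<bar>"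
    by (simp add: abs_mult[symmetric] power2_eq_square algebra_simps abs_minus_commute)
  also have "\<dots> \<le> 4 * \<bar>x - y\<bar>" using assms by (intro mult_right_mono) auto
  finally show ?thesis using assms(1) by (simp add: field_simps)
qed

text \<open>The semicircle profile extended by 0, so that it may be translated along the whole
  line.\<close>

definition semi :: "real \<Rightarrow> real" where
  "semi x = indicator {-2..2} x * edge x"

lemma semi_bounds: "0 \<le> semi x" "semi x \<le> 2"
  using edge_nonneg[of x] edge_le_2[of x] by (auto simp: semi_def indicator_def abs_le_iff)

lemma semi_eq: "\<bar>x\<bar> \<le> 2 \<Longrightarrow> semi x = edge x"
  by (auto simp: semi_def indicator_def abs_le_iff)

lemma borel_measurable_semi [measurable]: "semi \<in> borel_measurable borel"
  unfolding semi_def by measurable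

text \<open>For |t| \<le> \<delta>/2 the square roots are rationalized: the terms linear in t cancel
  up to the difference p - q, which is itself O(|t|), giving 32 / \<delta>^3, and the two quadratic
  terms give 2 / \<delta>. For larger |t| the trivial bound 8 is at most 32 t^2 /
  \<delta>^2.\<close>

lemma semi_second_difference:
  assumes \<delta>: "0 < \<delta>" and E: "\<bar>E\<bar> \<le> 2 - \<delta>"
  shows "\<bar>semi (E + t) + semi (E - t) - 2 * semi E\<bar> \<le> (32 / \<delta> ^ 3 + 2 / \<delta> + 32 / \<delta>\<^sup>2) * t\<^sup>2"
proof (cases "\<bar>t\<bar> \<le> \<delta> / 2")
  case True
  define p q r where "p = edge (E + t)" and "q = edge (E - t)" and "r = edge E"
  have b: "\<bar>E + t\<bar> \<le> 2 - \<delta> / 2" "\<bar>E - t\<bar> \<le> 2 - \<delta> / 2" "\<bar>E\<bar> \<le> 2 - \<delta> / 2"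
    using E True by auto
  have e: "\<delta> / 2 \<le> p" "\<delta> / 2 \<le> q" "\<delta> / 2 \<le> r"
    unfolding p_def q_def r_def
    using b \<delta> edge_ge[of "E + t" "\<delta> / 2"] edge_ge[of "E - t" "\<delta> / 2"] edge_ge[of E "\<delta> / 2"] by auto
  have 1: "(p - r) * (p + r) = - (2 * E * t) - t\<^sup>2"
    unfolding p_def r_def using b \<delta> by (subst edge_diff) (auto simp: power2_eq_square algebra_simps)
  have 2: "(q - r) * (q + r) = 2 * E * t - t\<^sup>2"
    unfolding q_def r_def using b \<delta> by (subst edge_diff) (auto simp: power2_eq_square algebra_simps)
  have pq: "\<bar>p - q\<bar> \<le> 8 / \<delta> * \<bar>t\<bar>"
    using edge_lipschitz[of "\<delta> / 2" "E + t" "E - t"] b \<delta> by (simp add: p_def q_def abs_mult)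
  have pos: "\<delta> \<le> p + r" "\<delta> \<le> q + r" using e by auto
  then have pos': "0 < p + r" "0 < q + r" using \<delta> by auto
  have abs3: "\<bar>a - b - c\<bar> \<le> \<bar>a\<bar> + \<bar>b\<bar> + \<bar>c\<bar>" for a b c :: real by linarith
  have "p + q - 2 * r = (- (2 * E * t) - t\<^sup>2) / (p + r) + (2 * E * t - t\<^sup>2) / (q + r)"
    unfolding 1[symmetric] 2[symmetric] using pos' by simp
  also have "\<dots> = 2 * E * t * (p - q) / ((p + r) * (q + r)) - t\<^sup>2 / (p + r) - t\<^sup>2 / (q + r)"
  proof -
    have "2 * E * t * (p - q) / ((p + r) * (q + r)) = 2 * E * t * (((p + r) - (q + r)) / ((p + r) * (q + r)))" by simp
    also have "((p + r) - (q + r)) / ((p + r) * (q + r)) = 1 / (q + r) - 1 / (p + r)"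
      using pos' by (simp only: diff_divide_distrib) simp
    finally show ?thesis by (simp add: diff_divide_distrib algebra_simps)
  qed
  finally have "\<bar>p + q - 2 * r\<bar> \<le> \<bar>2 * E * t * (p - q) / ((p + r) * (q + r))\<bar> + \<bar>t\<^sup>2 / (p + r)\<bar> + \<bar>t\<^sup>2 / (q + r)\<bar>"
    by (simp only:) (rule abs3)
  also have "\<dots> \<le> 32 / \<delta> ^ 3 * t\<^sup>2 + t\<^sup>2 / \<delta> + t\<^sup>2 / \<delta>"
  proof (intro add_mono)
    have "\<bar>2 * E * t * (p - q)\<bar> \<le> (4 * \<bar>t\<bar>) * (8 / \<delta> * \<bar>t\<bar>)"
      unfolding abs_mult[of _ "p - q"] using E \<delta> pq
      by (intro mult_mono) (auto simp: abs_mult intro!: mult_right_mono)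
    also have "\<dots> = 32 / \<delta> * t\<^sup>2"
      by (simp add: power2_eq_square abs_mult_self_eq)
    finally have n: "\<bar>2 * E * t * (p - q)\<bar> \<le> 32 / \<delta> * t\<^sup>2" .
    have d: "\<delta> * \<delta> \<le> (p + r) * (q + r)" using pos \<delta> by (intro mult_mono) auto
    have "\<bar>2 * E * t * (p - q) / ((p + r) * (q + r))\<bar> \<le> (32 / \<delta> * t\<^sup>2) / (\<delta> * \<delta>)"
      unfolding abs_divide using n d \<delta> pos' by (intro frac_le) auto
    then show "\<bar>2 * E * t * (p - q) / ((p + r) * (q + r))\<bar> \<le> 32 / \<delta> ^ 3 * t\<^sup>2"
      by (simp add: power3_eq_cube mult_ac)
    show "\<bar>t\<^sup>2 / (p + r)\<bar> \<le> t\<^sup>2 / \<delta>" "\<bar>t\<^sup>2 / (q + r)\<bar> \<le> t\<^sup>2 / \<delta>"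
      unfolding abs_divide using pos pos' \<delta> by (auto intro!: divide_left_mono mult_pos_pos)
  qed
  also have "\<dots> \<le> (32 / \<delta> ^ 3 + 2 / \<delta> + 32 / \<delta>\<^sup>2) * t\<^sup>2"
  proof -
    have "0 \<le> 32 / \<delta>\<^sup>2 * t\<^sup>2" by simp
    moreover have "(32 / \<delta> ^ 3 + 2 / \<delta> + 32 / \<delta>\<^sup>2) * t\<^sup>2 = 32 / \<delta> ^ 3 * t\<^sup>2 + (t\<^sup>2 / \<delta> + t\<^sup>2 / \<delta>) + 32 / \<delta>\<^sup>2 * t\<^sup>2"
      by (simp add: distrib_right)
    ultimately show ?thesis by linarith
  qed
  finally show ?thesis
    using b \<delta> by (simp add: semi_eq p_def q_def r_def)
next
  case False
  have "(\<delta> / 2)\<^sup>2 \<le> \<bar>t\<bar>\<^sup>2" using False \<delta> by (intro power_mono) auto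
  then have "\<delta>\<^sup>2 / 4 \<le> t\<^sup>2" by (simp add: power_divide)
  then have "8 \<le> 32 / \<delta>\<^sup>2 * t\<^sup>2" using \<delta> by (simp add: field_simps)
  moreover have "0 \<le> (32 / \<delta> ^ 3 + 2 / \<delta>) * t\<^sup>2" using \<delta> by simp
  moreover have "\<bar>semi (E + t) + semi (E - t) - 2 * semi E\<bar> \<le> 8"
    using semi_bounds[of "E + t"] semi_bounds[of "E - t"] semi_bounds[of E] by linarith
  ultimately show ?thesis by (simp add: distrib_right)
qed

lemma
  assumes "0 < \<eta>"
  shows integrable_cauchy_scaled: "integrable lborel (\<lambda>t. \<eta> / (t\<^sup>2 + \<eta>\<^sup>2))"
    and integral_cauchy_scaled: "(LINT t|lborel. \<eta> / (t\<^sup>2 + \<eta>\<^sup>2)) = pi"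
proof -
  have eq: "\<eta> / (t\<^sup>2 + \<eta>\<^sup>2) = 1 / \<eta> * (1 / (1 + (0 + 1 / \<eta> * t)\<^sup>2))" for t
  proof -
    have "(0 + 1 / \<eta> * t)\<^sup>2 = t\<^sup>2 / \<eta>\<^sup>2" by (simp add: power_divide)
    moreover have "1 + t\<^sup>2 / \<eta>\<^sup>2 = (t\<^sup>2 + \<eta>\<^sup>2) / \<eta>\<^sup>2" using assms by (simp add: add_divide_distrib)
    moreover have "1 / \<eta> * (1 / (s / \<eta>\<^sup>2)) = \<eta> / s" for s using assms by (simp add: power2_eq_square)
    ultimately show ?thesis by (simp only:)
  qed
  have "integrable lborel (\<lambda>t. 1 / (1 + (0 + 1 / \<eta> * t)\<^sup>2))"
    by (rule lborel_integrable_real_affine[OF integrable_cauchy, of "1 / \<eta>" 0]) (use assms in auto)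
  then show "integrable lborel (\<lambda>t. \<eta> / (t\<^sup>2 + \<eta>\<^sup>2))"
    unfolding eq by (rule integrable_mult_right)
  have "pi = \<bar>1 / \<eta>\<bar> *\<^sub>R (LINT t|lborel. 1 / (1 + (0 + 1 / \<eta> * t)\<^sup>2))"
    unfolding integral_cauchy[symmetric]
    by (rule lborel_integral_real_affine[of "1 / \<eta>" "\<lambda>x. 1 / (1 + x\<^sup>2)" 0]) (use assms in auto)
  then show "(LINT t|lborel. \<eta> / (t\<^sup>2 + \<eta>\<^sup>2)) = pi"
    unfolding eq integral_mult_right_zero using assms by simp
qed

text \<open>The imaginary part of 1 / (x - E - i \<eta>) is \<eta> / ((x - E)^2 + \<eta>^2), so Im
  \<open>m_sc\<close> is the half-plane Poisson extension of the semicircle density.\<close>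

lemma rho_Poisson:
  assumes \<eta>: "0 < \<eta>"
  shows "rho (Complex E \<eta>) = \<bar>LINT t|lborel. semi (E + t) * (\<eta> / (t\<^sup>2 + \<eta>\<^sup>2))\<bar> / (2 * pi\<^sup>2)"
proof -
  let ?g = "\<lambda>x. complex_of_real (sqrt (4 - x\<^sup>2) / (2 * pi)) / (complex_of_real x - Complex E \<eta>)"
  have nz: "complex_of_real x - Complex E \<eta> \<noteq> 0" for x
    using \<eta> by (auto simp: complex_eq_iff)
  have "integrable lborel (\<lambda>x. indicator {-2..2} x *\<^sub>R ?g x)"
    by (intro borel_integrable_compact continuous_intros) (use nz in auto)
  then have "Im (m_sc (Complex E \<eta>)) = (LINT x|lborel. Im (indicator {-2..2} x *\<^sub>R ?g x))"
    unfolding m_sc_def set_lebesgue_integral_def by (rule integral_Im[symmetric])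
  also have "\<dots> = (LINT x|lborel. 1 / (2 * pi) * (semi x * (\<eta> / ((x - E)\<^sup>2 + \<eta>\<^sup>2))))"
  proof (rule Bochner_Integration.integral_cong[OF refl])
    fix x :: real
    show "Im (indicator {-2..2} x *\<^sub>R ?g x) = 1 / (2 * pi) * (semi x * (\<eta> / ((x - E)\<^sup>2 + \<eta>\<^sup>2)))"
    proof -
      have "Im (complex_of_real r / (complex_of_real x - Complex E \<eta>)) = r * (\<eta> / ((x - E)\<^sup>2 + \<eta>\<^sup>2))" for r
        by (simp add: Im_divide)
      then have "Im (indicator {-2..2} x *\<^sub>R ?g x)
          = indicator {-2..2} x * (sqrt (4 - x\<^sup>2) / (2 * pi) * (\<eta> / ((x - E)\<^sup>2 + \<eta>\<^sup>2)))"
        by (simp only: scaleR_complex.simps)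
      then show ?thesis by (simp add: semi_def edge_def)
    qed
  qed
  also have "\<dots> = 1 / (2 * pi) * (LINT x|lborel. semi x * (\<eta> / ((x - E)\<^sup>2 + \<eta>\<^sup>2)))"
    by (rule integral_mult_right_zero)
  also have "(LINT x|lborel. semi x * (\<eta> / ((x - E)\<^sup>2 + \<eta>\<^sup>2))) = (LINT t|lborel. semi (E + t) * (\<eta> / (t\<^sup>2 + \<eta>\<^sup>2)))"
    by (subst lborel_integral_real_affine[of 1 _ E]) auto
  finally show ?thesis
    by (simp add: rho_def abs_mult power2_eq_square)
qed

lemma rho_bulk:
  assumes \<delta>: "0 < \<delta>" and E: "\<bar>E\<bar> \<le> 2 - \<delta>" and \<eta>: "0 < \<eta>"
  shows "\<bar>rho (Complex E \<eta>) - edge E / (2 * pi)\<bar> \<le> (32 / \<delta> ^ 3 + 2 / \<delta> + 32 / \<delta>\<^sup>2 + 8) * \<eta>"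
proof -
  define C where "C = 32 / \<delta> ^ 3 + 2 / \<delta> + 32 / \<delta>\<^sup>2"
  have C: "0 \<le> C" using \<delta> by (simp add: C_def)
  let ?\<kappa> = "\<lambda>t. \<eta> / (t\<^sup>2 + \<eta>\<^sup>2)"
  define J where "J = (LINT t|lborel. semi (E + t) * ?\<kappa> t)"
  have \<kappa>: "0 \<le> ?\<kappa> t" for t using \<eta> by simp
  have i: "integrable lborel (\<lambda>t. semi (E + c * t) * ?\<kappa> t)" for c
  proof (rule Bochner_Integration.integrable_bound)
    show "integrable lborel (\<lambda>t. 2 * ?\<kappa> t)"
      by (intro integrable_mult_right integrable_cauchy_scaled \<eta>)
    show "AE t in lborel. norm (semi (E + c * t) * ?\<kappa> t) \<le> norm (2 * ?\<kappa> t)"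
      using semi_bounds \<kappa> by (intro AE_I2) (auto simp: abs_mult intro!: mult_right_mono divide_right_mono)
  qed measurable
  have J': "J = (LINT t|lborel. semi (E - t) * ?\<kappa> t)"
    unfolding J_def by (subst lborel_integral_real_affine[of "-1" _ 0]) auto
  \<comment> \<open>Averaging J with its reflected form \<open>J'\<close>, and using \<pi> as the
    mass of the Cauchy kernel, leaves the second difference of \<open>semi\<close> at E.\<close>
  have "2 * J - 2 * edge E * pi = (LINT t|lborel. semi (E + 1 * t) * ?\<kappa> t) + (LINT t|lborel. semi (E + (-1) * t) * ?\<kappa> t)
      - (LINT t|lborel. 2 * edge E * ?\<kappa> t)"
    unfolding integral_mult_right_zero integral_cauchy_scaled[OF \<eta>] using J' by (simp add: J_def)
  also have "\<dots> = (LINT t|lborel. semi (E + 1 * t) * ?\<kappa> t + semi (E + (-1) * t) * ?\<kappa> t - 2 * edge E * ?\<kappa> t)"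
    by (subst Bochner_Integration.integral_diff Bochner_Integration.integral_add;
        (intro Bochner_Integration.integrable_add i integrable_mult_right integrable_cauchy_scaled \<eta>)?)+
      (rule refl)
  finally have eq: "2 * J - 2 * edge E * pi = (LINT t|lborel. semi (E + 1 * t) * ?\<kappa> t + semi (E + (-1) * t) * ?\<kappa> t - 2 * edge E * ?\<kappa> t)" .
  have "\<bar>2 * J - 2 * edge E * pi\<bar> \<le> (LINT t|lborel. (C + 8) * \<eta> * (1 / (1 + t\<^sup>2)))"
    unfolding eq
  proof (rule abs_integral_le)
    show "integrable lborel (\<lambda>t. (C + 8) * \<eta> * (1 / (1 + t\<^sup>2)))"
      by (intro integrable_mult_right integrable_cauchy)
    fix t :: real
    \<comment> \<open>The quadratic bound alone leaves a tail that is not integrable, and the bound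
      8 alone gives no factor \<eta>. Together they yield S (1 + t^2) \<le> (C + 8) t^2, which
      trades the kernel for \<eta> / (1 + t^2).\<close>
    define S where "S = \<bar>semi (E + t) + semi (E - t) - 2 * semi E\<bar>"
    have S1: "S \<le> C * t\<^sup>2" unfolding S_def C_def by (rule semi_second_difference[OF \<delta> E])
    have S2: "S \<le> 8" unfolding S_def
      using semi_bounds[of "E + t"] semi_bounds[of "E - t"] semi_bounds[of E] by linarith
    have "S * t\<^sup>2 \<le> 8 * t\<^sup>2" using S2 by (intro mult_right_mono) auto
    then have "S * (1 + t\<^sup>2) \<le> (C + 8) * t\<^sup>2" using S1 by (simp add: algebra_simps)
    also have "\<dots> \<le> (C + 8) * (t\<^sup>2 + \<eta>\<^sup>2)" using C by (intro mult_left_mono) auto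
    finally have S: "S * (1 + t\<^sup>2) \<le> (C + 8) * (t\<^sup>2 + \<eta>\<^sup>2)" .
    have p: "0 < 1 + t\<^sup>2" "0 < t\<^sup>2 + \<eta>\<^sup>2" using \<eta> by (simp_all add: add_pos_nonneg add_nonneg_pos)
    have "S / (t\<^sup>2 + \<eta>\<^sup>2) \<le> (C + 8) / (1 + t\<^sup>2)"
      using S p by (simp add: divide_simps mult.commute)
    then have "\<eta> * (S / (t\<^sup>2 + \<eta>\<^sup>2)) \<le> \<eta> * ((C + 8) / (1 + t\<^sup>2))"
      using \<eta> by (intro mult_left_mono) auto
    moreover have "semi (E + 1 * t) * ?\<kappa> t + semi (E + (-1) * t) * ?\<kappa> t - 2 * edge E * ?\<kappa> t
        = (semi (E + t) + semi (E - t) - 2 * semi E) * ?\<kappa> t"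
      using E \<delta> by (simp add: semi_eq distrib_right left_diff_distrib add_divide_distrib diff_divide_distrib)
    then have "\<bar>semi (E + 1 * t) * ?\<kappa> t + semi (E + (-1) * t) * ?\<kappa> t - 2 * edge E * ?\<kappa> t\<bar> = S * ?\<kappa> t"
      by (simp only: abs_mult abs_of_nonneg[OF \<kappa>] S_def)
    ultimately show "\<bar>semi (E + 1 * t) * ?\<kappa> t + semi (E + (-1) * t) * ?\<kappa> t - 2 * edge E * ?\<kappa> t\<bar>
        \<le> (C + 8) * \<eta> * (1 / (1 + t\<^sup>2))"
      by (simp add: mult.commute)
  qed
  also have "\<dots> = (C + 8) * \<eta> * pi"
    unfolding integral_mult_right_zero integral_cauchy ..
  finally have d: "\<bar>2 * J - 2 * edge E * pi\<bar> \<le> (C + 8) * \<eta> * pi" .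
  have "0 \<le> J" unfolding J_def by (intro integral_nonneg_AE AE_I2 mult_nonneg_nonneg semi_bounds \<kappa>)
  then have "rho (Complex E \<eta>) = J / (2 * pi\<^sup>2)"
    unfolding rho_Poisson[OF \<eta>] J_def by simp
  then have "rho (Complex E \<eta>) - edge E / (2 * pi) = (2 * J - 2 * edge E * pi) / (4 * pi\<^sup>2)"
    by (simp add: field_simps power2_eq_square)
  then have "\<bar>rho (Complex E \<eta>) - edge E / (2 * pi)\<bar> = \<bar>2 * J - 2 * edge E * pi\<bar> / (4 * pi\<^sup>2)"
    by (simp add: abs_divide)
  also have "\<dots> \<le> (C + 8) * \<eta> * pi / (4 * pi\<^sup>2)"
    by (rule divide_right_mono[OF d]) simp
  also have "\<dots> = (C + 8) * \<eta> / (4 * pi)" by (simp add: power2_eq_square)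
  also have "\<dots> \<le> (C + 8) * \<eta> / 1"
    using C \<eta> pi_gt3 by (intro divide_left_mono) auto
  finally show ?thesis by (simp add: C_def)
qed

text \<open>On the support, of radius l / c, the profile differs from edge E by at most 2 l /
  (\<delta> c). Together with the factor 1 / c of the substitution the error is of order
  c^-2.\<close>

lemma avg_sc_rescale:
  assumes \<delta>: "0 < \<delta>" and c: "0 < c" and l: "0 \<le> l" and E: "\<bar>E\<bar> + l / c \<le> 2 - \<delta>"
    and G: "continuous_on UNIV G" and supp: "\<And>x. G x \<noteq> 0 \<Longrightarrow> \<bar>x\<bar> \<le> l"
  shows "\<bar>avg_sc (\<lambda>x. G (c * (x - E))) - edge E / (2 * pi) * (LINT x|lborel. G x) / c\<bar>
    \<le> l / \<delta> * (LINT x|lborel. \<bar>G x\<bar>) / c\<^sup>2"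
proof -
  have iG: "integrable lborel G" by (rule integrable_bounded_support[OF G supp])
  have aff: "(\<lambda>x. F (c * (x - E))) = (\<lambda>x. F (- (c * E) + c * x))" for F :: "real \<Rightarrow> real"
    by (simp add: algebra_simps)
  have resc: "(LINT x|lborel. F (c * (x - E))) = (LINT x|lborel. F x) / c" for F :: "real \<Rightarrow> real"
    using lborel_integral_real_affine[of c F "- (c * E)"] c by (simp add: aff field_simps)
  have iGc: "integrable lborel (\<lambda>x. G (c * (x - E)))"
    unfolding aff by (rule lborel_integrable_real_affine[OF iG]) (use c in simp)
  have near: "\<bar>x - E\<bar> \<le> l / c" if "G (c * (x - E)) \<noteq> 0" for x
    using supp[OF that] c by (simp add: abs_mult pos_le_divide_eq mult.commute)
  have [measurable]: "G \<in> borel_measurable borel" using G by (rule borel_measurable_continuous_onI)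
  have bound: "\<bar>G (c * (x - E)) * (semi x - edge E)\<bar> \<le> 2 * l / (\<delta> * c) * \<bar>G (c * (x - E))\<bar>" for x
  proof (cases "G (c * (x - E)) = 0")
    case False
    then have n: "\<bar>x - E\<bar> \<le> l / c" by (rule near)
    then have x: "\<bar>x\<bar> \<le> 2 - \<delta>" using E by linarith
    have E': "\<bar>E\<bar> \<le> 2 - \<delta>"
    proof -
      have "0 \<le> l / c" using l c by simp
      then show ?thesis using E by linarith
    qed
    have "\<bar>semi x - edge E\<bar> \<le> 2 / \<delta> * \<bar>x - E\<bar>"
      using edge_lipschitz[OF \<delta> x E'] x \<delta> by (simp add: semi_eq)
    also have "\<dots> \<le> 2 / \<delta> * (l / c)" using n \<delta> by (intro mult_left_mono) auto
    finally have "\<bar>semi x - edge E\<bar> * \<bar>G (c * (x - E))\<bar> \<le> 2 / \<delta> * (l / c) * \<bar>G (c * (x - E))\<bar>"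
      by (rule mult_right_mono) simp
    then show ?thesis by (simp add: abs_mult mult.commute)
  qed simp
  have iS: "integrable lborel (\<lambda>x. G (c * (x - E)) * semi x)"
  proof (rule Bochner_Integration.integrable_bound)
    show "integrable lborel (\<lambda>x. 2 * G (c * (x - E)))" by (intro integrable_mult_right iGc)
    show "AE x in lborel. norm (G (c * (x - E)) * semi x) \<le> norm (2 * G (c * (x - E)))"
      using semi_bounds by (intro AE_I2) (auto simp: abs_mult mult.commute intro!: mult_right_mono)
  qed measurable
  have "avg_sc (\<lambda>x. G (c * (x - E))) = (LINT x|lborel. 1 / (2 * pi) * (G (c * (x - E)) * semi x))"
    unfolding avg_sc_def set_lebesgue_integral_def
    by (rule Bochner_Integration.integral_cong[OF refl]) (simp add: semi_def edge_def)
  also have "\<dots> = 1 / (2 * pi) * (LINT x|lborel. G (c * (x - E)) * semi x)"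
    by (rule integral_mult_right_zero)
  finally have a: "avg_sc (\<lambda>x. G (c * (x - E))) = 1 / (2 * pi) * (LINT x|lborel. G (c * (x - E)) * semi x)" .
  have b: "edge E / (2 * pi) * (LINT x|lborel. G x) / c = 1 / (2 * pi) * (LINT x|lborel. G (c * (x - E)) * edge E)"
    using resc[of G] by simp
  have "avg_sc (\<lambda>x. G (c * (x - E))) - edge E / (2 * pi) * (LINT x|lborel. G x) / c
      = 1 / (2 * pi) * (LINT x|lborel. G (c * (x - E)) * (semi x - edge E))"
  proof -
    have "(LINT x|lborel. G (c * (x - E)) * (semi x - edge E))
        = (LINT x|lborel. G (c * (x - E)) * semi x - G (c * (x - E)) * edge E)"
      by (rule Bochner_Integration.integral_cong[OF refl]) (rule right_diff_distrib)
    also have "\<dots> = (LINT x|lborel. G (c * (x - E)) * semi x) - (LINT x|lborel. G (c * (x - E)) * edge E)"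
      by (rule Bochner_Integration.integral_diff[OF iS integrable_mult_left[OF iGc]])
    finally show ?thesis unfolding a b by (simp only: right_diff_distrib)
  qed
  then have "\<bar>avg_sc (\<lambda>x. G (c * (x - E))) - edge E / (2 * pi) * (LINT x|lborel. G x) / c\<bar>
      = 1 / (2 * pi) * \<bar>LINT x|lborel. G (c * (x - E)) * (semi x - edge E)\<bar>"
    by (simp add: abs_mult)
  also have "\<dots> \<le> 1 / (2 * pi) * (LINT x|lborel. 2 * l / (\<delta> * c) * \<bar>G (c * (x - E))\<bar>)"
    by (intro mult_left_mono abs_integral_le bound integrable_mult_right integrable_abs iGc) simp
  also have "\<dots> = 1 / pi * (l / \<delta> * (LINT x|lborel. \<bar>G x\<bar>) / c\<^sup>2)"
    unfolding integral_mult_right_zero resc[of "\<lambda>x. \<bar>G x\<bar>"] by (simp add: power2_eq_square)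
  also have "\<dots> \<le> 1 * (l / \<delta> * (LINT x|lborel. \<bar>G x\<bar>) / c\<^sup>2)"
    using l \<delta> pi_gt3 by (intro mult_right_mono divide_nonneg_nonneg mult_nonneg_nonneg integral_nonneg_AE AE_I2) auto
  finally show ?thesis by simp
qed

section \<open>Rescaled test functions\<close>

lemma at_boundary_nontrivial: "\<not> trivial_limit (at 1 within {-1<..<(1::real)})" "\<not> trivial_limit (at (-1) within {-1<..<(1::real)})"
  by (auto simp: trivial_limit_within islimpt_greaterThanLessThan1 islimpt_greaterThanLessThan2)

lemma extend_limit_inner: "\<bar>\<sigma>\<bar> < 1 \<Longrightarrow> extend_limit V \<sigma> = V \<sigma>"
  by (simp add: extend_limit_def)

lemma extend_limit_1:
  assumes "\<And>\<sigma>. \<bar>\<sigma>\<bar> < 1 \<Longrightarrow> V \<sigma> = W \<sigma>" and "(W \<longlongrightarrow> l) (at 1 within {-1<..<1})"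
  shows "extend_limit V 1 = l"
proof -
  have "(V \<longlongrightarrow> l) (at 1 within {-1<..<1})"
    by (rule Lim_transform_eventually[OF assms(2)])
       (auto simp: eventually_at_filter intro!: always_eventually assms(1)[symmetric])
  then show ?thesis
    by (simp add: extend_limit_def tendsto_Lim at_boundary_nontrivial)
qed

text \<open>The reflection of \<sigma> moves the limit to 1, so that all convergence statements are
  proved at 1 only.\<close>

lemma extend_limit_minus_1:
  assumes "\<And>\<sigma>. \<bar>\<sigma>\<bar> < 1 \<Longrightarrow> V (- \<sigma>) = W \<sigma>" and W: "(W \<longlongrightarrow> l) (at 1 within {-1<..<1})"
  shows "extend_limit V (- 1) = l"
proof -
  have "(uminus \<longlongrightarrow> - (-1)) (at (-1) within {-1<..<(1::real)})"
    by (intro tendsto_intros)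
  then have "filterlim uminus (at 1 within {-1<..<1}) (at (-1) within {-1<..<(1::real)})"
    by (auto simp: filterlim_at eventually_at_filter intro!: always_eventually)
  then have lim: "((\<lambda>\<sigma>. W (- \<sigma>)) \<longlongrightarrow> l) (at (-1) within {-1<..<1})"
    by (rule filterlim_compose[OF W])
  have eq: "W (- \<sigma>) = V \<sigma>" if "\<bar>\<sigma>\<bar> < 1" for \<sigma>
    using assms(1)[of "- \<sigma>"] that by simp
  have "(V \<longlongrightarrow> l) (at (-1) within {-1<..<1})"
    by (rule Lim_transform_eventually[OF lim])
       (auto simp: eventually_at_filter intro!: always_eventually eq)
  then show ?thesis
    by (simp add: extend_limit_def tendsto_Lim at_boundary_nontrivial)
qed

text \<open>\<open>c\<close> stands for N^a. The condition \<open>bulk\<close> keeps the support of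
  the rescaled function at distance \<delta> from the edges. The error constants derived in this
  locale depend on \<open>B\<close>, \<open>l\<close>, \<open>\<delta>\<close> and the gap
  \<epsilon>' alone, hence are uniform in \<open>E\<close> and \<open>c\<close>; \<open>M\<close>
  enters only through the limits in \<sigma>.\<close>

locale rescaled_bump =
  fixes g :: "real \<Rightarrow> real" and M B l \<delta> c E :: real
  assumes lip: "M-lipschitz_on UNIV g" and supp: "g x \<noteq> 0 \<Longrightarrow> \<bar>x\<bar> \<le> l" and bound: "\<bar>g x\<bar> \<le> B"
    and l: "0 < l" and \<delta>: "0 < \<delta>" and c: "1 \<le> c" and bulk: "\<bar>E\<bar> + l / c \<le> 2 - \<delta>"
begin

definition f :: "real \<Rightarrow> real" where
  "f x = g (c * (x - E))"

section \<open>Support, size and integrals of the rescaled function\<close>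

lemma c_pos: "0 < c" and B_nonneg: "0 \<le> B"
  using c bound[of 0] by auto

lemma f_lipschitz: "(M * c)-lipschitz_on UNIV f"
proof (rule lipschitz_onI)
  show "dist (f x) (f y) \<le> M * c * dist x y" for x y
  proof -
    have "\<bar>c * (x - E) - c * (y - E)\<bar> = c * \<bar>x - y\<bar>"
    proof -
      have "c * (x - E) - c * (y - E) = c * (x - y)" by (simp add: algebra_simps)
      then show ?thesis using c_pos by (simp add: abs_mult)
    qed
    then show ?thesis
      using lipschitz_onD[OF lip, of "c * (x - E)" "c * (y - E)"] by (simp add: f_def dist_real_def)
  qed
  show "0 \<le> M * c" using lipschitz_on_nonneg[OF lip] c_pos by simp
qed

lemma g_measurable [measurable]: "g \<in> borel_measurable borel"
  by (rule lipschitz_borel_measurable[OF lip])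

lemma f_measurable [measurable]: "f \<in> borel_measurable borel"
  by (rule lipschitz_borel_measurable[OF f_lipschitz])

lemma f_supp: "f x \<noteq> 0 \<Longrightarrow> \<bar>x - E\<bar> \<le> l / c"
  using supp[of "c * (x - E)"] c_pos by (simp add: f_def abs_mult pos_le_divide_eq mult.commute)

lemma f_bulk: "f x \<noteq> 0 \<Longrightarrow> \<bar>x\<bar> \<le> 2 - \<delta>"
  using f_supp[of x] bulk by linarith

lemma f_bound: "\<bar>f x\<bar> \<le> B"
  by (simp add: f_def bound)

lemma E_bulk: "\<bar>E\<bar> \<le> 2 - \<delta>"
  using bulk l c_pos divide_pos_pos[OF l c_pos] by linarith

lemma edge_bulk: "f x \<noteq> 0 \<Longrightarrow> \<delta> \<le> edge x"
  using f_bulk[of x] \<delta> by (intro edge_ge) auto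

lemma g_continuous: "continuous_on A g"
  using lipschitz_on_continuous_on[OF lip] continuous_on_subset by blast

lemma f_continuous: "continuous_on A f"
  using lipschitz_on_continuous_on[OF f_lipschitz] continuous_on_subset by blast

lemma f_integrable: "integrable lborel f"
  by (rule integrable_bounded_support[OF f_continuous f_bulk])

lemma integral_g_bound:
  assumes "\<And>x. \<bar>G x\<bar> \<le> C" and "\<And>x. G x \<noteq> 0 \<Longrightarrow> g x \<noteq> 0"
  shows "\<bar>LINT x|lborel. G x\<bar> \<le> 2 * l * C"
proof -
  have "\<bar>LINT x|lborel. G x\<bar> \<le> (LINT x|lborel. indicator {-l..l} x *\<^sub>R C)"
  proof (rule abs_integral_le)
    show "integrable lborel (\<lambda>x. indicator {-l..l} x *\<^sub>R C)"
      by (intro borel_integrable_compact continuous_intros) auto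
    show "\<bar>G x\<bar> \<le> indicator {-l..l} x *\<^sub>R C" for x
      using assms(1)[of x] assms(2)[of x] supp[of x] by (cases "G x = 0") (auto simp: indicator_def abs_le_iff)
  qed
  then show ?thesis using l by simp
qed

lemma integral_rescale: "(LINT x|lborel. F (c * (x - E))) = (LINT x|lborel. F x) / c" for F :: "real \<Rightarrow> real"
proof -
  have "(\<lambda>x. F (c * (x - E))) = (\<lambda>x. F (- (c * E) + c * x))" by (simp add: algebra_simps)
  then show ?thesis using lborel_integral_real_affine[of c F "- (c * E)"] c_pos by (simp add: field_simps)
qed

lemma f_L1: "(LINT x|lborel. \<bar>f x\<bar>) \<le> 2 * l * B / c"
proof -
  have "\<bar>LINT x|lborel. \<bar>g x\<bar>\<bar> \<le> 2 * l * B" by (rule integral_g_bound) (use bound in auto)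
  then have "(LINT x|lborel. \<bar>g x\<bar>) / c \<le> 2 * l * B / c"
    using c_pos by (intro divide_right_mono) auto
  then show ?thesis unfolding f_def integral_rescale[of "\<lambda>x. \<bar>g x\<bar>"] .
qed

lemma f_L2: "(LINT x|lborel. (f x)\<^sup>2) \<le> 2 * l * B\<^sup>2 / c"
proof -
  have "\<bar>(g x)\<^sup>2\<bar> \<le> B\<^sup>2" for x using power_mono[OF bound[of x], of 2] by simp
  then have "\<bar>LINT x|lborel. (g x)\<^sup>2\<bar> \<le> 2 * l * B\<^sup>2" by (rule integral_g_bound) auto
  then have "(LINT x|lborel. (g x)\<^sup>2) / c \<le> 2 * l * B\<^sup>2 / c"
    using c_pos by (intro divide_right_mono) auto
  then show ?thesis unfolding f_def integral_rescale[of "\<lambda>x. (g x)\<^sup>2"] .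
qed

lemma f_set_L1:
  shows "set_integrable lborel {-2..2} (\<lambda>x. \<bar>f x\<bar>)" 
    and "(LINT x:{-2..2}|lborel. \<bar>f x\<bar>) \<le> 2 * l * B / c" and "0 \<le> (LINT x:{-2..2}|lborel. \<bar>f x\<bar>)"
proof -
  have eq: "(\<lambda>x. indicator {-2..2} x *\<^sub>R \<bar>f x\<bar>) = (\<lambda>x. \<bar>f x\<bar>)"
    using f_bulk \<delta> by (force simp: fun_eq_iff indicator_def abs_le_iff)
  show "set_integrable lborel {-2..2} (\<lambda>x. \<bar>f x\<bar>)" 
    unfolding set_integrable_def eq by (intro integrable_abs f_integrable)
  show "(LINT x:{-2..2}|lborel. \<bar>f x\<bar>) \<le> 2 * l * B / c"
    unfolding set_lebesgue_integral_def eq by (rule f_L1)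
  show "0 \<le> (LINT x:{-2..2}|lborel. \<bar>f x\<bar>)"
    unfolding set_lebesgue_integral_def by (intro integral_nonneg_AE AE_I2) (simp add: indicator_def)
qed

lemma f_L1_bound_le:
  assumes "0 \<le> C"
  shows "C * (LINT x:{-2..2}|lborel. \<bar>f x\<bar>) \<le> C * (2 * l * B) / c"
  using mult_left_mono[OF f_set_L1(2) assms] by simp

lemma inverse_square_le: "0 \<le> x \<Longrightarrow> x / c\<^sup>2 \<le> x / c"
  using c by (intro divide_left_mono) (auto simp: power2_eq_square)

lemma integral_sq_product_bound:
  assumes C: "0 \<le> C" and F: "\<And>x y. \<bar>x\<bar> \<le> 2 \<Longrightarrow> \<bar>y\<bar> \<le> 2 \<Longrightarrow> \<bar>F x y\<bar> \<le> C * (\<bar>f x\<bar> * \<bar>f y\<bar>)"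
  shows "\<bar>integral_sq F\<bar> \<le> C * (2 * l * B)\<^sup>2 / c\<^sup>2"
proof -
  have "\<bar>integral_sq F\<bar> \<le> integral_sq (\<lambda>x y. C * (\<bar>f x\<bar> * \<bar>f y\<bar>))"
    by (rule abs_integral_sq_le[OF sq_integrable_cmult[OF sq_integrable_tensor[OF f_set_L1(1) f_set_L1(1)]]]) (rule F)
  also have "\<dots> = C * ((LINT x:{-2..2}|lborel. \<bar>f x\<bar>) * (LINT x:{-2..2}|lborel. \<bar>f x\<bar>))"
    unfolding integral_sq_cmult integral_sq_tensor[OF f_set_L1(1) f_set_L1(1)] ..
  also have "\<dots> \<le> C * ((2 * l * B / c) * (2 * l * B / c))"
    using f_set_L1(2,3) C by (intro mult_left_mono mult_mono) auto
  also have "\<dots> = C * (2 * l * B)\<^sup>2 / c\<^sup>2" by (simp add: power2_eq_square)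
  finally show ?thesis .
qed

lemma reflected: "rescaled_bump (\<lambda>x. g (- x)) M B l \<delta> c (- E)"
proof
  show "M-lipschitz_on UNIV (\<lambda>x. g (- x))" by (rule lipschitz_reflect[OF lip])
qed (use supp[of "- _"] bound l \<delta> c bulk in auto)

lemma f_reflected: "f (- x) = rescaled_bump.f (\<lambda>x. g (- x)) c (- E) x"
proof -
  have "c * (- x - E) = - (c * (x - - E))" by (simp add: algebra_simps)
  then show ?thesis unfolding f_def rescaled_bump.f_def[OF reflected] by (simp only:)
qed

text \<open>The supports of the function and of its reflection lie within l / c of E and of
  -E.\<close>

lemma f_disjoint_reflection:
  assumes "l < c * \<bar>E\<bar>"
  shows "f x * f (- x) = 0"
proof (rule ccontr)
  assume "f x * f (- x) \<noteq> 0"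
  then have "\<bar>x - E\<bar> \<le> l / c" "\<bar>- x - E\<bar> \<le> l / c" using f_supp[of x] f_supp[of "- x"] by auto
  then have "\<bar>E\<bar> \<le> l / c" by linarith
  then show False using assms c_pos by (simp add: pos_le_divide_eq mult.commute)
qed

section \<open>The trace variances\<close>

lemma V_tr1_eq: "V_tr1 f = tr_form f f / (4 * pi\<^sup>2)"
  unfolding V_tr1_def tr_form_def sqrt_edge by (simp add: power2_eq_square)

lemma tr_form_asymptotics:
  assumes h: "rescaled_bump h M B l \<delta> c E"
  shows "\<bar>tr_form f (rescaled_bump.f h c E) - Hhalf_inner g h\<bar> \<le> 14 * pi / \<delta>\<^sup>2 * (4 * l * B\<^sup>2) / c"
proof -
  interpret h: rescaled_bump h M B l \<delta> c E by (rule h)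
  have "Hhalf_inner f h.f = Hhalf_inner g h"
    unfolding f_def h.f_def by (rule Hhalf_inner_rescale) (use c_pos in auto)
  then have "\<bar>tr_form f h.f - Hhalf_inner g h\<bar> \<le> 14 * pi / \<delta>\<^sup>2 * ((LINT x|lborel. (f x)\<^sup>2) + (LINT x|lborel. (h.f x)\<^sup>2))"
    using tr_form_Hhalf_inner[OF f_lipschitz h.f_lipschitz \<delta> f_bulk h.f_bulk] by simp
  also have "\<dots> \<le> 14 * pi / \<delta>\<^sup>2 * (2 * l * B\<^sup>2 / c + 2 * l * B\<^sup>2 / c)"
    by (intro mult_left_mono add_mono f_L2 h.f_L2) auto
  also have "\<dots> = 14 * pi / \<delta>\<^sup>2 * (4 * l * B\<^sup>2) / c" by simp
  finally show ?thesis .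
qed

lemma divide_4pi2_le: "\<bar>x\<bar> \<le> y \<Longrightarrow> \<bar>x / (4 * pi\<^sup>2)\<bar> \<le> y"
proof -
  assume xy: "\<bar>x\<bar> \<le> y"
  have "1 \<le> pi\<^sup>2" using pi_gt3 by (simp add: one_le_power)
  then have "\<bar>x\<bar> / (4 * pi\<^sup>2) \<le> \<bar>x\<bar> / 1" by (intro divide_left_mono) auto
  then show ?thesis using xy by (simp add: abs_divide)
qed

lemma V_tr1_asymptotics:
  "\<bar>V_tr1 f - Hhalf_inner g g / (4 * pi\<^sup>2)\<bar> \<le> 14 * pi / \<delta>\<^sup>2 * (4 * l * B\<^sup>2) / c"
  unfolding V_tr1_eq diff_divide_distrib[symmetric]
  by (rule divide_4pi2_le[OF tr_form_asymptotics[OF rescaled_bump_axioms]])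

text \<open>The formula for the mixed derivative is available on the open square only; at the edges
  the factor \<open>f x\<close> or \<open>f y\<close> vanishes.\<close>

lemma V_tr2_integrand:
  assumes "\<bar>\<sigma>\<bar> < 1"
  shows "integral_sq (\<lambda>x y. f x * f y * deriv (\<lambda>u. deriv (\<lambda>v. log_kernel \<sigma> u v) y) x)
    = integral_sq (\<lambda>x y. f x * f y * kern \<sigma> x y)"
proof (rule integral_sq_cong)
  show "f x * f y * deriv (\<lambda>u. deriv (\<lambda>v. log_kernel \<sigma> u v) y) x = f x * f y * kern \<sigma> x y" for x y
  proof (cases "f x = 0 \<or> f y = 0")
    case False
    then show ?thesis
      using f_bulk[of x] f_bulk[of y] \<delta> by (subst deriv_log_kernel[OF assms]) auto
  qed auto
qed

lemma integral_reflected: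
  assumes [measurable]: "(\<lambda>(x, y). K x y) \<in> borel_measurable (borel \<Otimes>\<^sub>M borel)"
    and K: "\<And>x y. \<bar>x\<bar> \<le> 2 \<Longrightarrow> \<bar>y\<bar> \<le> 2 \<Longrightarrow> \<bar>K x y\<bar> \<le> C / (edge x * edge y)"
  shows "integral_sq (\<lambda>x y. f x * f y * K x (- y)) = integral_sq (\<lambda>x y. f x * f (- y) * K x y)"
proof -
  have [measurable]: "(\<lambda>(x, y). K x (- y)) \<in> borel_measurable (borel \<Otimes>\<^sub>M borel)"
  proof -
    have "(\<lambda>p. (\<lambda>(x, y). K x y) (fst p, - snd p)) \<in> borel_measurable (borel \<Otimes>\<^sub>M borel)"
      by (rule measurable_compose[OF _ assms(1)]) measurable
    then show ?thesis by (simp add: case_prod_unfold)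
  qed
  have b: "\<bar>f x * f y * k\<bar> \<le> B * B * C / e" if "\<bar>k\<bar> \<le> C / e" for x y k e
  proof -
    have "\<bar>f x * f y * k\<bar> \<le> B * B * (C / e)"
      unfolding abs_mult using that B_nonneg by (intro mult_mono f_bound) auto
    then show ?thesis by simp
  qed
  have i1: "sq_integrable (\<lambda>x y. f x * f (- y) * K x y)"
    by (rule sq_integrable_bounded_by_inverse_edge[where C = "B * B * C"]) (measurable, rule b, rule K)
  have i2: "sq_integrable (\<lambda>x y. f x * f (- (- y)) * K x (- y))"
  proof (rule sq_integrable_bounded_by_inverse_edge[where C = "B * B * C"])
    show "\<bar>f x * f (- (- y)) * K x (- y)\<bar> \<le> B * B * C / (edge x * edge y)" if "\<bar>x\<bar> \<le> 2" "\<bar>y\<bar> \<le> 2" for x y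
      using K[of x "- y"] that by (intro b) auto
  qed measurable
  show ?thesis using integral_sq_reflect[OF i1 i2] by simp
qed

lemma V_tr2_1: "V_tr2 f 1 = tr_form f f / (4 * pi\<^sup>2)"
  unfolding V_tr2_def
proof (rule extend_limit_1)
  show "1 / (4 * pi\<^sup>2) * integral_sq (\<lambda>x y. f x * f y * deriv (\<lambda>u. deriv (\<lambda>v. log_kernel \<sigma> u v) y) x)
      = integral_sq (\<lambda>x y. f x * f y * kern \<sigma> x y) / (4 * pi\<^sup>2)" if "\<bar>\<sigma>\<bar> < 1" for \<sigma>
    by (simp add: V_tr2_integrand[OF that])
  show "((\<lambda>\<sigma>. integral_sq (\<lambda>x y. f x * f y * kern \<sigma> x y) / (4 * pi\<^sup>2)) \<longlongrightarrow> tr_form f f / (4 * pi\<^sup>2)) (at 1 within {-1<..<1})"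
    by (intro tendsto_divide integral_kern_tendsto[OF f_lipschitz f_lipschitz] tendsto_const) simp
qed

lemma V_tr2_minus_1: "V_tr2 f (- 1) = tr_form f (\<lambda>x. f (- x)) / (4 * pi\<^sup>2)"
  unfolding V_tr2_def
proof (rule extend_limit_minus_1)
  show "1 / (4 * pi\<^sup>2) * integral_sq (\<lambda>x y. f x * f y * deriv (\<lambda>u. deriv (\<lambda>v. log_kernel (- \<sigma>) u v) y) x)
      = integral_sq (\<lambda>x y. f x * f (- y) * kern \<sigma> x y) / (4 * pi\<^sup>2)" if s: "\<bar>\<sigma>\<bar> < 1" for \<sigma>
  proof -
    have "integral_sq (\<lambda>x y. f x * f y * kern (- \<sigma>) x y) = integral_sq (\<lambda>x y. f x * f (- y) * kern \<sigma> x y)"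
      unfolding kern_uminus
      by (rule integral_reflected[where C = "16 / (1 - \<bar>\<sigma>\<bar>) ^ 4"]) (measurable, rule abs_kern_le[OF s])
    then show ?thesis using s by (simp add: V_tr2_integrand)
  qed
  show "((\<lambda>\<sigma>. integral_sq (\<lambda>x y. f x * f (- y) * kern \<sigma> x y) / (4 * pi\<^sup>2)) \<longlongrightarrow> tr_form f (\<lambda>x. f (- x)) / (4 * pi\<^sup>2)) (at 1 within {-1<..<1})"
    by (intro tendsto_divide integral_kern_tendsto[OF f_lipschitz lipschitz_reflect[OF f_lipschitz]] tendsto_const) simp
qed

text \<open>On the support both edge factors are at least \<delta>, so the kernel is bounded there.
  Two L1 norms of order 1 / c give c^-2, which is relaxed to c^-1.\<close>

lemma V_tr2_inner_bound:
  assumes "0 < \<epsilon>'" "\<bar>\<sigma>\<bar> \<le> 1 - \<epsilon>'"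
  shows "\<bar>V_tr2 f \<sigma>\<bar> \<le> 16 / \<epsilon>' ^ 4 / \<delta>\<^sup>2 * (2 * l * B)\<^sup>2 / c"
proof -
  have s: "\<bar>\<sigma>\<bar> < 1" using assms by linarith
  have e: "\<epsilon>' ^ 4 \<le> (1 - \<bar>\<sigma>\<bar>) ^ 4" using assms by (intro power_mono) auto
  have "\<bar>integral_sq (\<lambda>x y. f x * f y * kern \<sigma> x y)\<bar> \<le> 16 / \<epsilon>' ^ 4 / \<delta>\<^sup>2 * (2 * l * B)\<^sup>2 / c\<^sup>2"
  proof (rule integral_sq_product_bound)
    fix x y :: real
    assume xy: "\<bar>x\<bar> \<le> 2" "\<bar>y\<bar> \<le> 2"
    show "\<bar>f x * f y * kern \<sigma> x y\<bar> \<le> 16 / \<epsilon>' ^ 4 / \<delta>\<^sup>2 * (\<bar>f x\<bar> * \<bar>f y\<bar>)"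
    proof (cases "f x = 0 \<or> f y = 0")
      case False
      then have "\<delta> \<le> edge x" "\<delta> \<le> edge y" using edge_bulk by auto
      then have d: "\<delta>\<^sup>2 \<le> edge x * edge y" unfolding power2_eq_square using \<delta> by (intro mult_mono) auto
      have "\<bar>kern \<sigma> x y\<bar> \<le> 16 / (1 - \<bar>\<sigma>\<bar>) ^ 4 / (edge x * edge y)" by (rule abs_kern_le[OF s xy])
      also have "\<dots> \<le> 16 / \<epsilon>' ^ 4 / \<delta>\<^sup>2"
        using d e assms(1) \<delta> by (intro frac_le) auto
      finally have "\<bar>f x * f y\<bar> * \<bar>kern \<sigma> x y\<bar> \<le> \<bar>f x * f y\<bar> * (16 / \<epsilon>' ^ 4 / \<delta>\<^sup>2)"
        by (rule mult_left_mono) simp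
      then show ?thesis by (simp add: abs_mult mult_ac)
    qed auto
  qed (use assms(1) in simp)
  also have "\<dots> \<le> 16 / \<epsilon>' ^ 4 / \<delta>\<^sup>2 * (2 * l * B)\<^sup>2 / c"
    using assms(1) by (intro inverse_square_le) auto
  finally have "\<bar>integral_sq (\<lambda>x y. f x * f y * kern \<sigma> x y) / (4 * pi\<^sup>2)\<bar> \<le> 16 / \<epsilon>' ^ 4 / \<delta>\<^sup>2 * (2 * l * B)\<^sup>2 / c"
    by (rule divide_4pi2_le)
  then show ?thesis
    unfolding V_tr2_def extend_limit_inner[OF s] by (simp add: V_tr2_integrand[OF s])
qed

text \<open>The supports around E and -E are disjoint, so of the product of increments only the
  cross terms f x h y and f y h x survive. Where these are nonzero, |x - y| \<ge> 2|E| - 2 l / c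
  \<ge> \<epsilon>', and the singular denominator is harmless.\<close>

lemma tr_form_reflected_bound:
  assumes \<epsilon>': "0 < \<epsilon>'" "\<epsilon>' \<le> \<bar>E\<bar>" and c': "2 * l < c * \<epsilon>'"
  shows "\<bar>tr_form f (\<lambda>x. f (- x))\<bar> \<le> 16 / (\<delta>\<^sup>2 * \<epsilon>'\<^sup>2) * (2 * l * B)\<^sup>2 / c"
proof -
  interpret r: rescaled_bump "\<lambda>x. g (- x)" M B l \<delta> c "- E" by (rule reflected)
  define h where "h x = f (- x)" for x
  have h: "h = r.f" by (simp add: fun_eq_iff h_def f_reflected)
  define C where "C = 8 / (\<delta>\<^sup>2 * \<epsilon>'\<^sup>2)"
  have C: "0 \<le> C" by (simp add: C_def)
  have "c * \<epsilon>' \<le> c * \<bar>E\<bar>" using \<epsilon>' c_pos by (intro mult_left_mono) auto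
  then have "l < c * \<bar>E\<bar>" using c' l by linarith
  then have z: "f x * h x = 0" for x unfolding h_def by (rule f_disjoint_reflection)
  have lc: "2 * (l / c) \<le> \<epsilon>'" using c' c_pos by (simp add: field_simps)
  have one: "\<bar>f x * h y\<bar> / (x - y)\<^sup>2 * ((4 - x * y) / (edge x * edge y)) \<le> C * (\<bar>f x\<bar> * \<bar>h y\<bar>)"
    if xy: "\<bar>x\<bar> \<le> 2" "\<bar>y\<bar> \<le> 2" for x y
  proof (cases "f x = 0 \<or> h y = 0")
    case False
    then have s: "\<bar>x - E\<bar> \<le> l / c" "\<bar>y - - E\<bar> \<le> l / c" using f_supp[of x] r.f_supp[of y] by (auto simp: h)
    then have "\<epsilon>' \<le> \<bar>x - y\<bar>" using \<epsilon>' lc by linarith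
    then have d: "\<epsilon>'\<^sup>2 \<le> (x - y)\<^sup>2" using power_mono[of \<epsilon>' "\<bar>x - y\<bar>" 2] \<epsilon>' by simp
    have "\<delta> \<le> edge x" "\<delta> \<le> edge y" using edge_bulk r.edge_bulk False by (auto simp: h)
    then have e: "\<delta>\<^sup>2 \<le> edge x * edge y" unfolding power2_eq_square using \<delta> by (intro mult_mono) auto
    have "1 / (x - y)\<^sup>2 * ((4 - x * y) / (edge x * edge y)) \<le> 1 / \<epsilon>'\<^sup>2 * (8 / \<delta>\<^sup>2)"
      using d e \<epsilon>' \<delta> abs_4_minus_mult[OF xy] edge_prod_bounds(1)[OF xy]
      by (intro mult_mono frac_le) auto
    then have "\<bar>f x * h y\<bar> * (1 / (x - y)\<^sup>2 * ((4 - x * y) / (edge x * edge y))) \<le> \<bar>f x * h y\<bar> * (1 / \<epsilon>'\<^sup>2 * (8 / \<delta>\<^sup>2))"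
      by (rule mult_left_mono) simp
    then show ?thesis by (simp add: C_def abs_mult mult_ac)
  qed auto
  have i: "sq_integrable (\<lambda>x y. C * (\<bar>f x\<bar> * \<bar>h y\<bar>))" "sq_integrable (\<lambda>x y. C * (\<bar>h x\<bar> * \<bar>f y\<bar>))"
    unfolding h by (intro sq_integrable_cmult sq_integrable_tensor f_set_L1(1) r.f_set_L1(1))+
  have "\<bar>tr_form f h\<bar> \<le> integral_sq (\<lambda>x y. C * (\<bar>f x\<bar> * \<bar>h y\<bar>) + C * (\<bar>h x\<bar> * \<bar>f y\<bar>))"
    unfolding tr_form_def
  proof (rule abs_integral_sq_le[OF sq_integrable_add[OF i]])
    fix x y :: real
    assume xy: "\<bar>x\<bar> \<le> 2" "\<bar>y\<bar> \<le> 2"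
    let ?w = "(4 - x * y) / (edge x * edge y)"
    have w: "0 \<le> ?w" using abs_4_minus_mult[OF xy] edge_prod_bounds(1)[OF xy] by simp
    have "(f x - f y) * (h x - h y) = f x * h x + f y * h y - f x * h y - f y * h x"
      by (simp add: algebra_simps)
    then have "(f x - f y) * (h x - h y) = - (f x * h y) - f y * h x"
      unfolding z by simp
    then have n: "\<bar>(f x - f y) * (h x - h y)\<bar> \<le> \<bar>f x * h y\<bar> + \<bar>f y * h x\<bar>"
      by linarith
    have "\<bar>(f x - f y) / (x - y) * ((h x - h y) / (x - y)) * ?w\<bar> = \<bar>(f x - f y) * (h x - h y)\<bar> / (x - y)\<^sup>2 * ?w"
      unfolding abs_mult[of _ ?w] abs_of_nonneg[OF w] by (simp add: abs_mult abs_divide power2_eq_square abs_mult_self_eq)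
    also have "\<dots> \<le> (\<bar>f x * h y\<bar> + \<bar>f y * h x\<bar>) / (x - y)\<^sup>2 * ?w"
      by (intro mult_right_mono divide_right_mono n w) simp
    also have "\<dots> = \<bar>f x * h y\<bar> / (x - y)\<^sup>2 * ?w + \<bar>f y * h x\<bar> / (y - x)\<^sup>2 * ((4 - y * x) / (edge y * edge x))"
      by (simp only: add_divide_distrib distrib_right power2_commute[of y x] mult.commute[of y x] mult.commute[of "edge y"])
    also have "\<dots> \<le> C * (\<bar>f x\<bar> * \<bar>h y\<bar>) + C * (\<bar>f y\<bar> * \<bar>h x\<bar>)"
      by (intro add_mono one xy)
    finally show "\<bar>(f x - f y) / (x - y) * ((h x - h y) / (x - y)) * ?w\<bar>
        \<le> C * (\<bar>f x\<bar> * \<bar>h y\<bar>) + C * (\<bar>h x\<bar> * \<bar>f y\<bar>)" by (simp add: mult.commute[of "\<bar>h x\<bar>"])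
  qed
  also have "\<dots> = 2 * C * ((LINT x:{-2..2}|lborel. \<bar>f x\<bar>) * (LINT x:{-2..2}|lborel. \<bar>h x\<bar>))"
    unfolding integral_sq_add[OF i] unfolding integral_sq_cmult h
      integral_sq_tensor[OF f_set_L1(1) r.f_set_L1(1)] integral_sq_tensor[OF r.f_set_L1(1) f_set_L1(1)]
    by simp
  also have "\<dots> \<le> 2 * C * ((2 * l * B / c) * (2 * l * B / c))"
    unfolding h using f_set_L1 r.f_set_L1 C by (intro mult_left_mono mult_mono) auto
  also have "\<dots> = 16 / (\<delta>\<^sup>2 * \<epsilon>'\<^sup>2) * (2 * l * B)\<^sup>2 / c\<^sup>2" by (simp add: C_def power2_eq_square)
  also have "\<dots> \<le> 16 / (\<delta>\<^sup>2 * \<epsilon>'\<^sup>2) * (2 * l * B)\<^sup>2 / c" by (rule inverse_square_le) simp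
  finally show ?thesis by (simp add: h_def[abs_def])
qed

definition rho_C :: real where
  "rho_C = 32 / \<delta> ^ 3 + 2 / \<delta> + 32 / \<delta>\<^sup>2 + 8"

text \<open>The assumption \<open>big\<close> keeps \<^const>\<open>rho\<close> above half of its lower bound \<open>\<delta> / (2 \<pi>)\<close> in the bulk.\<close>

lemma normalize_by_rho:
  assumes big: "4 * pi * rho_C \<le> \<delta> * c"
    and X: "\<bar>X - edge E / (2 * pi) * I / c\<bar> \<le> C / c\<^sup>2" and I: "\<bar>I\<bar> \<le> I0"
  shows "\<bar>c / rho (Complex E (1 / c)) * X - I\<bar> \<le> 4 * pi / \<delta> * (rho_C * I0 + C) / c"
proof -
  define r e where "r = rho (Complex E (1 / c))" and "e = edge E / (2 * pi)"
  have re: "\<bar>r - e\<bar> \<le> rho_C / c"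
    using rho_bulk[OF \<delta> E_bulk, of "1 / c"] c_pos by (simp add: r_def e_def rho_C_def)
  have rC: "0 \<le> rho_C" using \<delta> by (simp add: rho_C_def)
  have "\<delta> / (2 * pi) \<le> e" unfolding e_def using edge_ge[OF E_bulk] \<delta> by (intro divide_right_mono) auto
  moreover have "rho_C / c \<le> \<delta> / (4 * pi)" using big c_pos by (simp add: field_simps)
  moreover have "\<delta> / (2 * pi) = \<delta> / (4 * pi) + \<delta> / (4 * pi)" by simp
  ultimately have r: "\<delta> / (4 * pi) \<le> r" using re by linarith
  have "0 < \<delta> / (4 * pi)" using \<delta> by simp
  then have r0: "0 < r" using r by linarith
  \<comment> \<open>Splits the error into the expansion error of X, magnified by c, and the error of
    replacing the density r by its bulk value e. Both are O(1 / c), and r is bounded below.\<close>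
  have "c / r * X - I = (c * (X - e * I / c) + (e - r) * I) / r"
    using r0 c_pos by (simp add: field_simps)
  then have "\<bar>c / r * X - I\<bar> = \<bar>c * (X - e * I / c) + (e - r) * I\<bar> / r"
    using r0 by simp
  also have "\<dots> \<le> (C / c + rho_C / c * I0) / (\<delta> / (4 * pi))"
  proof (rule frac_le)
    have "\<bar>c * (X - e * I / c)\<bar> \<le> c * (C / c\<^sup>2)"
      unfolding abs_mult using X c_pos by (intro mult_mono) (auto simp: e_def)
    also have "\<dots> = C / c" using c_pos by (simp add: power2_eq_square)
    finally have 1: "\<bar>c * (X - e * I / c)\<bar> \<le> C / c" .
    have 2: "\<bar>(e - r) * I\<bar> \<le> rho_C / c * I0"
      unfolding abs_mult using re I rC c_pos by (intro mult_mono) auto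
    show "\<bar>c * (X - e * I / c) + (e - r) * I\<bar> \<le> C / c + rho_C / c * I0" using 1 2 by linarith
    have "0 \<le> C / c\<^sup>2" using X by (meson abs_ge_zero order_trans)
    then have "0 \<le> C" using c_pos by (simp add: zero_le_divide_iff)
    moreover have "0 \<le> I0" using I by linarith
    ultimately show "0 \<le> C / c + rho_C / c * I0" using c_pos rC by simp
  qed (use r \<delta> in auto)
  also have "\<dots> = 4 * pi / \<delta> * (rho_C * I0 + C) / c"
    using \<delta> c_pos by (simp add: field_simps)
  finally show ?thesis by (simp add: r_def)
qed

section \<open>The diagonal variances\<close>

lemma avg_sc_f_bound: "\<bar>avg_sc f\<bar> \<le> 2 * l * B / c"
proof -
  have "\<bar>avg_sc f\<bar> \<le> (LINT x:{-2..2}|lborel. \<bar>f x\<bar>)"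
    unfolding avg_sc_def
  proof (rule abs_set_integral_le[OF f_set_L1(1)])
    fix x :: real
    assume "x \<in> {-2..2}"
    then have x: "\<bar>x\<bar> \<le> 2" by auto
    have "edge x / (2 * pi) \<le> 1" using edge_le_2[of x] pi_gt3 by simp
    then have "\<bar>f x\<bar> * (edge x / (2 * pi)) \<le> \<bar>f x\<bar> * 1" by (rule mult_left_mono) simp
    then show "\<bar>f x * sqrt (4 - x\<^sup>2) / (2 * pi)\<bar> \<le> \<bar>f x\<bar>"
      using edge_nonneg[OF x] by (simp add: edge_def abs_mult)
  qed
  then show ?thesis using f_set_L1(2) by linarith
qed

lemma avg_sc_f_square_bound: "(avg_sc f)\<^sup>2 \<le> (2 * l * B)\<^sup>2 / c\<^sup>2"
  using power_mono[OF avg_sc_f_bound, of 2] by (simp add: power_divide)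

text \<open>The error of \<open>avg_sc_rescale\<close> for a product bounded by B^2, plus the square
  of the mean.\<close>

definition d_C :: real where
  "d_C = l / \<delta> * (2 * l * B\<^sup>2) + (2 * l * B)\<^sup>2"

text \<open>Serves both endpoints: h is g at \<sigma> = 1 and the reflected g at \<sigma> = -1 with
  E = 0. The squared mean is O(c^-2), one order below the main term, so it drops out after
  normalization.\<close>

lemma avg_sc_product:
  assumes h: "continuous_on UNIV h" "\<And>x. \<bar>h x\<bar> \<le> B"
  shows "\<bar>avg_sc (\<lambda>x. g (c * (x - E)) * h (c * (x - E))) - (avg_sc f)\<^sup>2
      - edge E / (2 * pi) * (LINT x|lborel. g x * h x) / c\<bar> \<le> d_C / c\<^sup>2"
    and "\<bar>LINT x|lborel. g x * h x\<bar> \<le> 2 * l * B\<^sup>2"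
proof -
  have gh: "\<bar>g x * h x\<bar> \<le> B\<^sup>2" for x
    unfolding abs_mult power2_eq_square using B_nonneg by (intro mult_mono bound h) auto
  show "\<bar>LINT x|lborel. g x * h x\<bar> \<le> 2 * l * B\<^sup>2"
    by (rule integral_g_bound[OF gh]) auto
  have "\<bar>avg_sc (\<lambda>x. g (c * (x - E)) * h (c * (x - E))) - edge E / (2 * pi) * (LINT x|lborel. g x * h x) / c\<bar>
      \<le> l / \<delta> * (LINT x|lborel. \<bar>g x * h x\<bar>) / c\<^sup>2"
    by (rule avg_sc_rescale[of \<delta> c l E "\<lambda>x. g x * h x"])
       (use \<delta> c_pos l bulk supp in \<open>auto intro!: continuous_intros g_continuous h\<close>)
  also have "\<dots> \<le> l / \<delta> * (2 * l * B\<^sup>2) / c\<^sup>2"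
  proof -
    have "\<bar>LINT x|lborel. \<bar>g x * h x\<bar>\<bar> \<le> 2 * l * B\<^sup>2"
      by (rule integral_g_bound) (use gh in auto)
    then show ?thesis using l \<delta> by (intro divide_right_mono mult_left_mono) auto
  qed
  finally show "\<bar>avg_sc (\<lambda>x. g (c * (x - E)) * h (c * (x - E))) - (avg_sc f)\<^sup>2
      - edge E / (2 * pi) * (LINT x|lborel. g x * h x) / c\<bar> \<le> d_C / c\<^sup>2"
    using avg_sc_f_square_bound zero_le_power2[of "avg_sc f"]
    unfolding d_C_def add_divide_distrib by linarith
qed

definition d_bound :: real where
  "d_bound = 4 * pi / \<delta> * (rho_C * (2 * l * B\<^sup>2) + d_C)"

lemma V_d1_asymptotics:
  assumes "4 * pi * rho_C \<le> \<delta> * c"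
  shows "\<bar>c / rho (Complex E (1 / c)) * V_d1 f - (L2_norm g)\<^sup>2\<bar> \<le> d_bound / c"
  unfolding d_bound_def L2_norm_square
proof (rule normalize_by_rho[OF assms])
  show "\<bar>V_d1 f - edge E / (2 * pi) * (LINT x|lborel. (g x)\<^sup>2) / c\<bar> \<le> d_C / c\<^sup>2"
    using avg_sc_product(1)[OF g_continuous bound] by (simp add: V_d1_def f_def power2_eq_square)
  show "\<bar>LINT x|lborel. (g x)\<^sup>2\<bar> \<le> 2 * l * B\<^sup>2"
    using avg_sc_product(2)[OF g_continuous bound] by (simp add: power2_eq_square)
qed

lemma V_d2_integrand:
  "integral_sq (\<lambda>x y. f x * f y * ((1 - \<sigma>\<^sup>2) * sqrt ((4 - x\<^sup>2) * (4 - y\<^sup>2)) /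
        (\<sigma>\<^sup>2 * (x\<^sup>2 + y\<^sup>2) + (1 - \<sigma>\<^sup>2)\<^sup>2 - x * y * \<sigma> * (1 + \<sigma>\<^sup>2))))
   = integral_sq (\<lambda>x y. f x * f y * pker \<sigma> x y)"
  unfolding sqrt_edge pker_def ..

lemma V_d2_limit_value: "1 / (4 * pi\<^sup>2) * (4 * pi\<^sup>2 * s) = (s :: real)"
  by simp

lemma V_d2_1: "V_d2 f 1 = V_d1 f"
  unfolding V_d2_def V_d2_integrand
proof (rule extend_limit_1[OF refl])
  have "((\<lambda>\<sigma>. 1 / (4 * pi\<^sup>2) * integral_sq (\<lambda>x y. f x * f y * pker \<sigma> x y) - (avg_sc f)\<^sup>2)
      \<longlongrightarrow> 1 / (4 * pi\<^sup>2) * (4 * pi\<^sup>2 * avg_sc (\<lambda>x. f x * f x)) - (avg_sc f)\<^sup>2) (at 1 within {-1<..<1})"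
    by (intro tendsto_diff tendsto_mult tendsto_const integral_pker_tendsto[OF f_lipschitz f_lipschitz])
  then show "((\<lambda>\<sigma>. 1 / (4 * pi\<^sup>2) * integral_sq (\<lambda>x y. f x * f y * pker \<sigma> x y) - (avg_sc f)\<^sup>2)
      \<longlongrightarrow> V_d1 f) (at 1 within {-1<..<1})"
    unfolding V_d2_limit_value by (simp add: V_d1_def power2_eq_square)
qed

lemma V_d2_minus_1: "V_d2 f (- 1) = avg_sc (\<lambda>x. f x * f (- x)) - (avg_sc f)\<^sup>2"
  unfolding V_d2_def V_d2_integrand
proof (rule extend_limit_minus_1)
  show "1 / (4 * pi\<^sup>2) * integral_sq (\<lambda>x y. f x * f y * pker (- \<sigma>) x y) - (avg_sc f)\<^sup>2
      = 1 / (4 * pi\<^sup>2) * integral_sq (\<lambda>x y. f x * f (- y) * pker \<sigma> x y) - (avg_sc f)\<^sup>2"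
    if s: "\<bar>\<sigma>\<bar> < 1" for \<sigma>
  proof -
    have "integral_sq (\<lambda>x y. f x * f y * pker \<sigma> x (- y)) = integral_sq (\<lambda>x y. f x * f (- y) * pker \<sigma> x y)"
    proof (rule integral_reflected[where C = "16 / (1 - \<bar>\<sigma>\<bar>) ^ 4"])
      show "\<bar>pker \<sigma> x y\<bar> \<le> 16 / (1 - \<bar>\<sigma>\<bar>) ^ 4 / (edge x * edge y)" if "\<bar>x\<bar> \<le> 2" "\<bar>y\<bar> \<le> 2" for x y
        using pker_le'[OF s that] pker_nonneg[OF s that] by simp
    qed measurable
    then show ?thesis unfolding pker_uminus by simp
  qed
  have "((\<lambda>\<sigma>. 1 / (4 * pi\<^sup>2) * integral_sq (\<lambda>x y. f x * f (- y) * pker \<sigma> x y) - (avg_sc f)\<^sup>2)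
      \<longlongrightarrow> 1 / (4 * pi\<^sup>2) * (4 * pi\<^sup>2 * avg_sc (\<lambda>x. f x * f (- x))) - (avg_sc f)\<^sup>2) (at 1 within {-1<..<1})"
    by (intro tendsto_diff tendsto_mult tendsto_const
        integral_pker_tendsto[OF f_lipschitz lipschitz_reflect[OF f_lipschitz]])
  then show "((\<lambda>\<sigma>. 1 / (4 * pi\<^sup>2) * integral_sq (\<lambda>x y. f x * f (- y) * pker \<sigma> x y) - (avg_sc f)\<^sup>2)
      \<longlongrightarrow> avg_sc (\<lambda>x. f x * f (- x)) - (avg_sc f)\<^sup>2) (at 1 within {-1<..<1})"
    unfolding V_d2_limit_value .
qed

lemma V_d2_minus_1_center:
  assumes "4 * pi * rho_C \<le> \<delta> * c" and E: "E = 0"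
  shows "\<bar>c / rho (Complex E (1 / c)) * V_d2 f (- 1) - L2_inner g (\<lambda>x. g (- x))\<bar> \<le> d_bound / c"
  unfolding d_bound_def L2_inner_def
proof (rule normalize_by_rho[OF assms(1)])
  have cr: "continuous_on UNIV (\<lambda>x. g (- x))"
    by (rule lipschitz_on_continuous_on[OF lipschitz_reflect[OF lip]])
  note a = avg_sc_product[OF cr bound]
  show "\<bar>V_d2 f (- 1) - edge E / (2 * pi) * (LINT x|lborel. g x * g (- x)) / c\<bar> \<le> d_C / c\<^sup>2"
  proof -
    have r: "f (- x) = g (- (c * (x - E)))" for x
    proof -
      have "c * (- x - E) = - (c * (x - E))" using E by simp
      then show ?thesis unfolding f_def by (simp only:)
    qed
    show ?thesis using a(1) unfolding V_d2_minus_1 r by (simp only: f_def)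
  qed
  show "\<bar>LINT x|lborel. g x * g (- x)\<bar> \<le> 2 * l * B\<^sup>2" by (rule a(2))
qed

lemma V_d2_minus_1_off_center:
  assumes "4 * pi * rho_C \<le> \<delta> * c" and "l < c * \<bar>E\<bar>"
  shows "\<bar>c / rho (Complex E (1 / c)) * V_d2 f (- 1)\<bar> \<le> d_bound / c"
proof -
  have "V_d2 f (- 1) = - (avg_sc f)\<^sup>2"
    unfolding V_d2_minus_1 f_disjoint_reflection[OF assms(2)] by (simp add: avg_sc_def)
  moreover have "0 \<le> l / \<delta> * (2 * l * B\<^sup>2)" using l \<delta> by simp
  then have "(2 * l * B)\<^sup>2 / c\<^sup>2 \<le> d_C / c\<^sup>2"
    unfolding d_C_def by (intro divide_right_mono) auto
  ultimately have "\<bar>V_d2 f (- 1) - edge E / (2 * pi) * 0 / c\<bar> \<le> d_C / c\<^sup>2"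
    using avg_sc_f_square_bound by simp
  \<comment> \<open>The main term is I = 0 here; the bound I0 is kept at 2 l B^2 only to arrive at
    the same constant \<open>d_bound\<close>.\<close>
  from normalize_by_rho[OF assms(1) this, of "2 * l * B\<^sup>2"] show ?thesis
    using l by (simp add: d_bound_def)
qed

lemma V_d2_inner_bound:
  assumes "4 * pi * rho_C \<le> \<delta> * c" and \<epsilon>': "0 < \<epsilon>'" "\<bar>\<sigma>\<bar> \<le> 1 - \<epsilon>'"
  shows "\<bar>c / rho (Complex E (1 / c)) * V_d2 f \<sigma>\<bar>
    \<le> 4 * pi / \<delta> * (4 / \<epsilon>' ^ 4 * (2 * l * B)\<^sup>2 + (2 * l * B)\<^sup>2) / c"
proof -
  have s: "\<bar>\<sigma>\<bar> < 1" using \<epsilon>' by linarith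
  have e: "\<epsilon>' ^ 4 \<le> (1 - \<bar>\<sigma>\<bar>) ^ 4" using \<epsilon>' by (intro power_mono) auto
  have "\<bar>integral_sq (\<lambda>x y. f x * f y * pker \<sigma> x y)\<bar> \<le> 4 / \<epsilon>' ^ 4 * (2 * l * B)\<^sup>2 / c\<^sup>2"
  proof (rule integral_sq_product_bound)
    fix x y :: real
    assume xy: "\<bar>x\<bar> \<le> 2" "\<bar>y\<bar> \<le> 2"
    have "pker \<sigma> x y \<le> 4 / (1 - \<bar>\<sigma>\<bar>) ^ 4" by (rule pker_le[OF s xy])
    also have "\<dots> \<le> 4 / \<epsilon>' ^ 4" using e \<epsilon>'(1) by (intro frac_le) auto
    finally have "\<bar>f x * f y\<bar> * \<bar>pker \<sigma> x y\<bar> \<le> \<bar>f x * f y\<bar> * (4 / \<epsilon>' ^ 4)"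
      using pker_nonneg[OF s xy] by (intro mult_left_mono) auto
    then show "\<bar>f x * f y * pker \<sigma> x y\<bar> \<le> 4 / \<epsilon>' ^ 4 * (\<bar>f x\<bar> * \<bar>f y\<bar>)"
      by (simp add: abs_mult mult_ac)
  qed (use \<epsilon>'(1) in simp)
  then have "\<bar>integral_sq (\<lambda>x y. f x * f y * pker \<sigma> x y) / (4 * pi\<^sup>2)\<bar> \<le> 4 / \<epsilon>' ^ 4 * (2 * l * B)\<^sup>2 / c\<^sup>2"
    by (rule divide_4pi2_le)
  then have "\<bar>integral_sq (\<lambda>x y. f x * f y * pker \<sigma> x y) / (4 * pi\<^sup>2) - (avg_sc f)\<^sup>2\<bar>
      \<le> 4 / \<epsilon>' ^ 4 * (2 * l * B)\<^sup>2 / c\<^sup>2 + (2 * l * B)\<^sup>2 / c\<^sup>2"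
    using avg_sc_f_square_bound zero_le_power2[of "avg_sc f"] by linarith
  then have "\<bar>V_d2 f \<sigma> - edge E / (2 * pi) * 0 / c\<bar> \<le> (4 / \<epsilon>' ^ 4 * (2 * l * B)\<^sup>2 + (2 * l * B)\<^sup>2) / c\<^sup>2"
    unfolding V_d2_def extend_limit_inner[OF s] V_d2_integrand add_divide_distrib by simp
  from normalize_by_rho[OF assms(1) this, of 0] show ?thesis by simp
qed

section \<open>The expectation term\<close>

lemma avg_inv_sc_f_bound:
  assumes "0 \<le> C" and "\<And>x. f x \<noteq> 0 \<Longrightarrow> \<bar>k x\<bar> \<le> C"
  shows "\<bar>avg_inv_sc (\<lambda>x. f x * k x)\<bar> \<le> C / \<delta> * (2 * l * B) / c"
proof -
  have "\<bar>avg_inv_sc (\<lambda>x. f x * k x)\<bar> \<le> (LINT x:{-2..2}|lborel. C / \<delta> * \<bar>f x\<bar>)"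
    unfolding avg_inv_sc_def
  proof (rule abs_set_integral_le[OF set_integrable_mult_right[OF f_set_L1(1)]])
    fix x :: real
    show "\<bar>f x * k x / (pi * sqrt (4 - x\<^sup>2))\<bar> \<le> C / \<delta> * \<bar>f x\<bar>"
    proof (cases "f x = 0")
      case False
      have "1 * \<delta> \<le> pi * edge x" using edge_bulk[OF False] \<delta> pi_gt3 by (intro mult_mono) auto
      then have "\<bar>k x\<bar> / (pi * edge x) \<le> C / \<delta>"
        using assms(2)[OF False] \<delta> assms(1) by (intro frac_le) auto
      then have "\<bar>f x\<bar> * (\<bar>k x\<bar> / (pi * edge x)) \<le> \<bar>f x\<bar> * (C / \<delta>)" by (rule mult_left_mono) simp
      moreover have "0 \<le> edge x" using edge_bulk[OF False] \<delta> by linarith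
      ultimately show ?thesis by (simp add: abs_mult abs_divide edge_def mult.commute)
    qed simp
  qed
  also have "\<dots> = C / \<delta> * (LINT x:{-2..2}|lborel. \<bar>f x\<bar>)"
    by (rule set_integral_mult_right)
  also have "\<dots> \<le> C / \<delta> * (2 * l * B) / c"
    using assms(1) \<delta> by (intro f_L1_bound_le) simp
  finally show ?thesis .
qed

lemma avg_inv_sc_f_bound_1: "\<bar>avg_inv_sc f\<bar> \<le> 1 / \<delta> * (2 * l * B) / c"
  using avg_inv_sc_f_bound[of 1 "\<lambda>_. 1"] by simp

text \<open>(1 + \<sigma>)^2 - \<sigma> x^2 = (1 - \<sigma>)^2 + \<sigma> (4 - x^2) is at least
  \<delta>^2 / 2 on the support. As \<sigma> tends to 1 the weight concentrates where 2\<alpha> is a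
  multiple of 2\<pi>, that is at the edges, away from the bulk.\<close>

lemma eker_bulk_positive:
  assumes "1 / 2 \<le> \<sigma>" "\<sigma> < 1" "f x \<noteq> 0"
  shows "\<bar>eker \<sigma> x\<bar> \<le> 2 / \<delta>\<^sup>2 * (1 - \<sigma>\<^sup>2)"
proof -
  have x: "\<bar>x\<bar> \<le> 2" using f_bulk[OF assms(3)] \<delta> by linarith
  have "\<delta>\<^sup>2 \<le> (edge x)\<^sup>2" using edge_bulk[OF assms(3)] \<delta> by (intro power_mono) auto
  then have d: "\<delta>\<^sup>2 \<le> 4 - x\<^sup>2" using edge_square[OF x] by simp
  have "1 / 2 * \<delta>\<^sup>2 \<le> \<sigma> * (4 - x\<^sup>2)" using assms d by (intro mult_mono) auto
  moreover have "(1 + \<sigma>)\<^sup>2 - \<sigma> * x\<^sup>2 = (1 - \<sigma>)\<^sup>2 + \<sigma> * (4 - x\<^sup>2)" by (simp add: power2_eq_square algebra_simps)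
  moreover have "0 \<le> (1 - \<sigma>)\<^sup>2" by simp
  ultimately have q: "\<delta>\<^sup>2 / 2 \<le> (1 + \<sigma>)\<^sup>2 - \<sigma> * x\<^sup>2" by linarith
  have s: "0 \<le> 1 - \<sigma>\<^sup>2" using assms by (simp add: abs_square_le_1)
  have "eker \<sigma> x \<le> (1 - \<sigma>\<^sup>2) / (\<delta>\<^sup>2 / 2)"
    unfolding eker_def using q s \<delta> by (intro divide_left_mono) (auto intro!: mult_pos_pos less_le_trans[OF _ q])
  moreover have "0 \<le> eker \<sigma> x" using eker_bounds(1)[of \<sigma> x] assms x by simp
  ultimately show ?thesis by (simp add: mult.commute)
qed

text \<open>The error in the expectation has to be uniform up to \<sigma> = 1, where the bound 1 /
  (1 - |\<sigma>|)^2 blows up. So \<sigma> \<ge> 1/2 relies on the distance to the edges; for the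
  rest this bound gives 4 if \<sigma> \<ge> 0 and 1 / \<epsilon>'^2 if \<sigma> < 0.\<close>

lemma eker_bulk:
  assumes "0 < \<epsilon>'" "- 1 + \<epsilon>' \<le> \<sigma>" "\<sigma> < 1" "f x \<noteq> 0"
  shows "\<bar>eker \<sigma> x\<bar> \<le> 1 / \<epsilon>'\<^sup>2 + 4 + 2 / \<delta>\<^sup>2"
proof (cases "1 / 2 \<le> \<sigma>")
  case True
  have "2 / \<delta>\<^sup>2 * (1 - \<sigma>\<^sup>2) \<le> 2 / \<delta>\<^sup>2 * 1" by (intro mult_left_mono) auto
  moreover have "0 \<le> 1 / \<epsilon>'\<^sup>2" by simp
  ultimately show ?thesis using eker_bulk_positive[OF True assms(3,4)] by linarith
next
  case False
  have x: "\<bar>x\<bar> \<le> 2" using f_bulk[OF assms(4)] \<delta> by linarith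
  have s: "\<bar>\<sigma>\<bar> < 1" using assms by auto
  have "1 / (1 - \<bar>\<sigma>\<bar>)\<^sup>2 \<le> 1 / \<epsilon>'\<^sup>2 + 4"
  proof (cases "0 \<le> \<sigma>")
    case True
    have "(1 / 2)\<^sup>2 \<le> (1 - \<bar>\<sigma>\<bar>)\<^sup>2" using False True by (intro power_mono) auto
    then have "1 / (1 - \<bar>\<sigma>\<bar>)\<^sup>2 \<le> 1 / (1 / 2)\<^sup>2" using s by (intro divide_left_mono mult_pos_pos zero_less_power) auto
    then show ?thesis by (simp add: power_divide add_increasing)
  next
    case False
    have "\<epsilon>'\<^sup>2 \<le> (1 - \<bar>\<sigma>\<bar>)\<^sup>2" using False assms by (intro power_mono) auto
    then have "1 / (1 - \<bar>\<sigma>\<bar>)\<^sup>2 \<le> 1 / \<epsilon>'\<^sup>2" using assms(1) s by (intro divide_left_mono mult_pos_pos zero_less_power) auto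
    then show ?thesis by simp
  qed
  moreover have "0 \<le> 2 / \<delta>\<^sup>2" by simp
  ultimately show ?thesis using eker_bounds[OF s x] by linarith
qed

lemma E_tr_integrand: "avg_inv_sc (\<lambda>x. f x * (1 - (1 - \<sigma>\<^sup>2) / ((1 + \<sigma>)\<^sup>2 - \<sigma> * x\<^sup>2)))
    = avg_inv_sc (\<lambda>x. f x * (1 - eker \<sigma> x))"
  by (simp add: eker_def)

lemma set_integrable_over_edge:
  assumes "u \<in> borel_measurable borel" and "\<And>x. \<bar>x\<bar> \<le> 2 \<Longrightarrow> \<bar>u x\<bar> \<le> C"
  shows "set_integrable lborel {-2..2} (\<lambda>x. u x / (pi * sqrt (4 - x\<^sup>2)))"
proof (rule set_integrable_bounded_by_inverse_edge)
  show "(\<lambda>x. u x / (pi * sqrt (4 - x\<^sup>2))) \<in> borel_measurable borel" using assms(1) by measurable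
  show "\<bar>u x / (pi * sqrt (4 - x\<^sup>2))\<bar> \<le> (C / pi) / edge x" if "\<bar>x\<bar> \<le> 2" for x
    using divide_right_mono[OF assms(2)[OF that], of "pi * edge x"] edge_nonneg[OF that]
    by (simp add: edge_def abs_mult abs_divide)
qed

lemma avg_inv_sc_diff:
  assumes "u \<in> borel_measurable borel" "v \<in> borel_measurable borel"
    and "\<And>x. \<bar>x\<bar> \<le> 2 \<Longrightarrow> \<bar>u x\<bar> \<le> C" "\<And>x. \<bar>x\<bar> \<le> 2 \<Longrightarrow> \<bar>v x\<bar> \<le> C'"
  shows "avg_inv_sc (\<lambda>x. u x - v x) = avg_inv_sc u - avg_inv_sc v"
  unfolding avg_inv_sc_def diff_divide_distrib
  using set_integral_diff(2)[OF set_integrable_over_edge[OF assms(1,3)] set_integrable_over_edge[OF assms(2,4)]] .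

lemma abs_f_eker_le: "\<bar>\<sigma>\<bar> < 1 \<Longrightarrow> \<bar>x\<bar> \<le> 2 \<Longrightarrow> \<bar>k\<bar> \<le> C \<Longrightarrow> \<bar>k * eker \<sigma> x\<bar> \<le> C * (1 / (1 - \<bar>\<sigma>\<bar>)\<^sup>2)"
  unfolding abs_mult using eker_bounds[of \<sigma> x] by (intro mult_mono) auto

lemma avg_inv_sc_split:
  assumes s: "\<bar>\<sigma>\<bar> < 1"
  shows "avg_inv_sc (\<lambda>x. f x * (1 - eker \<sigma> x)) = avg_inv_sc f - avg_inv_sc (\<lambda>x. f x * eker \<sigma> x)"
  unfolding right_diff_distrib mult_1_right
  by (rule avg_inv_sc_diff[where C = B and C' = "B * (1 / (1 - \<bar>\<sigma>\<bar>)\<^sup>2)"]) (use abs_f_eker_le[OF s] f_bound in auto)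

lemma E_tr_inner_bound:
  assumes \<epsilon>': "0 < \<epsilon>'" "- 1 + \<epsilon>' \<le> \<sigma>" "\<sigma> < 1"
  shows "\<bar>E_tr f \<sigma>\<bar> \<le> (1 + (1 / \<epsilon>'\<^sup>2 + 4 + 2 / \<delta>\<^sup>2)) / \<delta> * (2 * l * B) / c"
proof -
  have s: "\<bar>\<sigma>\<bar> < 1" using \<epsilon>' by auto
  show ?thesis
    unfolding E_tr_def extend_limit_inner[OF s] E_tr_integrand
  proof (rule avg_inv_sc_f_bound)
    show "\<bar>1 - eker \<sigma> x\<bar> \<le> 1 + (1 / \<epsilon>'\<^sup>2 + 4 + 2 / \<delta>\<^sup>2)" if "f x \<noteq> 0" for x
      using eker_bulk[OF \<epsilon>' that] by linarith
  qed (simp add: add_nonneg_nonneg)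
qed

lemma E_tr_1: "E_tr f 1 = avg_inv_sc f"
  unfolding E_tr_def E_tr_integrand
proof (rule extend_limit_1)
  show "avg_inv_sc (\<lambda>x. f x * (1 - eker \<sigma> x)) = avg_inv_sc f - avg_inv_sc (\<lambda>x. f x * eker \<sigma> x)"
    if "\<bar>\<sigma>\<bar> < 1" for \<sigma> by (rule avg_inv_sc_split[OF that])
  have ev: "\<forall>\<^sub>F \<sigma> in at 1 within {-1<..<1}. 1 / 2 < \<sigma> \<and> \<sigma> < (1::real)"
    by (auto simp: eventually_at dist_real_def intro!: exI[of _ "1 / 4"])
  have "((\<lambda>\<sigma>. 2 / \<delta>\<^sup>2 * (1 - \<sigma>\<^sup>2) / \<delta> * (2 * l * B) / c) \<longlongrightarrow> 2 / \<delta>\<^sup>2 * (1 - 1\<^sup>2) / \<delta> * (2 * l * B) / c) (at 1 within {-1<..<1})"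
    using \<delta> c_pos by (intro tendsto_intros) auto
  then have z: "((\<lambda>\<sigma>. 2 / \<delta>\<^sup>2 * (1 - \<sigma>\<^sup>2) / \<delta> * (2 * l * B) / c) \<longlongrightarrow> 0) (at 1 within {-1<..<1})" by simp
  have "((\<lambda>\<sigma>. avg_inv_sc (\<lambda>x. f x * eker \<sigma> x)) \<longlongrightarrow> 0) (at 1 within {-1<..<1})"
  proof (rule Lim_null_comparison[OF _ z])
    show "\<forall>\<^sub>F \<sigma> in at 1 within {-1<..<1}. norm (avg_inv_sc (\<lambda>x. f x * eker \<sigma> x)) \<le> 2 / \<delta>\<^sup>2 * (1 - \<sigma>\<^sup>2) / \<delta> * (2 * l * B) / c"
      using ev
    proof eventually_elim
      case (elim \<sigma>)
      then have "0 \<le> 2 / \<delta>\<^sup>2 * (1 - \<sigma>\<^sup>2)" by (simp add: abs_square_le_1)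
      then have "\<bar>avg_inv_sc (\<lambda>x. f x * eker \<sigma> x)\<bar> \<le> 2 / \<delta>\<^sup>2 * (1 - \<sigma>\<^sup>2) / \<delta> * (2 * l * B) / c"
        by (rule avg_inv_sc_f_bound) (rule eker_bulk_positive, use elim in auto)
      then show ?case by simp
    qed
  qed
  from tendsto_diff[OF tendsto_const this, of "avg_inv_sc f"]
  show "((\<lambda>\<sigma>. avg_inv_sc f - avg_inv_sc (\<lambda>x. f x * eker \<sigma> x)) \<longlongrightarrow> avg_inv_sc f) (at 1 within {-1<..<1})"
    by simp
qed

lemma avg_inv_sc_eker:
  assumes "\<bar>\<sigma>\<bar> < 1"
  shows "avg_inv_sc (\<lambda>x. k * eker \<sigma> x) = k"
proof -
  have "avg_inv_sc (\<lambda>x. k * eker \<sigma> x) = (LINT x:{-2..2}|lborel. k / pi * (eker \<sigma> x / edge x))"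
    unfolding avg_inv_sc_def by (simp add: edge_def)
  also have "\<dots> = k / pi * pi"
    unfolding set_integral_mult_right integral_eker(2)[OF assms] ..
  finally show ?thesis by simp
qed

text \<open>As \<open>\<sigma> \<rightarrow> - 1\<close> the weight concentrates at \<open>x = 0\<close>.\<close>

lemma E_tr_minus_1: "E_tr f (- 1) = avg_inv_sc f - f 0"
  unfolding E_tr_def E_tr_integrand
proof (rule extend_limit_minus_1)
  \<comment> \<open>Since the weight has total mass 1, subtracting \<open>f 0\<close> isolates the
    limit, and the remainder contains an increment that tames the weight at 0.\<close>
  let ?k = "\<lambda>\<sigma> x. (f x - f 0) * eker (- \<sigma>) x"
  show "avg_inv_sc (\<lambda>x. f x * (1 - eker (- \<sigma>) x)) = avg_inv_sc f - f 0 - avg_inv_sc (?k \<sigma>)"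
    if "\<bar>\<sigma>\<bar> < 1" for \<sigma>
  proof -
    have s: "\<bar>- \<sigma>\<bar> < 1" using that by simp
    have "avg_inv_sc (?k \<sigma>) = avg_inv_sc (\<lambda>x. f x * eker (- \<sigma>) x) - avg_inv_sc (\<lambda>x. f 0 * eker (- \<sigma>) x)"
      unfolding left_diff_distrib
      by (rule avg_inv_sc_diff[where C = "B * (1 / (1 - \<bar>- \<sigma>\<bar>)\<^sup>2)" and C' = "B * (1 / (1 - \<bar>- \<sigma>\<bar>)\<^sup>2)"])
         (use abs_f_eker_le[OF s] f_bound in auto)
    then show ?thesis unfolding avg_inv_sc_split[OF s] avg_inv_sc_eker[OF s] by simp
  qed
  have ev: "\<forall>\<^sub>F \<sigma> in at 1 within {-1<..<1}. 1 / 2 < \<sigma> \<and> \<sigma> < (1::real)"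
    by (auto simp: eventually_at dist_real_def intro!: exI[of _ "1 / 4"])
  let ?i = "\<lambda>x. indicator {-2..2} x :: real"
  have "((\<lambda>\<sigma>. LINT x|lborel. ?i x *\<^sub>R (?k \<sigma> x / (pi * sqrt (4 - x\<^sup>2)))) \<longlongrightarrow> integral\<^sup>L lborel (\<lambda>x::real. 0::real))
      (at 1 within {-1<..<1})"
  proof (rule integral_dominated_convergence_within)
    show "integrable lborel (\<lambda>x. ?i x *\<^sub>R (2 * (M * c) / pi * (1 / edge x)))"
      using set_integrable_mult_right[OF set_integrable_inverse_edge, of "2 * (M * c) / pi"]
      by (simp add: set_integrable_def)
    show "(\<lambda>x. ?i x *\<^sub>R (?k \<sigma> x / (pi * sqrt (4 - x\<^sup>2)))) \<in> borel_measurable lborel" for \<sigma> by measurable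
    show "\<forall>\<^sub>F \<sigma> in at 1 within {-1<..<1}. \<forall>x. \<bar>?i x *\<^sub>R (?k \<sigma> x / (pi * sqrt (4 - x\<^sup>2)))\<bar>
        \<le> ?i x *\<^sub>R (2 * (M * c) / pi * (1 / edge x))"
      using ev
    proof eventually_elim
      case (elim \<sigma>)
      show ?case
      proof
        fix x :: real
        show "\<bar>?i x *\<^sub>R (?k \<sigma> x / (pi * sqrt (4 - x\<^sup>2)))\<bar> \<le> ?i x *\<^sub>R (2 * (M * c) / pi * (1 / edge x))"
        proof (cases "x \<in> {-2..2}")
          case True
          then have x: "\<bar>x\<bar> \<le> 2" by auto
          \<comment> \<open>The weight is t (1 + \<sigma>) / q, and t |x| \<le> t^2 + x^2 / 2 \<le>
            q. Hence |x| times the weight is at most 2 uniformly in \<sigma>, and the Lipschitz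
            bound supplies the factor |x|.\<close>
          define t q where "t = 1 - \<sigma>" and "q = t\<^sup>2 + \<sigma> * x\<^sup>2"
          have t: "0 < t" using elim by (simp add: t_def)
          have "0 \<le> (t - \<bar>x\<bar> / 2)\<^sup>2 + x\<^sup>2 / 4" by simp
          then have "t * \<bar>x\<bar> \<le> t\<^sup>2 + 1 / 2 * x\<^sup>2" by (simp add: power2_diff power_divide)
          moreover have "1 / 2 * x\<^sup>2 \<le> \<sigma> * x\<^sup>2" using elim by (intro mult_right_mono) auto
          ultimately have q: "t * \<bar>x\<bar> \<le> q" by (simp add: q_def)
          have q0: "0 < q" using t elim by (simp add: q_def add_pos_nonneg)
          have e: "eker (- \<sigma>) x = t * (1 + \<sigma>) / q"
            by (simp add: eker_def q_def t_def power2_eq_square algebra_simps)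
          have e0: "0 \<le> eker (- \<sigma>) x" unfolding e using t elim q0 by simp
          have "\<bar>x\<bar> * eker (- \<sigma>) x = t * \<bar>x\<bar> * (1 + \<sigma>) / q" unfolding e by simp
          also have "\<dots> \<le> q * 2 / q"
            using q q0 elim by (intro divide_right_mono mult_mono) auto
          finally have xe: "\<bar>x\<bar> * eker (- \<sigma>) x \<le> 2" using q0 by simp
          have "\<bar>f x - f 0\<bar> \<le> M * c * \<bar>x\<bar>"
            using lipschitz_onD[OF f_lipschitz, of x 0] by (simp add: dist_real_def)
          then have "\<bar>?k \<sigma> x\<bar> \<le> M * c * \<bar>x\<bar> * eker (- \<sigma>) x"
            unfolding abs_mult abs_of_nonneg[OF e0] using e0 by (rule mult_right_mono)
          also have "\<dots> = M * c * (\<bar>x\<bar> * eker (- \<sigma>) x)" by simp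
          also have "\<dots> \<le> M * c * 2"
            using xe lipschitz_on_nonneg[OF f_lipschitz] by (rule mult_left_mono)
          finally have "\<bar>?k \<sigma> x\<bar> / (pi * edge x) \<le> M * c * 2 / (pi * edge x)"
            using edge_nonneg[OF x] by (intro divide_right_mono) auto
          then show ?thesis
            using True edge_nonneg[OF x] by (simp add: abs_divide abs_mult edge_def mult.commute)
        qed simp
      qed
    qed
    show "((\<lambda>\<sigma>. ?i x *\<^sub>R (?k \<sigma> x / (pi * sqrt (4 - x\<^sup>2)))) \<longlongrightarrow> 0) (at 1 within {-1<..<1})" for x
    \<comment> \<open>At x = 0 the weight diverges, but the increment in front of it is 0.\<close>
    proof (cases "x = 0")
      case False
      have "((\<lambda>\<sigma>. ?i x *\<^sub>R ((f x - f 0) * ((1 - (- \<sigma>)\<^sup>2) / ((1 + - \<sigma>)\<^sup>2 - - \<sigma> * x\<^sup>2)) * (1 / (pi * sqrt (4 - x\<^sup>2)))))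
          \<longlongrightarrow> ?i x *\<^sub>R ((f x - f 0) * ((1 - (- 1)\<^sup>2) / ((1 + - 1)\<^sup>2 - - 1 * x\<^sup>2)) * (1 / (pi * sqrt (4 - x\<^sup>2)))))
          (at 1 within {-1<..<1})"
        using False by (intro tendsto_intros) auto
      then show ?thesis by (simp add: eker_def)
    qed simp
  qed simp
  then have "((\<lambda>\<sigma>. avg_inv_sc (?k \<sigma>)) \<longlongrightarrow> 0) (at 1 within {-1<..<1})"
    by (simp add: avg_inv_sc_def set_lebesgue_integral_def)
  from tendsto_diff[OF tendsto_const this, of "avg_inv_sc f - f 0"]
  show "((\<lambda>\<sigma>. avg_inv_sc f - f 0 - avg_inv_sc (?k \<sigma>)) \<longlongrightarrow> avg_inv_sc f - f 0) (at 1 within {-1<..<1})"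
    by simp
qed

lemma V_tr2_minus_1_center:
  assumes "E = 0"
  shows "\<bar>V_tr2 f (- 1) - Hhalf_inner g (\<lambda>x. g (- x)) / (4 * pi\<^sup>2)\<bar> \<le> 14 * pi / \<delta>\<^sup>2 * (4 * l * B\<^sup>2) / c"
proof -
  have E: "- E = E" using assms by simp
  have "(\<lambda>x. f (- x)) = rescaled_bump.f (\<lambda>x. g (- x)) c E"
    using f_reflected unfolding E by (simp add: fun_eq_iff)
  then show ?thesis
    using tr_form_asymptotics[OF reflected[unfolded E]]
    unfolding V_tr2_minus_1 diff_divide_distrib[symmetric] by (intro divide_4pi2_le) simp
qed

lemma V_tr2_minus_1_off_center:
  assumes "0 < \<epsilon>'" "\<epsilon>' \<le> \<bar>E\<bar>" "2 * l < c * \<epsilon>'"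
  shows "\<bar>V_tr2 f (- 1)\<bar> \<le> 16 / (\<delta>\<^sup>2 * \<epsilon>'\<^sup>2) * (2 * l * B)\<^sup>2 / c"
  unfolding V_tr2_minus_1 by (rule divide_4pi2_le[OF tr_form_reflected_bound[OF assms]])

lemma f_0_center: "E = 0 \<Longrightarrow> f 0 = g 0"
  unfolding f_def by simp

lemma f_0_off_center: "l < c * \<bar>E\<bar> \<Longrightarrow> f 0 = 0"
  using f_supp[of 0] c_pos by (auto simp: pos_le_divide_eq mult.commute)

end

lemma Hhalf_norm_square: "(Hhalf_norm g)\<^sup>2 = Hhalf_inner g g"
proof -
  have "0 \<le> Hhalf_inner g g"
    unfolding Hhalf_inner_def by (intro integral_nonneg_AE AE_I2) auto
  then show ?thesis by (simp add: Hhalf_norm_def)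
qed

section \<open>Assembling the cases of \<sigma> and E\<close>

context rescaled_bump
begin

definition T1 :: real where
  "T1 = 14 * pi / \<delta>\<^sup>2 * (4 * l * B\<^sup>2)"

text \<open>One summand for each source of error: comparison with the plane, interior \<sigma>, and
  the reflected form off the centre.\<close>

definition T2 :: "real \<Rightarrow> real" where
  "T2 \<epsilon>' = T1 + 16 / \<epsilon>' ^ 4 / \<delta>\<^sup>2 * (2 * l * B)\<^sup>2 + 16 / (\<delta>\<^sup>2 * \<epsilon>'\<^sup>2) * (2 * l * B)\<^sup>2"

definition T3 :: "real \<Rightarrow> real" where
  "T3 \<epsilon>' = max d_bound (4 * pi / \<delta> * (4 / \<epsilon>' ^ 4 * (2 * l * B)\<^sup>2 + (2 * l * B)\<^sup>2))"

definition T4 :: "real \<Rightarrow> real" where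
  "T4 \<epsilon>' = max (1 / \<delta> * (2 * l * B)) ((1 + (1 / \<epsilon>'\<^sup>2 + 4 + 2 / \<delta>\<^sup>2)) / \<delta> * (2 * l * B))"

text \<open>The factor 3, rather than 2, provides the strict inequality 2 l < c \<epsilon>'.\<close>

lemma off_center:
  assumes "0 < \<epsilon>'" "3 * l / \<epsilon>' \<le> c" "\<epsilon>' \<le> \<bar>E\<bar>"
  shows "2 * l < c * \<epsilon>'" "l < c * \<bar>E\<bar>"
proof -
  have "3 * l \<le> c * \<epsilon>'" using assms(1,2) by (simp add: field_simps)
  then show "2 * l < c * \<epsilon>'" using l by linarith
  moreover have "c * \<epsilon>' \<le> c * \<bar>E\<bar>" using assms(3) c_pos by (intro mult_left_mono) auto
  ultimately show "l < c * \<bar>E\<bar>" using l by linarith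
qed

lemma sigma_E_cases:
  assumes "(\<sigma> = 1 \<or> \<sigma> \<le> 1 - \<epsilon>') \<and> (\<sigma> = -1 \<or> -1 + \<epsilon>' \<le> \<sigma>) \<and> (\<sigma> = -1 \<longrightarrow> E = 0 \<or> \<epsilon>' \<le> \<bar>E\<bar>)"
    and "0 < \<epsilon>'" "3 * l / \<epsilon>' \<le> c"
  obtains "\<sigma> = 1" | "\<sigma> = - 1" "E = 0"
    | "\<sigma> = - 1" "E \<noteq> 0" "\<epsilon>' \<le> \<bar>E\<bar>" "2 * l < c * \<epsilon>'" "l < c * \<bar>E\<bar>"
    | "\<sigma> \<noteq> 1" "\<sigma> \<noteq> - 1" "\<bar>\<sigma>\<bar> \<le> 1 - \<epsilon>'"
proof -
  consider "\<sigma> = 1" | "\<sigma> = - 1" "E = 0" | "\<sigma> = - 1" "E \<noteq> 0" "\<epsilon>' \<le> \<bar>E\<bar>"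
    | "\<sigma> \<noteq> 1" "\<sigma> \<noteq> - 1" "\<bar>\<sigma>\<bar> \<le> 1 - \<epsilon>'"
    using assms(1) by fastforce
  then show thesis
    using that off_center[OF assms(2,3)] by cases blast+
qed

lemma V_tr2_asymptotics:
  assumes "(\<sigma> = 1 \<or> \<sigma> \<le> 1 - \<epsilon>') \<and> (\<sigma> = -1 \<or> -1 + \<epsilon>' \<le> \<sigma>) \<and> (\<sigma> = -1 \<longrightarrow> E = 0 \<or> \<epsilon>' \<le> \<bar>E\<bar>)"
    and \<epsilon>': "0 < \<epsilon>'" "3 * l / \<epsilon>' \<le> c"
  shows "\<bar>V_tr2 f \<sigma> - (of_bool (\<sigma> = 1) * (Hhalf_inner g g / (4 * pi\<^sup>2))
      + of_bool (\<sigma> = -1) * of_bool (E = 0) * (Hhalf_inner g (\<lambda>x. g (- x)) / (4 * pi\<^sup>2)))\<bar> \<le> T2 \<epsilon>' / c"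
proof -
  have "0 \<le> T1 / c" "0 \<le> 16 / \<epsilon>' ^ 4 / \<delta>\<^sup>2 * (2 * l * B)\<^sup>2 / c" "0 \<le> 16 / (\<delta>\<^sup>2 * \<epsilon>'\<^sup>2) * (2 * l * B)\<^sup>2 / c"
    using l c_pos \<epsilon>' by (simp_all add: T1_def)
  then have le: "T1 / c \<le> T2 \<epsilon>' / c" "16 / \<epsilon>' ^ 4 / \<delta>\<^sup>2 * (2 * l * B)\<^sup>2 / c \<le> T2 \<epsilon>' / c"
    "16 / (\<delta>\<^sup>2 * \<epsilon>'\<^sup>2) * (2 * l * B)\<^sup>2 / c \<le> T2 \<epsilon>' / c"
    unfolding T2_def add_divide_distrib by linarith+
  from assms show ?thesis
  proof (cases rule: sigma_E_cases)
    case 1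
    then show ?thesis
      using order_trans[OF V_tr1_asymptotics[folded T1_def] le(1)] by (simp add: V_tr2_1 V_tr1_eq)
  next
    case 2
    then show ?thesis
      using order_trans[OF V_tr2_minus_1_center[OF 2(2), folded T1_def] le(1)] by simp
  next
    case 3
    then show ?thesis
      using order_trans[OF V_tr2_minus_1_off_center[OF \<epsilon>'(1) 3(3,4)] le(3)] by simp
  next
    case 4
    then show ?thesis
      using order_trans[OF V_tr2_inner_bound[OF \<epsilon>'(1) 4(3)] le(2)] by simp
  qed
qed

lemma V_d2_asymptotics:
  assumes "(\<sigma> = 1 \<or> \<sigma> \<le> 1 - \<epsilon>') \<and> (\<sigma> = -1 \<or> -1 + \<epsilon>' \<le> \<sigma>) \<and> (\<sigma> = -1 \<longrightarrow> E = 0 \<or> \<epsilon>' \<le> \<bar>E\<bar>)"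
    and \<epsilon>': "0 < \<epsilon>'" "3 * l / \<epsilon>' \<le> c" and big: "4 * pi * rho_C \<le> \<delta> * c"
  shows "\<bar>c / rho (Complex E (1 / c)) * V_d2 f \<sigma> - (of_bool (\<sigma> = 1) * (L2_norm g)\<^sup>2
      + of_bool (\<sigma> = -1) * of_bool (E = 0) * L2_inner g (\<lambda>x. g (- x)))\<bar> \<le> T3 \<epsilon>' / c"
proof -
  have le: "d_bound / c \<le> T3 \<epsilon>' / c"
    "4 * pi / \<delta> * (4 / \<epsilon>' ^ 4 * (2 * l * B)\<^sup>2 + (2 * l * B)\<^sup>2) / c \<le> T3 \<epsilon>' / c"
    using c_pos by (intro divide_right_mono; simp add: T3_def)+
  from assms(1-3) show ?thesis
  proof (cases rule: sigma_E_cases)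
    case 1
    then show ?thesis
      using order_trans[OF V_d1_asymptotics[OF big] le(1)] by (simp add: V_d2_1)
  next
    case 2
    then show ?thesis
      using order_trans[OF V_d2_minus_1_center[OF big 2(2)] le(1)] by simp
  next
    case 3
    then show ?thesis
      using order_trans[OF V_d2_minus_1_off_center[OF big 3(5)] le(1)] by simp
  next
    case 4
    then show ?thesis
      using order_trans[OF V_d2_inner_bound[OF big \<epsilon>'(1) 4(3)] le(2)] by simp
  qed
qed

lemma E_tr_asymptotics:
  assumes "\<sigma> \<le> 1" "\<sigma> = -1 \<or> -1 + \<epsilon>' \<le> \<sigma>" "\<sigma> = -1 \<longrightarrow> E = 0 \<or> \<epsilon>' \<le> \<bar>E\<bar>"
    and \<epsilon>': "0 < \<epsilon>'" "3 * l / \<epsilon>' \<le> c"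
  shows "\<bar>- (1 / 2) * E_tr f \<sigma> - of_bool (\<sigma> = -1) * of_bool (E = 0) * (g 0 / 2)\<bar> \<le> T4 \<epsilon>' / c"
proof -
  have le: "1 / \<delta> * (2 * l * B) / c \<le> T4 \<epsilon>' / c"
    "(1 + (1 / \<epsilon>'\<^sup>2 + 4 + 2 / \<delta>\<^sup>2)) / \<delta> * (2 * l * B) / c \<le> T4 \<epsilon>' / c"
    using c_pos by (intro divide_right_mono; simp add: T4_def)+
  note avg = order_trans[OF avg_inv_sc_f_bound_1 le(1)]
  have half: "\<bar>- (1 / 2) * x - y\<bar> \<le> z" if "\<bar>x + 2 * y\<bar> \<le> z" for x y z :: real
    using that by linarith
  consider "\<sigma> = 1" | "\<sigma> = - 1" "E = 0" | "\<sigma> = - 1" "E \<noteq> 0" "\<epsilon>' \<le> \<bar>E\<bar>" | "\<sigma> < 1" "\<sigma> \<noteq> - 1" "- 1 + \<epsilon>' \<le> \<sigma>"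
    using assms(1-3) by fastforce
  then show ?thesis
  proof (cases; intro half)
    case 1
    then show "\<bar>E_tr f \<sigma> + 2 * (of_bool (\<sigma> = -1) * of_bool (E = 0) * (g 0 / 2))\<bar> \<le> T4 \<epsilon>' / c"
      using avg E_tr_1 by simp
  next
    case 2
    then have "E_tr f \<sigma> + 2 * (of_bool (\<sigma> = -1) * of_bool (E = 0) * (g 0 / 2)) = avg_inv_sc f"
      using E_tr_minus_1 f_0_center[OF 2(2)] by simp
    then show "\<bar>E_tr f \<sigma> + 2 * (of_bool (\<sigma> = -1) * of_bool (E = 0) * (g 0 / 2))\<bar> \<le> T4 \<epsilon>' / c"
      using avg by simp
  next
    case 3
    then show "\<bar>E_tr f \<sigma> + 2 * (of_bool (\<sigma> = -1) * of_bool (E = 0) * (g 0 / 2))\<bar> \<le> T4 \<epsilon>' / c"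
      using avg E_tr_minus_1 f_0_off_center[OF off_center(2)[OF \<epsilon>' 3(3)]] by simp
  next
    case 4
    then show "\<bar>E_tr f \<sigma> + 2 * (of_bool (\<sigma> = -1) * of_bool (E = 0) * (g 0 / 2))\<bar> \<le> T4 \<epsilon>' / c"
      using order_trans[OF E_tr_inner_bound[OF \<epsilon>'(1) 4(3,1)] le(2)] by simp
  qed
qed

end

text \<open>The radius |L| + 1 is positive for every L, and g vanishes at the point |L| + 1. The
  supremum bound follows from the Lipschitz bound over the distance to that point. Half of
  \<epsilon> is spent on the radius l / c, the other half remains as \<delta>.\<close>

lemma H20_ball_rescaled_bump:
  assumes g: "g \<in> H20_ball K L" and E: "\<bar>E\<bar> \<le> 2 - \<epsilon>" and "0 < \<epsilon>"
    and c: "1 \<le> c" "(\<bar>L\<bar> + 1) / (\<epsilon> / 2) \<le> c"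
  shows "rescaled_bump g (2 * K + 1) ((2 * K + 1) * (2 * (\<bar>L\<bar> + 1))) (\<bar>L\<bar> + 1) (\<epsilon> / 2) c E"
proof
  note p = H20_ball_properties[OF g]
  show "(2 * K + 1)-lipschitz_on UNIV g" by (rule p(1))
  show "\<bar>x\<bar> \<le> \<bar>L\<bar> + 1" if "g x \<noteq> 0" for x using p(3)[OF that] by linarith
  show "\<bar>g x\<bar> \<le> (2 * K + 1) * (2 * (\<bar>L\<bar> + 1))" for x
  proof (cases "g x = 0")
    case False
    have "g (\<bar>L\<bar> + 1) = 0" using p(3)[of "\<bar>L\<bar> + 1"] by linarith
    then have "\<bar>g x\<bar> \<le> (2 * K + 1) * \<bar>x - (\<bar>L\<bar> + 1)\<bar>"
      using lipschitz_onD[OF p(1), of x "\<bar>L\<bar> + 1"] by (simp add: dist_real_def)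
    also have "\<dots> \<le> (2 * K + 1) * (2 * (\<bar>L\<bar> + 1))"
      using p(2) p(3)[OF False] by (intro mult_left_mono) auto
    finally show ?thesis .
  qed (use p(2) in simp)
  have "(\<bar>L\<bar> + 1) / c \<le> \<epsilon> / 2"
    using c \<open>0 < \<epsilon>\<close> by (simp add: field_simps)
  then show "\<bar>E\<bar> + (\<bar>L\<bar> + 1) / c \<le> 2 - \<epsilon> / 2" using E by linarith
qed (use \<open>0 < \<epsilon>\<close> c in auto)

section \<open>Thresholds and constants uniform over the Sobolev ball\<close>

theorem proposition2p9:
  fixes a \<epsilon> K L :: real
  assumes "0 < a" and "a < 1" and "0 < \<epsilon>"
  shows
    "(\<exists>C. \<forall>\<^sub>F N in sequentially. \<forall>g\<in>H20_ball K L. \<forall>E. \<bar>E\<bar> \<le> 2 - \<epsilon> \<longrightarrow>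
        \<bar>V_tr1 (rescale a E N g) - (Hhalf_norm g)\<^sup>2 / (4 * pi\<^sup>2)\<bar> \<le> C * real N powr (- a))
   \<and> (\<forall>\<epsilon>'>0. \<exists>C. \<forall>\<^sub>F N in sequentially. \<forall>g\<in>H20_ball K L. \<forall>E. \<forall>\<sigma>\<in>{-1..1}.
        \<bar>E\<bar> \<le> 2 - \<epsilon> \<and> (\<sigma> = 1 \<or> \<sigma> \<le> 1 - \<epsilon>') \<and> (\<sigma> = -1 \<or> -1 + \<epsilon>' \<le> \<sigma>) \<and>
        (\<sigma> = -1 \<longrightarrow> E = 0 \<or> \<epsilon>' \<le> \<bar>E\<bar>) \<longrightarrow>
        \<bar>V_tr2 (rescale a E N g) \<sigma>
          - (of_bool (\<sigma> = 1) * ((Hhalf_norm g)\<^sup>2 / (4 * pi\<^sup>2))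
             + of_bool (\<sigma> = -1) * of_bool (E = 0) * (Hhalf_inner g (\<lambda>x. g (- x)) / (4 * pi\<^sup>2)))\<bar>
        \<le> C * real N powr (- a))
   \<and> (\<exists>C. \<forall>\<^sub>F N in sequentially. \<forall>g\<in>H20_ball K L. \<forall>E. \<bar>E\<bar> \<le> 2 - \<epsilon> \<longrightarrow>
        \<bar>C_N a E N * V_d1 (rescale a E N g) - (L2_norm g)\<^sup>2\<bar> \<le> C * real N powr (- a))
   \<and> (\<forall>\<epsilon>'>0. \<exists>C. \<forall>\<^sub>F N in sequentially. \<forall>g\<in>H20_ball K L. \<forall>E. \<forall>\<sigma>\<in>{-1..1}.
        \<bar>E\<bar> \<le> 2 - \<epsilon> \<and> (\<sigma> = 1 \<or> \<sigma> \<le> 1 - \<epsilon>') \<and> (\<sigma> = -1 \<or> -1 + \<epsilon>' \<le> \<sigma>) \<and>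
        (\<sigma> = -1 \<longrightarrow> E = 0 \<or> \<epsilon>' \<le> \<bar>E\<bar>) \<longrightarrow>
        \<bar>C_N a E N * V_d2 (rescale a E N g) \<sigma>
          - (of_bool (\<sigma> = 1) * (L2_norm g)\<^sup>2
             + of_bool (\<sigma> = -1) * of_bool (E = 0) * L2_inner g (\<lambda>x. g (- x)))\<bar>
        \<le> C * real N powr (- a))
   \<and> (\<forall>\<epsilon>'>0. \<exists>C. \<forall>\<^sub>F N in sequentially. \<forall>g\<in>H20_ball K L. \<forall>E. \<forall>\<sigma>\<in>{-1..1}.
        \<bar>E\<bar> \<le> 2 - \<epsilon> \<and> (\<sigma> = -1 \<or> -1 + \<epsilon>' \<le> \<sigma>) \<and>
        (\<sigma> = -1 \<longrightarrow> E = 0 \<or> \<epsilon>' \<le> \<bar>E\<bar>) \<longrightarrow>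
        \<bar>- (1 / 2) * E_tr (rescale a E N g) \<sigma>
          - of_bool (\<sigma> = -1) * of_bool (E = 0) * (g 0 / 2)\<bar>
        \<le> C * real N powr (- a))"
proof -
  define \<delta> l M B where "\<delta> = \<epsilon> / 2" and "l = \<bar>L\<bar> + 1" and "M = 2 * K + 1" and "B = (2 * K + 1) * (2 * (\<bar>L\<bar> + 1))"
  define c where "c N = real N powr a" for N :: nat
  \<comment> \<open>Collects the lower bounds on N^a: \<open>c \<ge> 1\<close>, support in the bulk,
    density bounded below, separation of the reflected supports. None of them involves g, E or
    \<sigma>, which is what makes the threshold uniform.\<close>
  define X where "X \<epsilon>' = Max {1, l / \<delta>, 4 * pi * rescaled_bump.rho_C \<delta> / \<delta>, 3 * l / \<epsilon>'}" for \<epsilon>'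
  have \<delta>: "0 < \<delta>" using \<open>0 < \<epsilon>\<close> by (simp add: \<delta>_def)
  have inv: "C * real N powr (- a) = C / c N" for C N
    by (simp add: c_def powr_minus_divide)
  have CN: "C_N a E N = c N / rho (Complex E (1 / c N))" for E N
    by (simp add: C_N_def c_def powr_minus_divide)
  have ev: "\<forall>\<^sub>F N in sequentially. X \<epsilon>' \<le> c N" for \<epsilon>'
  proof -
    have "\<forall>\<^sub>F N in sequentially. X \<epsilon>' powr (1 / a) \<le> real N"
      using filterlim_real_sequentially by (simp add: filterlim_at_top)
    then show ?thesis
    proof eventually_elim
      case (elim N)
      then have "(X \<epsilon>' powr (1 / a)) powr a \<le> c N"
        unfolding c_def using \<open>0 < a\<close> by (intro powr_mono2) auto
      moreover have "1 \<le> X \<epsilon>'" unfolding X_def by (rule Max_ge) auto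
      ultimately show ?case using \<open>0 < a\<close> by (simp add: powr_powr)
    qed
  qed
  have X: "1 \<le> c N" "l / \<delta> \<le> c N" "4 * pi * rescaled_bump.rho_C \<delta> \<le> \<delta> * c N" "3 * l / \<epsilon>' \<le> c N"
    if "X \<epsilon>' \<le> c N" for \<epsilon>' N
    using that \<delta> by (auto simp: X_def field_simps)
  have bump: "rescaled_bump g M B l \<delta> (c N) E" "rescale a E N g = rescaled_bump.f g (c N) E"
    if "g \<in> H20_ball K L" "\<bar>E\<bar> \<le> 2 - \<epsilon>" "X \<epsilon>' \<le> c N" for g E N \<epsilon>'
  proof -
    show b: "rescaled_bump g M B l \<delta> (c N) E"
      using H20_ball_rescaled_bump[OF that(1,2) \<open>0 < \<epsilon>\<close> X(1)[OF that(3)]] X(2)[OF that(3)]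
      unfolding \<delta>_def l_def M_def B_def by blast
    show "rescale a E N g = rescaled_bump.f g (c N) E"
      unfolding fun_eq_iff rescaled_bump.f_def[OF b] by (simp add: rescale_def c_def)
  qed
  \<comment> \<open>Turns an estimate valid beyond the threshold for a fixed constant into the
    required quantifier order, the constant being chosen before N, g, E and \<sigma>.\<close>
  have uniform: "\<exists>C. \<forall>\<^sub>F N in sequentially. Q (C * real N powr (- a)) N"
    if "\<And>N. X \<epsilon>' \<le> c N \<Longrightarrow> Q (C / c N) N" for Q C \<epsilon>'
    using eventually_mono[OF ev[of \<epsilon>'], of "\<lambda>N. Q (C * real N powr (- a)) N"] that
    unfolding inv by blast
  show ?thesis
  proof (intro conjI allI impI, goal_cases)
    case 1
    show ?case
    \<comment> \<open>There is no gap parameter in this formula, so the threshold is taken with the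
      arbitrary value 1.\<close>
    proof (rule uniform[where C = "rescaled_bump.T1 B l \<delta>" and \<epsilon>' = 1], intro ballI allI impI)
      fix N g E assume g: "g \<in> H20_ball K L" "\<bar>E\<bar> \<le> 2 - \<epsilon>" and N: "X 1 \<le> c N"
      interpret rescaled_bump g M B l \<delta> "c N" E by (rule bump(1)[OF g N])
      show "\<bar>V_tr1 (rescale a E N g) - (Hhalf_norm g)\<^sup>2 / (4 * pi\<^sup>2)\<bar> \<le> T1 / c N"
        unfolding bump(2)[OF g N] Hhalf_norm_square T1_def by (rule V_tr1_asymptotics)
    qed
  next
    case (2 \<epsilon>')
    show ?case
    proof (rule uniform[where C = "rescaled_bump.T2 B l \<delta> \<epsilon>'" and \<epsilon>' = \<epsilon>'], intro ballI allI impI, elim conjE, goal_cases)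
      case (1 N g E \<sigma>)
      interpret rescaled_bump g M B l \<delta> "c N" E by (rule bump(1)[OF 1(2,4,1)])
      show ?case
        unfolding bump(2)[OF 1(2,4,1)] Hhalf_norm_square
        by (intro V_tr2_asymptotics 2 X(4)[OF 1(1)] conjI 1)
    qed
  next
    case 3
    show ?case
    proof (rule uniform[where C = "rescaled_bump.d_bound B l \<delta>" and \<epsilon>' = 1], intro ballI allI impI)
      fix N g E assume g: "g \<in> H20_ball K L" "\<bar>E\<bar> \<le> 2 - \<epsilon>" and N: "X 1 \<le> c N"
      interpret rescaled_bump g M B l \<delta> "c N" E by (rule bump(1)[OF g N])
      show "\<bar>C_N a E N * V_d1 (rescale a E N g) - (L2_norm g)\<^sup>2\<bar> \<le> d_bound / c N"
        unfolding bump(2)[OF g N] CN by (rule V_d1_asymptotics[OF X(3)[OF N]])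
    qed
  next
    case (4 \<epsilon>')
    show ?case
    proof (rule uniform[where C = "rescaled_bump.T3 B l \<delta> \<epsilon>'" and \<epsilon>' = \<epsilon>'], intro ballI allI impI, elim conjE, goal_cases)
      case (1 N g E \<sigma>)
      interpret rescaled_bump g M B l \<delta> "c N" E by (rule bump(1)[OF 1(2,4,1)])
      show ?case
        unfolding bump(2)[OF 1(2,4,1)] CN
        by (intro V_d2_asymptotics 4 X(3,4)[OF 1(1)] conjI 1)
    qed
  next
    case (5 \<epsilon>')
    show ?case
    proof (rule uniform[where C = "rescaled_bump.T4 B l \<delta> \<epsilon>'" and \<epsilon>' = \<epsilon>'], intro ballI allI impI, elim conjE, goal_cases)
      case (1 N g E \<sigma>)
      interpret rescaled_bump g M B l \<delta> "c N" E by (rule bump(1)[OF 1(2,4,1)])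
      show ?case
        unfolding bump(2)[OF 1(2,4,1)]
        by (intro E_tr_asymptotics 5 X(4)[OF 1(1)] 1) (use 1(3) in simp)
    qed
  qed
qed

end
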